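(* Let $i\in\{1,2,3\}$ and $y^0\in S^{f^{(i)}}$. Then the quenching time optimal control problem $(P)^{f^{(i)}}_{y^0}$, namely $\min_{u\in\mathcal U_{ad}} T_q(f^{(i)},y^0,u)$, has optimal controls; that is, there exists $u^*\in\mathcal U_{ad}$ with $T_q(f^{(i)},y^0,u^* )=t^*(f^{(i)},y^0):=\inf_{u\in\mathcal U_{ad}}T_q(f^{(i)},y^0,u)$.
   Context: Notation: $\|\cdot\|$ is the Euclidean norm on $\mathbb R^2$ (and the operator norm for matrices), $R^+=[0,+\infty)$. Fix a nontrivial (not a.e. zero) $B\in L^\infty(0,+\infty;\mathbb R^{2\times2})$ and $\rho_0>0$. Controls: $\mathcal U_{ad}=\{u:R^+\to\mathbb R^2:\ u \text{ Lebesgue measurable},\ \|u(t)\|\le\rho_0\text{ for a.e. }t\in R^+\}$. Put $K_0=\operatorname{ess\,sup}_{s\in R^+}\|B(s)\|\,\rho_0$. Vector fields (for $y=(y_1,y_2)^T$): $f^{(1)}(y)=\left(\frac{y_2}{1-y_1},\,y_1+y_2\right)^T$ on $\{y_1\ne1\}$; $f^{(2)}(y)=\left(\frac{y_1}{1-\|y\|},\,\frac{y_2}{1-\|y\|}\right)^T$ on $\{\|y\|\neq1\}$; $f^{(3)}(y)=\left(\frac1{1-y_2},\,\frac1{1-y_1}\right)^T$ on $\{y_1\ne1,\ y_2\neq1\}$. Sets of initial data: $S^{f^{(1)}}=\{z\in\mathbb R^2: z_1\in(1-\frac1{2K_0},1),\ z_2\in(K_0+\frac1{K_0}-1,+\infty)\}\cup\{z\in\mathbb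 R^2: z_1\in(1,1+\frac1{2K_0}),\ z_2\in(K_0+1,+\infty)\}$; $S^{f^{(2)}}=\{z\in\mathbb R^2:\|z\|\in(1-\frac1{2K_0+1},1)\}\cup\{z\in\mathbb R^2:\|z\|\in(1,1+\frac1{2K_0})\}$; $S^{f^{(3)}}=\{z\in\mathbb R^2: z_1,z_2\in(1-\frac{e^{-3/2}}{2K_0},1)\}\cup\{z\in\mathbb R^2: z_1,z_2\in(1,1+\frac{e^{-3/2}}{2K_0})\}$. For $f\in\{f^{(1)},f^{(2)},f^{(3)}\}$, $y^0\in S^f$, $u\in\mathcal U_{ad}$, let $y(\cdot\,;f,y^0,u)$ be the unique (absolutely continuous, with values in the domain of $f$) solution of $\frac{dy}{dt}=f(y(t))+B(t)u(t)$, $t>0$, $y(0)=y^0$, with maximal interval of existence $[0,T_{max}(f,y^0,u))$. For all such $f,y^0,u$ there is a unique time $T_q(f,y^0,u)\le T_{max}(f,y^0,u)$, called the quenching time, such that $0<T_q(f,y^0,u)<+\infty$, $\lim_{t\to T_q(f,y^0,u)}\|f(y(t;f,y^0,u))\|=+\infty$, and $\|f(y(t;f,y^0,u))\|<+\infty$ for $t\in[0,T_q(f,y^0,u))$. *)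

theory Defs
  imports "HOL-Analysis.Analysis" "HOL-Probability.Essential_Supremum"
begin

definition f1 :: "real^2 \<Rightarrow> real^2" where
  "f1 y = vector [y$2 / (1 - y$1), y$1 + y$2]"

definition dom_f1 :: "(real^2) set" where
  "dom_f1 = {y. y$1 \<noteq> 1}"

definition f2 :: "real^2 \<Rightarrow> real^2" where
  "f2 y = vector [y$1 / (1 - norm y), y$2 / (1 - norm y)]"

definition dom_f2 :: "(real^2) set" where
  "dom_f2 = {y. norm y \<noteq> 1}"

definition f3 :: "real^2 \<Rightarrow> real^2" where
  "f3 y = vector [1 / (1 - y$2), 1 / (1 - y$1)]"

definition dom_f3 :: "(real^2) set" where
  "dom_f3 = {y. y$1 \<noteq> 1 \<and> y$2 \<noteq> 1}"

definition S_f1 :: "real \<Rightarrow> (real^2) set" where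
  "S_f1 K0 =
     {z. z$1 \<in> {1 - 1 / (2 * K0) <..< 1} \<and> z$2 \<in> {K0 + 1 / K0 - 1 <..}} \<union>
     {z. z$1 \<in> {1 <..< 1 + 1 / (2 * K0)} \<and> z$2 \<in> {K0 + 1 <..}}"

definition S_f2 :: "real \<Rightarrow> (real^2) set" where
  "S_f2 K0 =
     {z. norm z \<in> {1 - 1 / (2 * K0 + 1) <..< 1}} \<union>
     {z. norm z \<in> {1 <..< 1 + 1 / (2 * K0)}}"

definition S_f3 :: "real \<Rightarrow> (real^2) set" where
  "S_f3 K0 =
     {z. z$1 \<in> {1 - exp (- 3 / 2) / (2 * K0) <..< 1} \<and>
         z$2 \<in> {1 - exp (- 3 / 2) / (2 * K0) <..< 1}} \<union>
     {z. z$1 \<in> {1 <..< 1 + exp (- 3 / 2) / (2 * K0)} \<and>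
         z$2 \<in> {1 <..< 1 + exp (- 3 / 2) / (2 * K0)}}"

definition L_infty :: "(real \<Rightarrow> real^2^2) \<Rightarrow> bool" where
  "L_infty B \<longleftrightarrow>
     B \<in> borel_measurable (lebesgue_on {0<..}) \<and>
     esssup (lebesgue_on {0<..}) (\<lambda>s. ereal (onorm ((*v) (B s)))) < \<infinity>"

definition K_zero :: "(real \<Rightarrow> real^2^2) \<Rightarrow> real \<Rightarrow> real" where
  "K_zero B \<rho>0 =
     real_of_ereal (esssup (lebesgue_on {0..}) (\<lambda>s. ereal (onorm ((*v) (B s))))) * \<rho>0"

text \<open>Controls are total functions on the reals; their values at negative times play no role.\<close>

definition U_ad :: "real \<Rightarrow> (real \<Rightarrow> real^2) set" where
  "U_ad \<rho>0 = {u. u \<in> borel_measurable (lebesgue_on {0..}) \<and>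
                 (AE t in lebesgue_on {0..}. norm (u t) \<le> \<rho>0)}"

text \<open>The usual epsilon-delta notion: a division of its own union is a finite family of
  non-overlapping compact intervals, and each member \<open>k\<close> is the interval from \<open>Inf k\<close> to
  \<open>Sup k\<close>.\<close>

definition abs_continuous_on :: "real set \<Rightarrow> (real \<Rightarrow> real^2) \<Rightarrow> bool" where
  "abs_continuous_on S y \<longleftrightarrow>
     (\<forall>\<epsilon>>0. \<exists>\<delta>>0. \<forall>\<D>. \<D> division_of \<Union>\<D> \<and> \<Union>\<D> \<subseteq> S \<and> (\<Sum>k\<in>\<D>. Sup k - Inf k) < \<delta>
        \<longrightarrow> (\<Sum>k\<in>\<D>. norm (y (Sup k) - y (Inf k))) < \<epsilon>)"

text \<open>A solution on \<open>[0, T)\<close>, where \<open>T\<close> may be infinite, stays in the domain \<open>D\<close> of the vector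
  field and is absolutely continuous on every compact subinterval.\<close>

definition solves_on ::
  "(real^2 \<Rightarrow> real^2) \<Rightarrow> (real^2) set \<Rightarrow> (real \<Rightarrow> real^2^2) \<Rightarrow> real^2 \<Rightarrow> (real \<Rightarrow> real^2)
     \<Rightarrow> ereal \<Rightarrow> (real \<Rightarrow> real^2) \<Rightarrow> bool" where
  "solves_on f D B y0 u T y \<longleftrightarrow>
     0 < T \<and> y 0 = y0 \<and>
     (\<forall>t. 0 \<le> t \<and> ereal t < T \<longrightarrow> y t \<in> D) \<and>
     (\<forall>b. 0 \<le> b \<and> ereal b < T \<longrightarrow> abs_continuous_on {0..b} y) \<and>
     (AE t in lebesgue. 0 < t \<and> ereal t < T \<longrightarrow>
        (y has_vector_derivative (f (y t) + B t *v u t)) (at t))"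

definition T_max ::
  "(real^2 \<Rightarrow> real^2) \<Rightarrow> (real^2) set \<Rightarrow> (real \<Rightarrow> real^2^2) \<Rightarrow> real^2 \<Rightarrow> (real \<Rightarrow> real^2)
     \<Rightarrow> ereal" where
  "T_max f D B y0 u = Sup {T. \<exists>y. solves_on f D B y0 u T y}"

text \<open>The maximal solution; only its values on \<open>[0, T_max)\<close>, where it is unique, are used.\<close>

definition traj ::
  "(real^2 \<Rightarrow> real^2) \<Rightarrow> (real^2) set \<Rightarrow> (real \<Rightarrow> real^2^2) \<Rightarrow> real^2 \<Rightarrow> (real \<Rightarrow> real^2)
     \<Rightarrow> real \<Rightarrow> real^2" where
  "traj f D B y0 u = (SOME y. solves_on f D B y0 u (T_max f D B y0 u) y)"

text \<open>Since \<open>f\<close> is a total function here, finiteness of \<open>norm (f (y t))\<close> before the quenching time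
  is the requirement that \<open>y t\<close> lies in the domain \<open>D\<close>.\<close>

definition is_quenching_time ::
  "(real^2 \<Rightarrow> real^2) \<Rightarrow> (real^2) set \<Rightarrow> (real \<Rightarrow> real^2^2) \<Rightarrow> real^2 \<Rightarrow> (real \<Rightarrow> real^2)
     \<Rightarrow> real \<Rightarrow> bool" where
  "is_quenching_time f D B y0 u T \<longleftrightarrow>
     0 < T \<and> ereal T \<le> T_max f D B y0 u \<and>
     filterlim (\<lambda>t. norm (f (traj f D B y0 u t))) at_top (at_left T) \<and>
     (\<forall>t\<in>{0..<T}. traj f D B y0 u t \<in> D)"

definition T_q ::
  "(real^2 \<Rightarrow> real^2) \<Rightarrow> (real^2) set \<Rightarrow> (real \<Rightarrow> real^2^2) \<Rightarrow> real^2 \<Rightarrow> (real \<Rightarrow> real^2)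
     \<Rightarrow> real" where
  "T_q f D B y0 u = (THE T. is_quenching_time f D B y0 u T)"

end

theory Submission
  imports Defs "HOL-Complex_Analysis.Great_Picard"
begin

text \<open>
  The control enters the equation only through the primitive \<open>w(t)\<close> of \<open>B u\<close> on \<open>[0, t]\<close>, which is
  Lipschitz with constant \<open>K\<^sub>0\<close>. In integrated form the equation is
  \<open>y(t) = y\<^sup>0 + w(t) + (integral of f(y) on [0, t])\<close>, a Volterra equation that depends on the
  control through the continuous function \<open>w\<close> alone. This splits the theorem into three independent
  facts.

  First, the quenching time is lower semicontinuous in \<open>w\<close>. If the solution for \<open>w\<close> exists on a
  closed interval \<open>[0, b]\<close>, then it runs in a compact part of the domain of \<open>f\<close>, and Picard iteration
  started at it converges for every forcing uniformly close to \<open>w\<close>, so that solutions for nearby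
  forcings exist on \<open>[0, b]\<close> as well (\<open>int_sol_perturb\<close>).

  Second, for the three vector fields the quenching time is the end of the maximal interval of
  existence. In the given regions the distance to the singular set (\<open>\<bar>1 - y\<^sub>1\<bar>\<close>, \<open>\<bar>1 - \<parallel>y\<parallel>\<bar>\<close> or
  \<open>\<bar>1 - y\<^sub>i\<bar>\<close>) drives the solution towards that set at a rate that beats \<open>K\<^sub>0\<close> twofold. So the distance
  decreases at a rate of at least \<open>K\<^sub>0\<close>, the solution ends in finite time, and it either blows up in the
  sense of quenching or stays in a compact part of the domain, in which case it could be continued
  (\<open>T_max_eq_T_q\<close>).

  Third, the set of forcings of admissible controls is closed under uniform convergence on compact
  intervals (\<open>forcing_set_closed\<close>). This replaces weak compactness of the set of controls: among the
  admissible controls whose forcing is close to the limit, those of nearly minimal \<open>L\<^sup>2\<close> norm form an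
  \<open>L\<^sup>2\<close> Cauchy sequence by the parallelogram law, and their limit is the control sought.

  Given these, take controls \<open>u\<^sub>n\<close> whose quenching times converge to the infimum \<open>t\<^sup>*\<close>. By Arzela-Ascoli
  a subsequence of their forcings converges uniformly, and the limit is the forcing of an admissible
  control \<open>v\<close>. If the quenching time of \<open>v\<close> exceeded some \<open>b > t\<^sup>*\<close>, lower semicontinuity would
  make the quenching times of \<open>u\<^sub>n\<close> exceed \<open>b\<close> as well.

  The passage between the differential form of the equation, with derivatives almost everywhere, and
  the integrated form rests on two classical theorems on the line, which are proved first: the
  differentiation theorem for indefinite integrals and the fundamental theorem of calculus for
  absolutely continuous functions.
\<close>

hide_const (open) Polynomial.content

section \<open>Differentiation and integration of absolutely continuous functions\<close>

text \<open>
  At a point \<open>t\<close> where the difference quotients of the indefinite integral stay \<open>\<epsilon>\<close> away from \<open>g t\<close>,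
  there are arbitrarily short intervals with end point \<open>t\<close> on which the Riemann term with tag \<open>t\<close>
  misses the integral by more than \<open>\<epsilon>\<close> times the length. Vitali's theorem selects disjoint ones that
  cover almost all such points. Finitely many of them form a tagged partial division, so Henstock's
  lemma makes their total length as small as desired.
\<close>
lemma negligible_no_derivative_indefinite_integral:
  fixes g :: "real \<Rightarrow> 'a::euclidean_space"
  assumes g: "g integrable_on {a..b}"
  shows "negligible {t\<in>{a<..<b}. \<not> ((\<lambda>t. integral {a..t} g) has_vector_derivative g t) (at t)}"
proof -
  define F where "F t = integral {a..t} g" for t
  define bad where "bad \<epsilon> t s \<longleftrightarrow> s \<in> {a<..<b} \<and> s \<noteq> t \<and> \<epsilon> * \<bar>s - t\<bar> < norm (F s - F t - (s - t) *\<^sub>R g t)"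
    for \<epsilon> t s
  define E where "E \<epsilon> = {t\<in>{a<..<b}. \<forall>d>0. \<exists>s. \<bar>s - t\<bar> < d \<and> bad \<epsilon> t s}" for \<epsilon>
  have F_diff: "integral {s..t} g = F t - F s" if "a \<le> s" "s \<le> t" "t \<le> b" for s t
  proof -
    have "integral {a..s} g + integral {s..t} g = integral {a..t} g"
      by (rule Henstock_Kurzweil_Integration.integral_combine)
        (use that g in \<open>auto intro: integrable_on_subinterval\<close>)
    then show ?thesis by (simp add: F_def algebra_simps)
  qed
  have negE: "negligible (E \<epsilon>)" if "\<epsilon> > 0" for \<epsilon>
    unfolding negligible_outer
  proof (intro allI impI)
    fix \<eta> :: real assume "\<eta> > 0"
    then have "\<eta> / 2 * \<epsilon> > 0" using \<open>\<epsilon> > 0\<close> by simp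
    then obtain \<gamma> where \<gamma>: "gauge \<gamma>"
      and hen: "\<And>p. \<lbrakk>p tagged_partial_division_of (cbox a b); \<gamma> fine p\<rbrakk> \<Longrightarrow>
             (\<Sum>(x,k)\<in>p. norm (content k *\<^sub>R g x - integral k g)) < \<eta> / 2 * \<epsilon>"
      using Henstock_lemma[of g a b "\<eta> / 2 * \<epsilon>"] g by (auto simp: cbox_interval)
    \<comment> \<open>An interval of the Vitali cover is stored as the pair \<open>(t, s)\<close> of its tag \<open>t\<close> and its
       other end point \<open>s\<close>, which may lie on either side of \<open>t\<close>.\<close>
    define I where "I = (\<lambda>(t::real, s). {min t s..max t s})"
    define c where "c = (\<lambda>(t::real, s). (t + s) / 2)"
    define r where "r = (\<lambda>(t::real, s). \<bar>s - t\<bar> / 2)"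
    define K where "K = {(t, s). t \<in> E \<epsilon> \<and> bad \<epsilon> t s \<and> I (t, s) \<subseteq> \<gamma> t}"
    have I_cball: "cball (c i) (r i) = I i" for i
      by (cases i) (auto simp: c_def r_def I_def cball_eq_atLeastAtMost min_def max_def field_simps)
    obtain C where C: "countable C" "C \<subseteq> K"
      "pairwise (\<lambda>i j. disjnt (cball (c i) (r i)) (cball (c j) (r j))) C"
      "negligible (E \<epsilon> - (\<Union>i\<in>C. cball (c i) (r i)))"
    proof (rule Vitali_covering_theorem_cballs[of K r "E \<epsilon>" c])
      show "0 < r i" if "i \<in> K" for i
        using that by (auto simp: K_def r_def bad_def)
      show "\<exists>i. i \<in> K \<and> x \<in> cball (c i) (r i) \<and> r i < d" if x: "x \<in> E \<epsilon>" and "0 < d" for x d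
      proof -
        obtain \<rho> where \<rho>: "\<rho> > 0" "ball x \<rho> \<subseteq> \<gamma> x"
          using \<gamma> by (meson gauge_def openE)
        obtain s where s: "\<bar>s - x\<bar> < min d \<rho>" "bad \<epsilon> x s"
          using x \<open>0 < d\<close> \<rho>(1) unfolding E_def by (auto dest: spec[of _ "min d \<rho>"])
        have "I (x, s) \<subseteq> ball x \<rho>"
          using s(1) by (auto simp: I_def dist_real_def)
        then have "(x, s) \<in> K" using x s(2) \<rho>(2) by (auto simp: K_def)
        moreover have "x \<in> cball (c (x, s)) (r (x, s))" unfolding I_cball by (simp add: I_def)
        moreover have "r (x, s) < d" using s(1) \<open>0 < d\<close> by (simp add: r_def)
        ultimately show ?thesis by blast
      qed
    qed (rule that; assumption)
    have disj: "I i \<inter> I j = {}" if "i \<in> C" "j \<in> C" "i \<noteq> j" for i j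
      using C(3) that unfolding pairwise_def I_cball disjnt_def by blast
    have fin: "measure lebesgue (\<Union> (I ` C')) \<le> \<eta> / 2" if C': "C' \<subseteq> C" "finite C'" for C'
    proof -
      define p where "p = (\<lambda>i. (fst i, I i)) ` C'"
      have inj: "inj_on (\<lambda>i. (fst i, I i)) C'"
      proof (rule inj_onI)
        fix i j assume ij: "i \<in> C'" "j \<in> C'" "(fst i, I i) = (fst j, I j)"
        have "fst i \<in> I i" by (cases i) (auto simp: I_def)
        then show "i = j" using disj[of i j] ij C' by auto
      qed
      have K': "fst i \<in> E \<epsilon>" "bad \<epsilon> (fst i) (snd i)" "I i \<subseteq> \<gamma> (fst i)" if "i \<in> C'" for i
        using that C'(1) C(2) by (auto simp: K_def subset_eq case_prod_unfold)
      have "p tagged_partial_division_of (cbox a b)"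
        unfolding tagged_partial_division_of_def
      proof (intro conjI allI impI)
        show "finite p" using C'(2) by (simp add: p_def)
      next
        fix x k assume "(x, k) \<in> p"
        then obtain i where i: "i \<in> C'" "x = fst i" "k = I i" by (auto simp: p_def)
        show "x \<in> k" using i by (cases i) (auto simp: I_def)
        show "k \<subseteq> cbox a b"
          using K'(1,2)[OF i(1)] i by (cases i) (auto simp: I_def E_def bad_def)
        show "\<exists>a b. k = cbox a b" using i by (cases i) (auto simp: I_def cbox_interval)
      next
        fix x1 k1 x2 k2 assume "(x1, k1) \<in> p \<and> (x2, k2) \<in> p \<and> (x1, k1) \<noteq> (x2, k2)"
        then obtain i j where "i \<in> C'" "j \<in> C'" "i \<noteq> j" "k1 = I i" "k2 = I j" by (auto simp: p_def)
        then have "k1 \<inter> k2 = {}" using disj[of i j] C'(1) by blast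
        then show "interior k1 \<inter> interior k2 = {}" using interior_subset by blast
      qed
      moreover have "\<gamma> fine p" using K'(3) by (auto simp: fine_def p_def)
      ultimately have *: "(\<Sum>(x,k)\<in>p. norm (content k *\<^sub>R g x - integral k g)) < \<eta> / 2 * \<epsilon>" by (rule hen)
      have "\<epsilon> * measure lebesgue (I i) \<le> norm (content (I i) *\<^sub>R g (fst i) - integral (I i) g)"
        if "i \<in> C'" for i
      proof -
        obtain t s where i: "i = (t, s)" by (cases i)
        have ts: "t \<in> {a<..<b}" "s \<in> {a<..<b}" "\<epsilon> * \<bar>s - t\<bar> < norm (F s - F t - (s - t) *\<^sub>R g t)"
          using K'(1,2)[OF that] by (auto simp: i E_def bad_def)
        have m: "measure lebesgue (I i) = \<bar>s - t\<bar>" "content (I i) = \<bar>s - t\<bar>"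
          by (auto simp: i I_def)
        have "norm (content (I i) *\<^sub>R g (fst i) - integral (I i) g)
            = norm (F s - F t - (s - t) *\<^sub>R g t)"
        proof (cases "t \<le> s")
          case True
          then have "integral (I i) g = F s - F t" using F_diff[of t s] ts by (simp add: I_def i)
          then show ?thesis unfolding m using True by (simp add: i norm_minus_commute)
        next
          case False
          then have int: "integral (I i) g = F t - F s" using F_diff[of s t] ts by (simp add: I_def i)
          show ?thesis unfolding m int using False by (simp add: i algebra_simps)
        qed
        then show ?thesis using ts(3) m by simp
      qed
      then have "(\<Sum>i\<in>C'. \<epsilon> * measure lebesgue (I i))
          \<le> (\<Sum>i\<in>C'. norm (content (I i) *\<^sub>R g (fst i) - integral (I i) g))"
        by (rule sum_mono)
      also have "\<dots> = (\<Sum>(x,k)\<in>p. norm (content k *\<^sub>R g x - integral k g))"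
        unfolding p_def by (subst sum.reindex[OF inj]) (simp add: o_def)
      finally have "\<epsilon> * (\<Sum>i\<in>C'. measure lebesgue (I i)) \<le> \<eta> / 2 * \<epsilon>"
        using * by (simp add: sum_distrib_left)
      then have "(\<Sum>i\<in>C'. measure lebesgue (I i)) \<le> \<eta> / 2" using \<open>\<epsilon> > 0\<close> by (simp add: mult.commute)
      moreover have "measure lebesgue (\<Union> (I ` C')) \<le> (\<Sum>i\<in>C'. measure lebesgue (I i))"
        by (rule measure_UNION_le) (use C' in \<open>auto simp: I_def\<close>)
      ultimately show ?thesis by linarith
    qed
    have Im: "I i \<in> lmeasurable" for i by (cases i) (auto simp: I_def)
    have U: "\<Union> (I ` C) \<in> lmeasurable" "measure lebesgue (\<Union> (I ` C)) \<le> \<eta> / 2"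
      using fmeasurable_UN_bound[OF C(1) Im fin] measure_UN_bound[OF C(1) Im fin] by auto
    have "negligible (E \<epsilon> - \<Union> (I ` C))" using C(4) by (simp add: I_cball)
    then obtain T where T: "E \<epsilon> - \<Union> (I ` C) \<subseteq> T" "T \<in> lmeasurable" "measure lebesgue T < \<eta> / 2"
      using \<open>\<eta> > 0\<close> unfolding negligible_outer by (meson half_gt_zero)
    have "measure lebesgue (T \<union> \<Union> (I ` C)) \<le> measure lebesgue T + measure lebesgue (\<Union> (I ` C))"
      by (rule measure_Un_le) (use T U in auto)
    then show "\<exists>T. E \<epsilon> \<subseteq> T \<and> T \<in> lmeasurable \<and> measure lebesgue T < \<eta>"
      using T U by (intro exI[of _ "T \<union> \<Union> (I ` C)"]) auto
  qed
  have "negligible (\<Union>n. E (inverse (real (Suc n))))"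
    by (intro negligible_countable_Union) (auto intro!: negE simp del: of_nat_Suc)
  moreover have "{t\<in>{a<..<b}. \<not> (F has_vector_derivative g t) (at t)} \<subseteq> (\<Union>n. E (inverse (real (Suc n))))"
  proof (rule subsetI, rule ccontr)
    fix t assume t: "t \<in> {t\<in>{a<..<b}. \<not> (F has_vector_derivative g t) (at t)}"
      and nt: "t \<notin> (\<Union>n. E (inverse (real (Suc n))))"
    have "(F has_vector_derivative g t) (at t)"
      unfolding has_vector_derivative_def has_derivative_at_alt
    proof (intro conjI allI impI)
      show "bounded_linear (\<lambda>x. x *\<^sub>R g t)" by (rule bounded_linear_scaleR_left)
      fix e :: real assume "e > 0"
      then obtain n where n: "inverse (real (Suc n)) < e" using reals_Archimedean by blast
      from nt t obtain d where d: "d > 0" "\<And>s. \<bar>s - t\<bar> < d \<Longrightarrow> \<not> bad (inverse (real (Suc n))) t s"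
        by (auto simp: E_def)
      show "\<exists>d>0. \<forall>y. norm (y - t) < d \<longrightarrow> norm (F y - F t - (y - t) *\<^sub>R g t) \<le> e * norm (y - t)"
      proof (intro exI[of _ "min d (min (t - a) (b - t))"] conjI allI impI)
        show "0 < min d (min (t - a) (b - t))" using d t by auto
        fix y assume y: "norm (y - t) < min d (min (t - a) (b - t))"
        show "norm (F y - F t - (y - t) *\<^sub>R g t) \<le> e * norm (y - t)"
        proof (cases "y = t")
          case False
          have "norm (F y - F t - (y - t) *\<^sub>R g t) \<le> inverse (real (Suc n)) * \<bar>y - t\<bar>"
            using d(2)[of y] y False unfolding bad_def by auto
          also have "\<dots> \<le> e * \<bar>y - t\<bar>" using n by (intro mult_right_mono) auto
          finally show ?thesis by simp
        qed simp
      qed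
    qed
    then show False using t by simp
  qed
  ultimately show ?thesis unfolding F_def[abs_def] by (rule negligible_subset)
qed

lemma abs_continuous_onE:
  assumes "abs_continuous_on S y" "\<epsilon> > 0"
  obtains \<delta> where "\<delta> > 0" "\<And>\<D>. \<lbrakk>\<D> division_of \<Union>\<D>; \<Union>\<D> \<subseteq> S; (\<Sum>k\<in>\<D>. Sup k - Inf k) < \<delta>\<rbrakk>
      \<Longrightarrow> (\<Sum>k\<in>\<D>. norm (y (Sup k) - y (Inf k))) < \<epsilon>"
proof -
  obtain \<delta> where \<delta>: "\<delta> > 0" "\<forall>\<D>. \<D> division_of \<Union>\<D> \<and> \<Union>\<D> \<subseteq> S \<and> (\<Sum>k\<in>\<D>. Sup k - Inf k) < \<delta>
      \<longrightarrow> (\<Sum>k\<in>\<D>. norm (y (Sup k) - y (Inf k))) < \<epsilon>"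
    using assms(1)[unfolded abs_continuous_on_def, rule_format, OF assms(2)] by (elim exE conjE) (rule that)
  show ?thesis
    by (rule that[OF \<delta>(1) \<delta>(2)[rule_format]]) (intro conjI)
qed

lemma abs_continuous_on_imp_continuous_on:
  assumes "abs_continuous_on {a..b} y"
  shows "continuous_on {a..b} y"
  unfolding continuous_on_iff
proof (intro ballI allI impI)
  fix x e :: real assume x: "x \<in> {a..b}" and "e > 0"
  obtain \<delta> where \<delta>: "\<delta> > 0" "\<And>\<D>. \<lbrakk>\<D> division_of \<Union>\<D>; \<Union>\<D> \<subseteq> {a..b}; (\<Sum>k\<in>\<D>. Sup k - Inf k) < \<delta>\<rbrakk>
      \<Longrightarrow> (\<Sum>k\<in>\<D>. norm (y (Sup k) - y (Inf k))) < e"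
    by (rule abs_continuous_onE[OF assms \<open>e > 0\<close>], rule that)
  have *: "dist (y s) (y t) < e" if "s \<le> t" "{s..t} \<subseteq> {a..b}" "t - s < \<delta>" for s t
  proof -
    have "{{s..t}} division_of {s..t}"
      using that(1) division_of_self[of s t] by (simp add: cbox_interval)
    then have "{{s..t}} division_of \<Union>{{s..t}}" by simp
    from \<delta>(2)[OF this] that show ?thesis by (simp add: dist_norm norm_minus_commute)
  qed
  show "\<exists>d>0. \<forall>x'\<in>{a..b}. dist x' x < d \<longrightarrow> dist (y x') (y x) < e"
  proof (intro exI[of _ \<delta>] conjI ballI impI)
    fix x' assume "x' \<in> {a..b}" "dist x' x < \<delta>"
    then show "dist (y x') (y x) < e"
      using *[of x x'] *[of x' x] x by (cases "x \<le> x'") (auto simp: dist_real_def dist_commute)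
  qed (fact \<delta>(1))
qed

text \<open>
  The integrand is first set to \<open>0\<close> on the exceptional set \<open>N\<close>. A sufficiently fine tagged division
  then splits into two parts: for tags outside \<open>N\<close> the derivative controls the increment of \<open>y\<close>, and
  the intervals with tags in \<open>N\<close> lie in an open set of measure less than \<open>\<delta>\<close>, so that absolute
  continuity makes the sum of the increments of \<open>y\<close> over them small.
\<close>
lemma abs_continuous_imp_has_integral:
  fixes y :: "real \<Rightarrow> real^2"
  assumes "a \<le> b" and ac: "abs_continuous_on {a..b} y" and N: "negligible N"
    and deriv: "\<And>t. t \<in> {a..b} - N \<Longrightarrow> (y has_vector_derivative g t) (at t within {a..b})"
  shows "(g has_integral (y b - y a)) {a..b}"
proof -
  define h where "h t = (if t \<in> N then 0 else g t)" for t
  have "(h has_integral (y b - y a)) {a..b}"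
    unfolding has_integral_real
  proof (intro allI impI)
    fix e :: real assume "e > 0"
    define \<epsilon> where "\<epsilon> = e / (2 * (b - a + 1))"
    have "\<epsilon> > 0" "\<epsilon> * (b - a) < e / 2" using \<open>e > 0\<close> \<open>a \<le> b\<close> by (auto simp: \<epsilon>_def field_simps)
    have "e / 2 > 0" using \<open>e > 0\<close> by simp
    obtain \<delta> where \<delta>: "\<delta> > 0" "\<And>\<D>. \<lbrakk>\<D> division_of \<Union>\<D>; \<Union>\<D> \<subseteq> {a..b}; (\<Sum>k\<in>\<D>. Sup k - Inf k) < \<delta>\<rbrakk>
        \<Longrightarrow> (\<Sum>k\<in>\<D>. norm (y (Sup k) - y (Inf k))) < e / 2"
      by (rule abs_continuous_onE[OF ac \<open>e / 2 > 0\<close>], rule that)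
    obtain U where U: "open U" "N \<subseteq> U" "U \<in> lmeasurable" "measure lebesgue U < \<delta>"
    proof -
      have N': "N \<in> sets lebesgue" "N \<in> lmeasurable" "measure lebesgue N = 0"
        using N by (auto simp: negligible_iff_measure negligible_imp_sets)
      obtain U where U: "open U" "N \<subseteq> U" "U - N \<in> lmeasurable" "emeasure lebesgue (U - N) < ennreal \<delta>"
        using sets_lebesgue_outer_open[OF N'(1) \<delta>(1)] by metis
      have "U = N \<union> (U - N)" using U(2) by auto
      then have "U \<in> lmeasurable" "measure lebesgue U \<le> measure lebesgue N + measure lebesgue (U - N)"
        using fmeasurable.Un[OF N'(2) U(3)] measure_Un_le[of N lebesgue "U - N"] N' U(3) by auto
      moreover have "measure lebesgue (U - N) < \<delta>"
        using U(3,4) \<delta>(1) by (simp add: emeasure_eq_measure2 ennreal_less_iff)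
      ultimately show ?thesis using U N' that by auto
    qed
    have "\<exists>d>0. t \<notin> N \<and> t \<in> {a..b} \<longrightarrow>
        (\<forall>s\<in>{a..b}. \<bar>s - t\<bar> < d \<longrightarrow> norm (y s - y t - (s - t) *\<^sub>R g t) \<le> \<epsilon> * \<bar>s - t\<bar>)" for t
      using deriv[of t] \<open>\<epsilon> > 0\<close>
      unfolding has_vector_derivative_def has_derivative_within_alt
      by (cases "t \<notin> N \<and> t \<in> {a..b}") (auto intro: exI[of _ 1])
    then obtain d where d: "\<And>t. d t > 0" "\<And>t s. \<lbrakk>t \<notin> N; t \<in> {a..b}; s \<in> {a..b}; \<bar>s - t\<bar> < d t\<rbrakk>
        \<Longrightarrow> norm (y s - y t - (s - t) *\<^sub>R g t) \<le> \<epsilon> * \<bar>s - t\<bar>"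
      by metis
    define \<gamma> where "\<gamma> t = (if t \<in> N then U else ball t (d t))" for t
    have \<gamma>: "gauge \<gamma>" using U d(1) by (auto simp: gauge_def \<gamma>_def)
    have fine_bound: "norm ((\<Sum>(x, k)\<in>p. content k *\<^sub>R h x) - (y b - y a)) < e"
      if p: "p tagged_division_of {a..b}" "\<gamma> fine p" for p
    proof -
      have finp: "finite p" using p(1) by auto
      have pD: "\<exists>u v. k = {u..v} \<and> u \<le> x \<and> x \<le> v \<and> a \<le> u \<and> v \<le> b" if xk: "(x, k) \<in> p" for x k
      proof -
        obtain u v where k: "k = {u..v}" using tagged_division_ofD(4)[OF p(1) xk] by (auto simp: cbox_interval)
        then show ?thesis using tagged_division_ofD(2,3)[OF p(1) xk] by (intro exI[of _ u] exI[of _ v]) auto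
      qed
      have tpd: "p tagged_partial_division_of {a..b}" using p(1) by (simp add: tagged_division_of_def)
      define pN where "pN = {(x, k) \<in> p. x \<in> N}"
      let ?\<Delta> = "\<lambda>(x, k). y (Sup k) - y (Inf k)"
      have "(\<Sum>(x, k)\<in>p. content k *\<^sub>R h x) - (y b - y a) = (\<Sum>(x, k)\<in>p. content k *\<^sub>R h x - (y (Sup k) - y (Inf k)))"
        using additive_tagged_division_1[OF \<open>a \<le> b\<close> p(1), of y] by (simp add: sum_subtractf case_prod_unfold)
      also have "norm \<dots> \<le> (\<Sum>(x, k)\<in>p. norm (content k *\<^sub>R h x - (y (Sup k) - y (Inf k))))"
        by (rule order_trans[OF norm_sum]) (simp add: case_prod_unfold)
      also have "\<dots> \<le> (\<Sum>(x, k)\<in>p. \<epsilon> * content k + (if x \<in> N then norm (y (Sup k) - y (Inf k)) else 0))"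
      proof (rule sum_mono, clarify)
        fix x k assume xk: "(x, k) \<in> p"
        from pD[OF xk] obtain u v where k: "k = {u..v}" "u \<le> x" "x \<le> v" "a \<le> u" "v \<le> b" by blast
        show "norm (content k *\<^sub>R h x - (y (Sup k) - y (Inf k))) \<le>
            \<epsilon> * content k + (if x \<in> N then norm (y (Sup k) - y (Inf k)) else 0)"
        proof (cases "x \<in> N")
          case True
          then show ?thesis using k \<open>\<epsilon> > 0\<close> by (simp add: h_def norm_minus_commute)
        next
          case False
          have "k \<subseteq> ball x (d x)" using fineD[OF p(2) xk] False by (simp add: \<gamma>_def)
          moreover have "u \<in> k" "v \<in> k" using k by auto
          ultimately have dx: "\<bar>u - x\<bar> < d x" "\<bar>v - x\<bar> < d x" by (auto simp: dist_real_def)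
          have "content k *\<^sub>R h x - (y (Sup k) - y (Inf k))
              = (y u - y x - (u - x) *\<^sub>R g x) - (y v - y x - (v - x) *\<^sub>R g x)"
            using k False by (simp add: h_def algebra_simps)
          also have "norm \<dots> \<le> norm (y u - y x - (u - x) *\<^sub>R g x) + norm (y v - y x - (v - x) *\<^sub>R g x)"
            by (rule norm_triangle_ineq4)
          also have "\<dots> \<le> \<epsilon> * \<bar>u - x\<bar> + \<epsilon> * \<bar>v - x\<bar>"
            by (intro add_mono d(2)) (use k False dx in auto)
          also have "\<dots> = \<epsilon> * content k" using k by (simp add: algebra_simps)
          finally show ?thesis using False by simp
        qed
      qed
      also have "\<dots> = \<epsilon> * (\<Sum>(x, k)\<in>p. content k) + (\<Sum>(x, k)\<in>p. if x \<in> N then norm (y (Sup k) - y (Inf k)) else 0)"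
        by (simp add: sum.distrib sum_distrib_left case_prod_unfold)
      also have "(\<Sum>(x, k)\<in>p. content k) = b - a"
        using additive_content_tagged_division[of p a b] p(1) \<open>a \<le> b\<close> by (simp add: cbox_interval)
      also have "(\<Sum>(x, k)\<in>p. if x \<in> N then norm (y (Sup k) - y (Inf k)) else 0)
          = (\<Sum>(x, k)\<in>pN. norm (y (Sup k) - y (Inf k)))"
        unfolding pN_def by (rule sum.mono_neutral_cong_right) (use finp in \<open>auto split: if_splits\<close>)
      \<comment> \<open>Absolute continuity speaks of sets of intervals without tags. An interval that carries
         two tags is degenerate, so it does not contribute.\<close>
      also have "\<dots> = (\<Sum>k\<in>snd ` pN. norm (y (Sup k) - y (Inf k)))"
      proof -
        have "(\<Sum>k\<in>snd ` pN. norm (y (Sup k) - y (Inf k))) = (\<Sum>z\<in>pN. norm (y (Sup (snd z)) - y (Inf (snd z))))"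
        proof (rule sum.reindex_nontrivial[where h=snd and g = "\<lambda>k. norm (y (Sup k) - y (Inf k))", unfolded o_def])
          show "finite pN" using finp by (rule rev_finite_subset) (auto simp: pN_def)
          fix z z' assume z: "z \<in> pN" "z' \<in> pN" "z \<noteq> z'" "snd z = snd z'"
          obtain x k x' where zz: "z = (x, k)" "z' = (x', k)" using z(4) by (metis prod.collapse)
          have "(x, k) \<in> p" "(x', k) \<in> p" using z zz by (auto simp: pN_def)
          then have "interior k = {}" using tagged_partial_division_ofD(5)[OF tpd, of x k x' k] z(3) zz by auto
          moreover obtain u v where "k = {u..v}" "u \<le> v" using pD[OF \<open>(x, k) \<in> p\<close>] by auto
          ultimately have "k = {u..u}" by (auto simp: interior_atLeastAtMost_real)
          then show "norm (y (Sup (snd z)) - y (Inf (snd z))) = 0" by (simp add: zz)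
        qed
        then show ?thesis by (simp add: case_prod_unfold)
      qed
      also have "\<dots> < e / 2"
      proof (rule \<delta>(2))
        have "pN tagged_partial_division_of {a..b}"
          by (rule tagged_partial_division_subset[OF tpd]) (auto simp: pN_def)
        then show div: "snd ` pN division_of \<Union> (snd ` pN)"
          by (rule partial_division_of_tagged_division)
        show "\<Union> (snd ` pN) \<subseteq> {a..b}" using pD by (fastforce simp: pN_def)
        have "(\<Sum>k\<in>snd ` pN. Sup k - Inf k) = (\<Sum>k\<in>snd ` pN. measure lebesgue k)"
        proof (rule sum.cong)
          fix k assume "k \<in> snd ` pN"
          then obtain x where "(x, k) \<in> p" by (auto simp: pN_def)
          from pD[OF this] show "Sup k - Inf k = measure lebesgue k" by auto
        qed simp
        also have "\<dots> = measure lebesgue (\<Union> (snd ` pN))"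
          using content_division[OF div] by simp
        also have "\<dots> \<le> measure lebesgue U"
        proof (rule measure_mono_fmeasurable)
          show "\<Union> (snd ` pN) \<subseteq> U" using p(2) by (fastforce simp: pN_def fine_def \<gamma>_def)
          show "\<Union> (snd ` pN) \<in> sets lebesgue" using div by (meson lmeasurable_division fmeasurableD)
        qed (fact U(3))
        finally show "(\<Sum>k\<in>snd ` pN. Sup k - Inf k) < \<delta>" using U(4) by simp
      qed
      finally show ?thesis using \<open>\<epsilon> * (b - a) < e / 2\<close> by linarith
    qed
    show "\<exists>\<gamma>. gauge \<gamma> \<and> (\<forall>p. p tagged_division_of {a..b} \<and> \<gamma> fine p \<longrightarrow>
        norm ((\<Sum>(x, k)\<in>p. content k *\<^sub>R h x) - (y b - y a)) < e)"
      by (rule exI[of _ \<gamma>], rule conjI[OF \<gamma>], intro allI impI, elim conjE, rule fine_bound)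
  qed
  then show ?thesis
    by (rule has_integral_spike[OF N, rotated]) (simp add: h_def)
qed

lemma lipschitz_imp_abs_continuous:
  assumes lip: "L-lipschitz_on S y"
  shows "abs_continuous_on S y"
  unfolding abs_continuous_on_def
proof (intro allI impI)
  fix \<epsilon> :: real assume "\<epsilon> > 0"
  have "L \<ge> 0" using lip by (rule lipschitz_on_nonneg)
  show "\<exists>\<delta>>0. \<forall>\<D>. \<D> division_of \<Union>\<D> \<and> \<Union>\<D> \<subseteq> S \<and> (\<Sum>k\<in>\<D>. Sup k - Inf k) < \<delta>
        \<longrightarrow> (\<Sum>k\<in>\<D>. norm (y (Sup k) - y (Inf k))) < \<epsilon>"
  proof (intro exI[of _ "\<epsilon> / (L + 1)"] conjI allI impI)
    show "\<epsilon> / (L + 1) > 0" using \<open>\<epsilon> > 0\<close> \<open>L \<ge> 0\<close> by simp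
    fix \<D> assume D: "\<D> division_of \<Union>\<D> \<and> \<Union>\<D> \<subseteq> S \<and> (\<Sum>k\<in>\<D>. Sup k - Inf k) < \<epsilon> / (L + 1)"
    have k: "Sup k \<in> S \<and> Inf k \<in> S \<and> Inf k \<le> Sup k" if kD: "k \<in> \<D>" for k
    proof -
      obtain u v where "k = {u..v}" "k \<noteq> {}"
        using division_ofD(3,4)[OF conjunct1[OF D] kD] by (metis cbox_interval)
      moreover have "k \<subseteq> S" using D kD by blast
      ultimately show ?thesis by auto
    qed
    have "(\<Sum>k\<in>\<D>. norm (y (Sup k) - y (Inf k))) \<le> (\<Sum>k\<in>\<D>. L * (Sup k - Inf k))"
    proof (rule sum_mono)
      fix i assume "i \<in> \<D>"
      then show "norm (y (Sup i) - y (Inf i)) \<le> L * (Sup i - Inf i)"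
        using lipschitz_onD[OF lip, of "Sup i" "Inf i"] k[of i] by (auto simp: dist_norm)
    qed
    also have "\<dots> \<le> L * (\<epsilon> / (L + 1))"
      unfolding sum_distrib_left[symmetric] using D \<open>L \<ge> 0\<close> by (intro mult_left_mono) auto
    also have "\<dots> < \<epsilon>" using \<open>\<epsilon> > 0\<close> \<open>L \<ge> 0\<close> by (simp add: field_simps)
    finally show "(\<Sum>k\<in>\<D>. norm (y (Sup k) - y (Inf k))) < \<epsilon>" .
  qed
qed

section \<open>Integral equations with a continuous forcing\<close>

text \<open>
  The integrated form of the controlled equation with forcing \<open>w\<close>. It makes sense for every function
  \<open>w\<close>, whether or not it is the primitive of some \<open>B u\<close>; the extension of solutions below relies on
  such artificial forcings. The time interval is closed, so that the range of a solution is compact.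
\<close>
definition int_sol :: "('a::euclidean_space \<Rightarrow> 'a) \<Rightarrow> 'a set \<Rightarrow> 'a \<Rightarrow> (real \<Rightarrow> 'a) \<Rightarrow> real \<Rightarrow> (real \<Rightarrow> 'a) \<Rightarrow> bool" where
  "int_sol f D y0 w b y \<longleftrightarrow> continuous_on {0..b} y \<and>
     (\<forall>t\<in>{0..b}. y t \<in> D \<and> y t = y0 + w t + integral {0..t} (\<lambda>s. f (y s)))"

lemma int_sol_mono: "int_sol f D y0 w b y \<Longrightarrow> b' \<le> b \<Longrightarrow> int_sol f D y0 w b' y"
  unfolding int_sol_def by (meson atLeastatMost_subset_iff continuous_on_subset order_refl subsetD)

lemma int_solD:
  assumes "int_sol f D y0 w b y"
  shows "continuous_on {0..b} y" "\<And>t. t \<in> {0..b} \<Longrightarrow> y t \<in> D"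
    "\<And>t. t \<in> {0..b} \<Longrightarrow> y t = y0 + w t + integral {0..t} (\<lambda>s. f (y s))"
  using assms unfolding int_sol_def by blast+

text \<open>
  With respect to the weight \<open>exp (2 L t)\<close>, integration of an \<open>L\<close>-Lipschitz expression is a
  contraction by the factor \<open>1/2\<close> on intervals of any length. This one estimate serves for
  uniqueness as well as for the Picard iteration.
\<close>
lemma norm_integral_exp_weighted_le:
  fixes g :: "real \<Rightarrow> 'a::euclidean_space"
  assumes "0 < L" "0 \<le> t" "0 \<le> c" "g integrable_on {0..t}"
    and g: "\<And>s. s \<in> {0..t} \<Longrightarrow> norm (g s) \<le> L * (c * exp (2 * L * s))"
  shows "norm (integral {0..t} g) \<le> c * exp (2 * L * t) / 2"
proof -
  have E: "((\<lambda>s. L * (c * exp (2 * L * s))) has_integral (c / 2 * exp (2 * L * t) - c / 2 * exp (2 * L * 0))) {0..t}"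
    by (rule fundamental_theorem_of_calculus[OF \<open>0 \<le> t\<close>])
       (auto intro!: derivative_eq_intros simp: has_real_derivative_iff_has_vector_derivative[symmetric])
  have "norm (integral {0..t} g) \<le> integral {0..t} (\<lambda>s. L * (c * exp (2 * L * s)))"
    by (rule integral_norm_bound_integral) (use assms E in auto)
  also have "\<dots> \<le> c * exp (2 * L * t) / 2"
    using integral_unique[OF E] \<open>0 \<le> c\<close> by simp
  finally show ?thesis .
qed

lemma integral_diff_exp_weighted_le:
  fixes f :: "'a::euclidean_space \<Rightarrow> 'a"
  assumes L: "L-lipschitz_on X f" "0 < L" and "0 \<le> t" "0 \<le> c"
    and v: "continuous_on {0..t} v" "v ` {0..t} \<subseteq> X"
    and v': "continuous_on {0..t} v'" "v' ` {0..t} \<subseteq> X"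
    and d: "\<And>s. s \<in> {0..t} \<Longrightarrow> norm (v s - v' s) \<le> c * exp (2 * L * s)"
  shows "norm (integral {0..t} (\<lambda>s. f (v s)) - integral {0..t} (\<lambda>s. f (v' s))) \<le> c * exp (2 * L * t) / 2"
proof -
  have i: "(\<lambda>s. f (v s)) integrable_on {0..t}" "(\<lambda>s. f (v' s)) integrable_on {0..t}"
    using continuous_on_compose2[OF lipschitz_on_continuous_on[OF L(1)] v]
      continuous_on_compose2[OF lipschitz_on_continuous_on[OF L(1)] v']
    by (auto intro!: integrable_continuous_real)
  have "norm (f (v s) - f (v' s)) \<le> L * (c * exp (2 * L * s))" if "s \<in> {0..t}" for s
  proof -
    have "norm (f (v s) - f (v' s)) \<le> L * norm (v s - v' s)"
      using lipschitz_onD[OF L(1), of "v s" "v' s"] subsetD[OF v(2)] subsetD[OF v'(2)] that by (simp add: dist_norm)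
    also have "\<dots> \<le> L * (c * exp (2 * L * s))"
      using d[OF that] L(2) by (intro mult_left_mono) auto
    finally show ?thesis .
  qed
  then have "norm (integral {0..t} (\<lambda>s. f (v s) - f (v' s))) \<le> c * exp (2 * L * t) / 2"
    by (intro norm_integral_exp_weighted_le) (use assms i in \<open>auto intro: integrable_diff\<close>)
  then show ?thesis by (simp add: Henstock_Kurzweil_Integration.integral_diff i)
qed

text \<open>
  The Lipschitz condition is stated on compact sets, because solutions on closed intervals are
  treated as a whole, in a compact neighbourhood of their range, and not pointwise.
\<close>
locale lipschitz_field =
  fixes f :: "'a::euclidean_space \<Rightarrow> 'a" and D :: "'a set"
  assumes open_D: "open D"
    and lipschitz_on_compacts: "\<And>C. compact C \<Longrightarrow> C \<subseteq> D \<Longrightarrow> \<exists>L. L-lipschitz_on C f"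
begin

lemma lipschitz_pos:
  assumes "compact C" "C \<subseteq> D" obtains L where "0 < L" "L-lipschitz_on C f"
proof -
  obtain L where "L-lipschitz_on C f" using lipschitz_on_compacts assms by blast
  then have "(max L 1)-lipschitz_on C f" by (rule lipschitz_on_le) simp
  then show ?thesis using that[of "max L 1"] by simp
qed

lemma continuous_on_field: "continuous_on D f"
  unfolding continuous_on_eq_continuous_at[OF open_D]
proof
  fix x assume "x \<in> D"
  then obtain r where r: "r > 0" "cball x r \<subseteq> D" using open_D open_contains_cball by blast
  obtain L where "L-lipschitz_on (cball x r) f" using lipschitz_on_compacts[OF _ r(2)] by auto
  then have "continuous_on (ball x r) f"
    by (meson ball_subset_cball continuous_on_subset lipschitz_on_continuous_on)
  then show "isCont f x" using r(1) by (simp add: continuous_on_eq_continuous_at)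
qed

lemma int_sol_integrable:
  assumes "int_sol f D y0 w b y" "0 \<le> s" "t \<le> b"
  shows "(\<lambda>s. f (y s)) integrable_on {s..t}"
proof -
  have "continuous_on {0..b} (\<lambda>s. f (y s))"
    using int_solD(1,2)[OF assms(1)]
    by (intro continuous_on_compose2[OF continuous_on_field]) auto
  then show ?thesis
    using assms by (intro integrable_continuous_real) (auto elim: continuous_on_subset)
qed

text \<open>
  At the point where the weighted distance \<open>exp (- 2 L t) * norm (y t - y' t)\<close> attains its maximum,
  the integral equation bounds it by half of this maximum.
\<close>
lemma int_sol_unique:
  assumes y: "int_sol f D y0 w b y" and y': "int_sol f D y0 w b y'" and t: "t \<in> {0..b}"
  shows "y t = y' t"
proof -
  have c: "continuous_on {0..b} y" "continuous_on {0..b} y'" using int_solD(1) y y' by blast+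
  define C where "C = y ` {0..b} \<union> y' ` {0..b}"
  have "compact C" "C \<subseteq> D"
    using int_solD(1,2)[OF y] int_solD(1,2)[OF y'] by (auto simp: C_def intro!: compact_continuous_image compact_Un)
  then obtain L where L: "0 < L" "L-lipschitz_on C f" by (rule lipschitz_pos)
  define h where "h s = exp (- (2 * L * s)) * norm (y s - y' s)" for s
  have "continuous_on {0..b} h" unfolding h_def by (intro continuous_intros c)
  then obtain m where m: "m \<in> {0..b}" "\<And>s. s \<in> {0..b} \<Longrightarrow> h s \<le> h m"
    using continuous_attains_sup[of "{0..b}" h] t by auto
  have le: "norm (y s - y' s) \<le> h m * exp (2 * L * s)" if "s \<in> {0..b}" for s
  proof -
    have "norm (y s - y' s) = h s * exp (2 * L * s)" by (simp add: h_def exp_minus field_simps)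
    also have "\<dots> \<le> h m * exp (2 * L * s)" by (intro mult_right_mono m that) simp
    finally show ?thesis .
  qed
  have "h m \<ge> 0" by (simp add: h_def)
  have "y m - y' m = integral {0..m} (\<lambda>s. f (y s)) - integral {0..m} (\<lambda>s. f (y' s))"
  proof -
    have "y m = y0 + w m + integral {0..m} (\<lambda>s. f (y s))" "y' m = y0 + w m + integral {0..m} (\<lambda>s. f (y' s))"
      using int_solD(3)[OF y m(1)] int_solD(3)[OF y' m(1)] by auto
    then show ?thesis by simp
  qed
  also have "norm \<dots> \<le> h m * exp (2 * L * m) / 2"
    by (rule integral_diff_exp_weighted_le[OF L(2,1)])
       (use m c \<open>h m \<ge> 0\<close> le in \<open>auto simp: C_def elim: continuous_on_subset\<close>)
  finally have "h m \<le> h m / 2" by (simp add: h_def exp_minus field_simps)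
  then have "h m = 0" using \<open>h m \<ge> 0\<close> by simp
  then show ?thesis using le[OF t] by simp
qed

text \<open>
  The heart of the matter: \<open>\<delta>\<close> depends only on the compact set \<open>C\<close> and on the time bound, not on the
  solution. Picard iteration for the new forcing \<open>w'\<close> starts at the old solution \<open>y\<close>. The first step
  moves it by at most \<open>\<delta>\<close>, and the contraction in the weighted norm keeps all iterates within
  \<open>2 \<delta> exp (2 L t)\<close> of \<open>y\<close>, hence in a compact neighbourhood \<open>X\<close> of \<open>C\<close> inside \<open>D\<close>.
\<close>
lemma int_sol_perturb:
  assumes C: "compact C" "C \<noteq> {}" "C \<subseteq> D" and "0 \<le> T"
  obtains \<delta> where "\<delta> > 0"
    "\<And>b w w' y. \<lbrakk>0 \<le> b; b \<le> T; int_sol f D y0 w b y; y ` {0..b} \<subseteq> C; continuous_on {0..b} w';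
       \<And>t. t \<in> {0..b} \<Longrightarrow> norm (w' t - w t) \<le> \<delta>\<rbrakk> \<Longrightarrow> \<exists>y'. int_sol f D y0 w' b y'"
proof -
  obtain \<epsilon> where \<epsilon>: "\<epsilon> > 0" "{x. infdist x C \<le> \<epsilon>} \<subseteq> D"
    using compact_in_open_separated[OF C(2,1) open_D C(3)] by blast
  define X where "X = {x. infdist x C \<le> \<epsilon>}"
  have X: "compact X" unfolding X_def using C \<epsilon>(1) by (intro compact_infdist_le) auto
  obtain L where L: "0 < L" "L-lipschitz_on X f" using lipschitz_pos[OF X] \<epsilon>(2) X_def by blast
  \<comment> \<open>Chosen such that \<open>2 * \<delta> * exp (2 * L * T) = \<epsilon>\<close>, so the iterates do not leave \<open>X\<close> before \<open>T\<close>.\<close>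
  define \<delta> where "\<delta> = \<epsilon> / 2 * exp (- (2 * L * T))"
  have "\<delta> > 0" using \<epsilon>(1) by (simp add: \<delta>_def)
  moreover have "\<exists>y'. int_sol f D y0 w' b y'"
    if b: "0 \<le> b" "b \<le> T" and y: "int_sol f D y0 w b y" "y ` {0..b} \<subseteq> C" and w': "continuous_on {0..b} w'"
      and ww: "\<And>t. t \<in> {0..b} \<Longrightarrow> norm (w' t - w t) \<le> \<delta>" for b w w' y
  proof -
    have y_eq: "y t = y0 + w t + integral {0..t} (\<lambda>s. f (y s))" if "t \<in> {0..b}" for t
      using int_solD(3)[OF y(1) that] .
    have y_cont: "continuous_on {0..b} y" using int_solD(1)[OF y(1)] .
    define \<Phi> where "\<Phi> v t = y0 + w' t + integral {0..t} (\<lambda>s. f (v s))" for v and t :: real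
    define v where "v n = (\<Phi> ^^ n) y" for n
    have v0: "v 0 = y" and vSuc: "v (Suc n) = \<Phi> (v n)" for n by (auto simp: v_def)
    have small: "2 * \<delta> * exp (2 * L * t) \<le> \<epsilon>" if "t \<in> {0..b}" for t
    proof -
      have "exp (2 * L * t) \<le> exp (2 * L * T)" using that b L(1) by simp
      then have "2 * \<delta> * exp (2 * L * t) \<le> 2 * \<delta> * exp (2 * L * T)" using \<open>\<delta> > 0\<close> by simp
      also have "\<dots> = \<epsilon>" by (simp add: \<delta>_def exp_minus)
      finally show ?thesis .
    qed
    have in_X: "x \<in> X" if "norm (x - y t) \<le> 2 * \<delta> * exp (2 * L * t)" "t \<in> {0..b}" for x t
    proof -
      have "infdist x C \<le> dist x (y t)" using y(2) that(2) by (intro infdist_le) auto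
      then show ?thesis using that small[OF that(2)] by (simp add: X_def dist_norm)
    qed
    have yX: "y ` {0..b} \<subseteq> X"
    proof clarify
      fix t assume "t \<in> {0..b}"
      then show "y t \<in> X" using in_X[of "y t" t] \<open>\<delta> > 0\<close> by simp
    qed
    have \<Phi>_cont: "continuous_on {0..b} (\<Phi> u)" if "continuous_on {0..b} u" "u ` {0..b} \<subseteq> X" for u
    proof -
      have "(\<lambda>s. f (u s)) integrable_on {0..b}"
        by (intro integrable_continuous_real continuous_on_compose2[OF lipschitz_on_continuous_on[OF L(2)]] that)
      then show ?thesis unfolding \<Phi>_def
        by (intro continuous_intros w' indefinite_integral_continuous_1)
    qed
    have P: "continuous_on {0..b} (v n) \<and> (\<forall>t\<in>{0..b}. norm (v n t - y t) \<le> 2 * \<delta> * exp (2 * L * t))" for n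
    proof (induction n)
      case 0
      then show ?case using y_cont \<open>\<delta> > 0\<close> by (simp add: v0)
    next
      case (Suc n)
      then have vX: "v n ` {0..b} \<subseteq> X" using in_X by auto
      have "norm (v (Suc n) t - y t) \<le> 2 * \<delta> * exp (2 * L * t)" if t: "t \<in> {0..b}" for t
      proof -
        have "v (Suc n) t - y t = (w' t - w t) + (integral {0..t} (\<lambda>s. f (v n s)) - integral {0..t} (\<lambda>s. f (y s)))"
          unfolding vSuc \<Phi>_def using y_eq[OF t] by (simp add: algebra_simps)
        also have "norm \<dots> \<le> \<delta> + 2 * \<delta> * exp (2 * L * t) / 2"
        proof (intro norm_triangle_mono ww[OF t] integral_diff_exp_weighted_le[OF L(2,1)])
          show "continuous_on {0..t} (v n)" "continuous_on {0..t} y"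
            using Suc y_cont t by (auto elim!: continuous_on_subset)
          show "v n ` {0..t} \<subseteq> X" "y ` {0..t} \<subseteq> X" using vX yX t by auto
        qed (use t Suc \<open>\<delta> > 0\<close> in auto)
        also have "\<dots> \<le> 2 * \<delta> * exp (2 * L * t)" using \<open>\<delta> > 0\<close> L(1) t by simp
        finally show ?thesis .
      qed
      then show ?case using \<Phi>_cont Suc vX by (auto simp: vSuc)
    qed
    have v_cont: "continuous_on {0..b} (v n)" and vX: "v n ` {0..b} \<subseteq> X" for n
      using P in_X by blast+
    have Q: "norm (v (Suc n) t - v n t) \<le> 2 * \<delta> * (1/2)^n * exp (2 * L * t)" if "t \<in> {0..b}" for n t
      using that
    proof (induction n arbitrary: t)
      case 0
      then show ?case using P[of 1] by (simp add: v0)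
    next
      case (Suc n)
      have "v (Suc (Suc n)) t - v (Suc n) t = integral {0..t} (\<lambda>s. f (v (Suc n) s)) - integral {0..t} (\<lambda>s. f (v n s))"
        by (subst (1) vSuc, subst (2) vSuc) (simp add: \<Phi>_def)
      also have "norm \<dots> \<le> 2 * \<delta> * (1/2)^n * exp (2 * L * t) / 2"
      proof (intro integral_diff_exp_weighted_le[OF L(2,1)])
        show "continuous_on {0..t} (v (Suc n))" "continuous_on {0..t} (v n)"
          using Suc(2) by (auto intro: continuous_on_subset[OF v_cont])
        show "v (Suc n) ` {0..t} \<subseteq> X" "v n ` {0..t} \<subseteq> X" using vX Suc(2) by fastforce+
      qed (use Suc \<open>\<delta> > 0\<close> in auto)
      finally show ?case by simp
    qed
    define V where "V t = y t + (\<Sum>i. v (Suc i) t - v i t)" for t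
    have lim: "uniform_limit {0..b} v V sequentially"
    proof -
      have "uniform_limit {0..b} (\<lambda>n t. \<Sum>i<n. v (Suc i) t - v i t) (\<lambda>t. \<Sum>i. v (Suc i) t - v i t) sequentially"
      proof (rule Weierstrass_m_test)
        fix n t assume t: "t \<in> {0..b}"
        have "norm (v (Suc n) t - v n t) \<le> (1/2)^n * (2 * \<delta> * exp (2 * L * t))"
          using Q[OF t, of n] by (simp add: mult_ac)
        also have "\<dots> \<le> (1/2)^n * \<epsilon>" by (intro mult_left_mono small t) simp
        finally show "norm (v (Suc n) t - v n t) \<le> (1/2)^n * \<epsilon>" .
      qed (intro summable_mult2 summable_geometric, simp)
      then have "uniform_limit {0..b} (\<lambda>n t. y t + (\<Sum>i<n. v (Suc i) t - v i t)) V sequentially"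
        unfolding V_def by (intro uniform_limit_intros)
      moreover have "y t + (\<Sum>i<n. v (Suc i) t - v i t) = v n t" for n t
        using sum_lessThan_telescope[of "\<lambda>i. v i t" n] by (simp add: v0)
      ultimately show ?thesis by simp
    qed
    have V_cont: "continuous_on {0..b} V"
      by (rule uniform_limit_theorem[OF _ lim]) (auto simp: v_cont)
    have V_lim: "(\<lambda>n. v n t) \<longlonglongrightarrow> V t" if "t \<in> {0..b}" for t
      by (rule tendsto_uniform_limitI[OF lim that])
    have VX: "V ` {0..b} \<subseteq> X"
    proof clarify
      fix t assume t: "t \<in> {0..b}"
      show "V t \<in> X"
        by (rule closed_sequentially[OF compact_imp_closed[OF X] _ V_lim[OF t]]) (use vX t in blast)
    qed
    have "V t = y0 + w' t + integral {0..t} (\<lambda>s. f (V s))" if t: "t \<in> {0..b}" for t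
    proof -
      have "(\<lambda>n. integral {0..t} (\<lambda>s. f (v n s))) \<longlonglongrightarrow> integral {0..t} (\<lambda>s. f (V s))"
      proof (rule metric_LIMSEQ_I)
        fix r :: real assume "r > 0"
        define c where "c = r * exp (- (2 * L * t))"
        have "c > 0" using \<open>r > 0\<close> by (simp add: c_def)
        then obtain N where N: "\<And>n s. n \<ge> N \<Longrightarrow> s \<in> {0..b} \<Longrightarrow> dist (v n s) (V s) < c"
          using lim unfolding uniform_limit_sequentially_iff by blast
        have "dist (integral {0..t} (\<lambda>s. f (v n s))) (integral {0..t} (\<lambda>s. f (V s))) < r" if "n \<ge> N" for n
        proof -
          have "norm (integral {0..t} (\<lambda>s. f (v n s)) - integral {0..t} (\<lambda>s. f (V s))) \<le> c * exp (2 * L * t) / 2"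
          proof (intro integral_diff_exp_weighted_le[OF L(2,1)])
            show "continuous_on {0..t} (v n)" "continuous_on {0..t} V"
              using t by (auto intro: continuous_on_subset[OF v_cont] continuous_on_subset[OF V_cont])
            show "v n ` {0..t} \<subseteq> X" "V ` {0..t} \<subseteq> X" using vX VX t by fastforce+
            fix s assume s: "s \<in> {0..t}"
            then have "norm (v n s - V s) \<le> c" using N[OF \<open>n \<ge> N\<close>, of s] t by (simp add: dist_norm)
            also have "c * 1 \<le> c * exp (2 * L * s)" using \<open>c > 0\<close> s L(1) by (intro mult_left_mono) auto
            finally show "norm (v n s - V s) \<le> c * exp (2 * L * s)" by simp
          qed (use t \<open>c > 0\<close> in auto)
          also have "\<dots> = r / 2" by (simp add: c_def exp_minus)
          finally show ?thesis using \<open>r > 0\<close> by (simp add: dist_norm)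
        qed
        then show "\<exists>no. \<forall>n\<ge>no. dist (integral {0..t} (\<lambda>s. f (v n s))) (integral {0..t} (\<lambda>s. f (V s))) < r"
          by blast
      qed
      then have "(\<lambda>n. v (Suc n) t) \<longlonglongrightarrow> y0 + w' t + integral {0..t} (\<lambda>s. f (V s))"
        unfolding vSuc \<Phi>_def by (intro tendsto_intros)
      moreover have "(\<lambda>n. v (Suc n) t) \<longlonglongrightarrow> V t" using V_lim[OF t] by (rule LIMSEQ_Suc)
      ultimately show ?thesis using LIMSEQ_unique by blast
    qed
    moreover have "V t \<in> D" if "t \<in> {0..b}" for t using VX \<epsilon>(2) that unfolding X_def by blast
    ultimately show ?thesis using V_cont unfolding int_sol_def by blast
  qed
  ultimately show ?thesis using that by blast
qed

text \<open>
  Extension is a case of perturbation: a solution that is frozen at \<open>y b\<close> after time \<open>b\<close> solves the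
  equation for a forcing \<open>w2\<close> that compensates \<open>f (y b)\<close>, and on \<open>[b, b + h]\<close> the functions \<open>w\<close> and
  \<open>w2\<close> differ by at most \<open>(K + M) h\<close>, where \<open>M\<close> bounds \<open>f\<close> on \<open>C\<close>. The gain \<open>h\<close> is uniform in \<open>b\<close>,
  which is what shows that a maximal solution cannot stay in \<open>C\<close>.
\<close>
lemma int_sol_extend:
  assumes C: "compact C" "C \<noteq> {}" "C \<subseteq> D" and "0 \<le> T" and w: "K-lipschitz_on {0..} w"
  obtains h where "h > 0"
    "\<And>b y. \<lbrakk>0 \<le> b; b \<le> T; int_sol f D y0 w b y; y ` {0..b} \<subseteq> C\<rbrakk> \<Longrightarrow> \<exists>y'. int_sol f D y0 w (b + h) y'"
proof -
  have "0 \<le> T + 1" using \<open>0 \<le> T\<close> by simp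
  from int_sol_perturb[OF C this] obtain \<delta> where \<delta>: "\<delta> > 0"
    "\<And>b w w' y. \<lbrakk>0 \<le> b; b \<le> T + 1; int_sol f D y0 w b y; y ` {0..b} \<subseteq> C; continuous_on {0..b} w';
       \<And>t. t \<in> {0..b} \<Longrightarrow> norm (w' t - w t) \<le> \<delta>\<rbrakk> \<Longrightarrow> \<exists>y'. int_sol f D y0 w' b y'" by metis
  have "compact (f ` C)" using C continuous_on_field by (auto intro: compact_continuous_image continuous_on_subset)
  then obtain M where M: "M > 0" "\<And>x. x \<in> C \<Longrightarrow> norm (f x) \<le> M"
    using compact_imp_bounded bounded_pos[of "f ` C"] by auto
  have "K \<ge> 0" using w by (rule lipschitz_on_nonneg)
  define h where "h = min 1 (\<delta> / (K + M))"
  have "h > 0" "h \<le> 1" using \<delta>(1) \<open>K \<ge> 0\<close> M(1) by (auto simp: h_def)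
  have hK: "(K + M) * h \<le> \<delta>"
  proof -
    have "h \<le> \<delta> / (K + M)" by (simp add: h_def)
    then show ?thesis using \<open>K \<ge> 0\<close> M(1) by (simp add: field_simps)
  qed
  have "\<exists>y'. int_sol f D y0 w (b + h) y'"
    if b: "0 \<le> b" "b \<le> T" and y: "int_sol f D y0 w b y" "y ` {0..b} \<subseteq> C" for b y
  proof -
    define y2 where "y2 t = y (min t b)" for t
    define w2 where "w2 t = (if t \<le> b then w t else w b - (t - b) *\<^sub>R f (y b))" for t
    have sol: "int_sol f D y0 w2 (b + h) y2"
      unfolding int_sol_def
    proof (intro conjI ballI)
      show "continuous_on {0..b + h} y2"
        unfolding y2_def using b
        by (intro continuous_on_compose2[OF int_solD(1)[OF y(1)]] continuous_intros) auto
      fix t assume t: "t \<in> {0..b + h}"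
      show "y2 t \<in> D" using int_solD(2)[OF y(1), of "min t b"] t b by (simp add: y2_def)
      show "y2 t = y0 + w2 t + integral {0..t} (\<lambda>s. f (y2 s))"
      proof (cases "t \<le> b")
        case True
        have "integral {0..t} (\<lambda>s. f (y2 s)) = integral {0..t} (\<lambda>s. f (y s))"
          by (rule Henstock_Kurzweil_Integration.integral_cong) (use True in \<open>auto simp: y2_def\<close>)
        then show ?thesis using int_solD(3)[OF y(1), of t] True t by (simp add: y2_def w2_def)
      next
        case False
        have 1: "((\<lambda>s. f (y2 s)) has_integral integral {0..b} (\<lambda>s. f (y s))) {0..b}"
          by (rule has_integral_eq[OF _ integrable_integral[OF int_sol_integrable[OF y(1)]]])
             (auto simp: y2_def)
        have 2: "((\<lambda>s. f (y2 s)) has_integral (t - b) *\<^sub>R f (y b)) {b..t}"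
        proof (rule has_integral_eq)
          show "((\<lambda>s. f (y b)) has_integral (t - b) *\<^sub>R f (y b)) {b..t}"
            using has_integral_const_real[of "f (y b)" b t] False by simp
        qed (simp add: y2_def)
        have "((\<lambda>s. f (y2 s)) has_integral integral {0..b} (\<lambda>s. f (y s)) + (t - b) *\<^sub>R f (y b)) {0..t}"
          by (rule has_integral_combine[OF _ _ 1 2]) (use b False in auto)
        moreover have "y b = y0 + w b + integral {0..b} (\<lambda>s. f (y s))" using int_solD(3)[OF y(1), of b] b by simp
        ultimately show ?thesis using False by (simp add: y2_def w2_def integral_unique algebra_simps)
      qed
    qed
    show ?thesis
    proof (rule \<delta>(2)[OF _ _ sol])
      show "y2 ` {0..b + h} \<subseteq> C" using y(2) b by (auto simp: y2_def)
      show "continuous_on {0..b + h} w"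
        using lipschitz_on_continuous_on[OF w] by (rule continuous_on_subset) auto
      fix t assume t: "t \<in> {0..b + h}"
      show "norm (w t - w2 t) \<le> \<delta>"
      proof (cases "t \<le> b")
        case False
        have "norm (w t - w2 t) \<le> norm (w t - w b) + norm ((t - b) *\<^sub>R f (y b))"
          using False norm_triangle_ineq[of "w t - w b" "(t - b) *\<^sub>R f (y b)"] by (simp add: w2_def algebra_simps)
        also have "norm (w t - w b) \<le> K * (t - b)"
          using lipschitz_onD[OF w, of t b] b False by (simp add: dist_norm)
        also have "norm ((t - b) *\<^sub>R f (y b)) \<le> (t - b) * M"
          using M(2)[OF subsetD[OF y(2) imageI]] b False by (simp add: mult_left_mono)
        also have "K * (t - b) + (t - b) * M = (K + M) * (t - b)" by (simp add: algebra_simps)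
        also have "\<dots> \<le> (K + M) * h" using t \<open>K \<ge> 0\<close> M(1) by (intro mult_left_mono) auto
        finally show ?thesis using hK by simp
      qed (use \<delta>(1) in \<open>simp add: w2_def\<close>)
    qed (use b \<open>h > 0\<close> \<open>h \<le> 1\<close> in auto)
  qed
  then show ?thesis using that \<open>h > 0\<close> by blast
qed

end

section \<open>Essentially bounded forcings\<close>

definition ess_bounded :: "real \<Rightarrow> (real \<Rightarrow> 'a::euclidean_space) \<Rightarrow> bool" where
  "ess_bounded K g \<longleftrightarrow> g \<in> borel_measurable (lebesgue_on {0..}) \<and> (AE s in lebesgue. 0 \<le> s \<longrightarrow> norm (g s) \<le> K)"

definition forcing :: "(real \<Rightarrow> real^2^2) \<Rightarrow> (real \<Rightarrow> real^2) \<Rightarrow> real \<Rightarrow> real^2" where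
  "forcing B u t = integral {0..t} (\<lambda>s. B s *v u s)"

lemma borel_measurable_lebesgue_on_nonneg:
  fixes g :: "real \<Rightarrow> 'b::euclidean_space"
  assumes "g \<in> borel_measurable (lebesgue_on {0<..})"
  shows "g \<in> borel_measurable (lebesgue_on {0..})"
proof (rule borel_measurable_if_D)
  have "(\<lambda>x. if x \<in> {0<..} then g x else 0) \<in> borel_measurable lebesgue"
    by (rule borel_measurable_if_I[OF assms]) auto
  moreover have "(\<lambda>x::real. indicator {0} x *\<^sub>R g 0) \<in> borel_measurable lebesgue"
    by (intro borel_measurable_scaleR borel_measurable_indicator) auto
  ultimately have "(\<lambda>x. (if x \<in> {0<..} then g x else 0) + indicator {0} x *\<^sub>R g 0) \<in> borel_measurable lebesgue"
    by (rule borel_measurable_add)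
  also have "(\<lambda>x. (if x \<in> {0<..} then g x else 0) + indicator {0} x *\<^sub>R g 0) = (\<lambda>x. if x \<in> {0..} then g x else 0)"
    by (auto simp: fun_eq_iff indicator_def)
  finally show "(\<lambda>x. if x \<in> {0..} then g x else 0) \<in> borel_measurable lebesgue" .
qed

lemma AE_lebesgue_on_pos_iff:
  "(AE s in lebesgue_on {0<..}. P s) \<longleftrightarrow> (AE s in lebesgue. 0 \<le> (s::real) \<longrightarrow> P s)"
proof -
  have "AE s in lebesgue. s \<noteq> (0::real)"
    by (rule AE_I'[of "{0}"]) (auto simp flip: negligible_iff_null_sets)
  then have "AE s in lebesgue. (s \<in> {0<..} \<longrightarrow> P s) \<longleftrightarrow> (0 \<le> s \<longrightarrow> P s)"
    by (rule eventually_mono) force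
  then have "(AE s in lebesgue. s \<in> {0<..} \<longrightarrow> P s) \<longleftrightarrow> (AE s in lebesgue. 0 \<le> s \<longrightarrow> P s)"
    by (rule eventually_subst)
  then show ?thesis by (simp add: AE_restrict_space_iff)
qed

lemma AE_lebesgue_on_nonneg_iff:
  "(AE s in lebesgue_on {0..}. P s) \<longleftrightarrow> (AE s in lebesgue. 0 \<le> (s::real) \<longrightarrow> P s)"
proof -
  have "(AE s in lebesgue_on {0..}. P s) \<longleftrightarrow> (AE s in lebesgue. s \<in> {0..} \<longrightarrow> P s)"
    by (rule AE_restrict_space_iff) simp
  then show ?thesis by simp
qed

lemma AE_lebesgue_negligible:
  assumes "AE t in lebesgue. P t"
  obtains N where "negligible N" "\<And>t. t \<notin> N \<Longrightarrow> P t"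
proof -
  obtain N where N: "N \<in> null_sets lebesgue" "{t \<in> space lebesgue. \<not> P t} \<subseteq> N"
    using assms unfolding eventually_ae_filter by blast
  show ?thesis
  proof (rule that[of N])
    show "negligible N" using N(1) by (simp add: negligible_iff_null_sets)
    show "P t" if "t \<notin> N" for t using N(2) that by (auto simp: subset_iff)
  qed
qed

text \<open>
  The essential suprema over \<open>(0, \<infinity>)\<close> and \<open>[0, \<infinity>)\<close> bound the same function up to a null set. The
  bound \<open>m\<close> is positive because \<open>B\<close> does not vanish almost everywhere.
\<close>
lemma L_infty_bound:
  assumes B: "L_infty B" "\<not> (AE s in lebesgue_on {0<..}. B s = 0)" and "\<rho> > 0"
  obtains m where "m > 0" "K_zero B \<rho> = m * \<rho>" "B \<in> borel_measurable (lebesgue_on {0..})"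
    "AE s in lebesgue. 0 \<le> s \<longrightarrow> onorm ((*v) (B s)) \<le> m"
proof -
  let ?\<Phi> = "\<lambda>s. ereal (onorm ((*v) (B s)))"
  define E where "E = esssup (lebesgue_on {0..}) ?\<Phi>"
  define c where "c = esssup (lebesgue_on {0<..}) ?\<Phi>"
  have "c < \<infinity>" using B(1) by (simp add: L_infty_def c_def)
  have "?\<Phi> \<in> borel_measurable (lebesgue_on {0<..})"
    using \<open>c < \<infinity>\<close> unfolding c_def by (metis esssup_non_measurable less_irrefl top_ereal_def)
  then have "(\<lambda>s. real_of_ereal (?\<Phi> s)) \<in> borel_measurable (lebesgue_on {0<..})"
    by (rule borel_measurable_real_of_ereal)
  then have "(\<lambda>s. onorm ((*v) (B s))) \<in> borel_measurable (lebesgue_on {0..})"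
    by (intro borel_measurable_lebesgue_on_nonneg) simp
  then have meas: "?\<Phi> \<in> borel_measurable (lebesgue_on {0..})" by (rule borel_measurable_ereal)
  have "AE s in lebesgue_on {0<..}. ?\<Phi> s \<le> c" unfolding c_def by (rule esssup_AE)
  then have "AE s in lebesgue_on {0..}. ?\<Phi> s \<le> c"
    by (simp only: AE_lebesgue_on_pos_iff AE_lebesgue_on_nonneg_iff)
  with meas have "E \<le> c" unfolding E_def by (rule esssup_I)
  have AE_E: "AE s in lebesgue. 0 \<le> s \<longrightarrow> ?\<Phi> s \<le> E"
    using esssup_AE[of ?\<Phi> "lebesgue_on {0..}"] unfolding E_def[symmetric] AE_lebesgue_on_nonneg_iff .
  have "0 < E"
  proof (rule ccontr)
    assume "\<not> 0 < E"
    have "AE s in lebesgue_on {0<..}. B s = 0"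
      unfolding AE_lebesgue_on_pos_iff using AE_E
    proof eventually_elim
      case (elim s)
      show ?case
      proof
        assume "0 \<le> s"
        then have "ereal (onorm ((*v) (B s))) \<le> 0" using elim \<open>\<not> 0 < E\<close> by (metis linorder_not_less order_trans)
        then have "onorm ((*v) (B s)) \<le> 0" by (simp add: zero_ereal_def)
        then have "onorm ((*v) (B s)) = 0"
          using onorm_pos_le[OF matrix_vector_mul_bounded_linear, of "B s"] by linarith
        then have "\<And>x. B s *v x = 0" by (simp add: onorm_eq_0)
        then show "B s = 0" by (metis matrix_eq matrix_vector_mult_0)
      qed
    qed
    then show False using B(2) by contradiction
  qed
  then obtain m where m: "E = ereal m" using \<open>E \<le> c\<close> \<open>c < \<infinity>\<close> by (cases E) auto
  show ?thesis
  proof (rule that)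
    show "m > 0" using \<open>0 < E\<close> m by simp
    show "K_zero B \<rho> = m * \<rho>" by (simp add: K_zero_def E_def[symmetric] m)
    show "B \<in> borel_measurable (lebesgue_on {0..})"
      using B(1) by (intro borel_measurable_lebesgue_on_nonneg) (simp add: L_infty_def)
    show "AE s in lebesgue. 0 \<le> s \<longrightarrow> onorm ((*v) (B s)) \<le> m" using AE_E by (simp add: m)
  qed
qed

lemma borel_measurable_matrix_vector_mult:
  fixes B :: "'b \<Rightarrow> real^'n^'m"
  assumes "B \<in> borel_measurable M" "u \<in> borel_measurable M"
  shows "(\<lambda>s. B s *v u s) \<in> borel_measurable M"
proof (rule borel_measurable_continuous_Pair[OF assms])
  show "continuous_on UNIV (\<lambda>x::(real^'n^'m) \<times> (real^'n). fst x *v snd x)"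
    unfolding matrix_vector_mult_def
    by (intro continuous_on_vec_lambda continuous_intros)
qed

lemma ess_bounded_forcing:
  assumes "B \<in> borel_measurable (lebesgue_on {0..})" "AE s in lebesgue. 0 \<le> s \<longrightarrow> onorm ((*v) (B s)) \<le> m"
    and "m > 0" "u \<in> U_ad \<rho>"
  shows "ess_bounded (m * \<rho>) (\<lambda>s. B s *v u s)"
  unfolding ess_bounded_def
proof
  show "(\<lambda>s. B s *v u s) \<in> borel_measurable (lebesgue_on {0..})"
    using assms by (intro borel_measurable_matrix_vector_mult) (auto simp: U_ad_def)
  have "AE t in lebesgue. 0 \<le> t \<longrightarrow> norm (u t) \<le> \<rho>"
    using assms(4) by (simp add: U_ad_def AE_lebesgue_on_nonneg_iff)
  with assms(2) show "AE s in lebesgue. 0 \<le> s \<longrightarrow> norm (B s *v u s) \<le> m * \<rho>"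
  proof eventually_elim
    case (elim s)
    have "norm (B s *v u s) \<le> onorm ((*v) (B s)) * norm (u s)"
      by (rule onorm[OF matrix_vector_mul_bounded_linear])
    moreover have "onorm ((*v) (B s)) * norm (u s) \<le> m * \<rho>" if "0 \<le> s"
      using elim that \<open>m > 0\<close> by (intro mult_mono) auto
    ultimately show ?case by linarith
  qed
qed

text \<open>
  The bound on \<open>g\<close> holds only almost everywhere, so \<open>g\<close> is replaced by its truncation at \<open>K\<close>.
\<close>
lemma ess_bounded_integral:
  fixes g :: "real \<Rightarrow> 'a::euclidean_space"
  assumes g: "ess_bounded K g" and "0 \<le> K" "0 \<le> a" "a \<le> b"
  shows "g integrable_on {a..b}" "norm (integral {a..b} g) \<le> K * (b - a)"
proof -
  define g' where "g' s = (if norm (g s) \<le> K then g s else 0)" for s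
  obtain N where N: "negligible N" "\<And>s. 0 \<le> s \<Longrightarrow> s \<notin> N \<Longrightarrow> norm (g s) \<le> K"
    using g unfolding ess_bounded_def eventually_ae_filter negligible_iff_null_sets by auto
  have m: "g \<in> borel_measurable (lebesgue_on {a..b})"
    using g \<open>0 \<le> a\<close> unfolding ess_bounded_def by (auto intro: measurable_restrict_mono)
  have "g' \<in> borel_measurable (lebesgue_on {a..b})"
    unfolding g'_def using m by measurable
  then have "g' integrable_on {a..b}"
    by (rule measurable_bounded_by_integrable_imp_integrable[where g="\<lambda>_. K"])
       (use \<open>0 \<le> K\<close> in \<open>auto simp: g'_def\<close>)
  then have g': "(g' has_integral integral {a..b} g') {a..b}" by (rule integrable_integral)
  have "norm (integral {a..b} g') \<le> K * content (cbox a b)"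
    by (rule has_integral_bound[of K g']) (use g' \<open>0 \<le> K\<close> in \<open>auto simp: g'_def\<close>)
  moreover have "(g has_integral integral {a..b} g') {a..b}"
    by (rule has_integral_spike[OF N(1) _ g']) (use N(2) \<open>0 \<le> a\<close> in \<open>auto simp: g'_def\<close>)
  ultimately show "g integrable_on {a..b}" "norm (integral {a..b} g) \<le> K * (b - a)"
    using \<open>a \<le> b\<close> by (simp_all add: integral_unique has_integral_integrable)
qed

lemma lipschitz_on_indefinite_integral:
  fixes g :: "real \<Rightarrow> 'a::euclidean_space"
  assumes g: "ess_bounded K g" and "0 \<le> K"
  shows "K-lipschitz_on {0..} (\<lambda>t. integral {0..t} g)"
proof (rule lipschitz_on_leI)
  fix s t :: real assume st: "s \<in> {0..}" "t \<in> {0..}" "s \<le> t"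
  have "integral {0..s} g + integral {s..t} g = integral {0..t} g"
    by (rule Henstock_Kurzweil_Integration.integral_combine)
       (use st ess_bounded_integral[OF assms] in auto)
  then have "dist (integral {0..s} g) (integral {0..t} g) = norm (integral {s..t} g)"
    by (metis add_diff_cancel_left' dist_commute dist_norm)
  also have "\<dots> \<le> K * dist s t"
    using ess_bounded_integral(2)[OF assms, of s t] st by (simp add: dist_real_def)
  finally show "dist (integral {0..s} g) (integral {0..t} g) \<le> K * dist s t" .
qed (fact \<open>0 \<le> K\<close>)

section \<open>Maximal solutions and quenching times\<close>

text \<open>
  The a priori information on a vector field from which existence of the quenching time follows. It
  speaks of Lipschitz forcings only, so it can be established without measure theory. The second
  alternative never occurs for maximal solutions, but it is the form in which the estimates for
  the vector fields arise.
\<close>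
definition quenches :: "('a::euclidean_space \<Rightarrow> 'a) \<Rightarrow> 'a set \<Rightarrow> real \<Rightarrow> 'a \<Rightarrow> bool" where
  "quenches f D K y0 \<longleftrightarrow> (\<exists>Tb. \<forall>w y T. K-lipschitz_on {0..} w \<longrightarrow> w 0 = 0 \<longrightarrow> 0 < T \<longrightarrow>
     (\<forall>b\<in>{0..<T}. int_sol f D y0 w b y) \<longrightarrow>
     T \<le> Tb \<and> (filterlim (\<lambda>t. norm (f (y t))) at_top (at_left T) \<or>
       (\<exists>C. compact C \<and> C \<subseteq> D \<and> y ` {0..<T} \<subseteq> C)))"

context
  fixes f :: "real^2 \<Rightarrow> real^2" and D :: "(real^2) set" and B :: "real \<Rightarrow> real^2^2" and u y0 K
  assumes field: "lipschitz_field f D" and bdd: "ess_bounded K (\<lambda>s. B s *v u s)" and K: "0 \<le> K"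
    and y0: "y0 \<in> D"
begin

interpretation lipschitz_field f D by (rule field)

lemma forcing_lipschitz: "K-lipschitz_on {0..} (forcing B u)"
  using lipschitz_on_indefinite_integral[OF bdd K] unfolding forcing_def[abs_def] .

lemma solves_on_imp_int_sol:
  assumes y: "solves_on f D B y0 u T y" and b: "0 \<le> b" "ereal b < T"
  shows "int_sol f D y0 (forcing B u) b y"
  unfolding int_sol_def
proof (intro conjI ballI)
  have less_T: "ereal t < T" if "t \<le> b" for t
    using le_less_trans[of "ereal t" "ereal b" T] b(2) that by simp
  have y_in: "\<And>t. 0 \<le> t \<Longrightarrow> ereal t < T \<Longrightarrow> y t \<in> D"
    and y_ac: "\<And>b. 0 \<le> b \<Longrightarrow> ereal b < T \<Longrightarrow> abs_continuous_on {0..b} y"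
    and y_0: "y 0 = y0"
    and y_deriv: "AE t in lebesgue. 0 < t \<and> ereal t < T \<longrightarrow> (y has_vector_derivative (f (y t) + B t *v u t)) (at t)"
    using y unfolding solves_on_def by blast+
  have ac: "abs_continuous_on {0..t} y" if "t \<in> {0..b}" for t
    using that by (intro y_ac less_T) auto
  show cont: "continuous_on {0..b} y" using ac b by (intro abs_continuous_on_imp_continuous_on) auto
  fix t assume t: "t \<in> {0..b}"
  have inD: "y s \<in> D" if "s \<in> {0..b}" for s
    using that by (intro y_in less_T) auto
  show "y t \<in> D" by (rule inD[OF t])
  obtain N where N: "negligible N" "\<And>t. t \<notin> N \<Longrightarrow> 0 < t \<and> ereal t < T \<longrightarrow> (y has_vector_derivative (f (y t) + B t *v u t)) (at t)"
    by (rule AE_lebesgue_negligible[OF y_deriv], rule that)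
  have "((\<lambda>s. f (y s) + B s *v u s) has_integral (y t - y 0)) {0..t}"
  proof (rule abs_continuous_imp_has_integral[OF _ ac[OF t], of "insert 0 N"])
    show "negligible (insert 0 N)" using N(1) by simp
    fix s assume s: "s \<in> {0..t} - insert 0 N"
    have "ereal s < T" using s t by (intro less_T) auto
    then show "(y has_vector_derivative (f (y s) + B s *v u s)) (at s within {0..t})"
      using N(2)[of s] s by (simp add: has_vector_derivative_at_within)
  qed (use t in auto)
  then have "y t - y 0 = integral {0..t} (\<lambda>s. f (y s) + B s *v u s)" by (simp add: integral_unique)
  also have "\<dots> = integral {0..t} (\<lambda>s. f (y s)) + forcing B u t"
    unfolding forcing_def
  proof (rule Henstock_Kurzweil_Integration.integral_add)
    have "continuous_on {0..t} (\<lambda>s. f (y s))"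
      using cont inD t by (intro continuous_on_compose2[OF continuous_on_field]) (auto intro: continuous_on_subset)
    then show "(\<lambda>s. f (y s)) integrable_on {0..t}" by (rule integrable_continuous_real)
    show "(\<lambda>s. B s *v u s) integrable_on {0..t}" using t by (intro ess_bounded_integral[OF bdd K]) auto
  qed
  finally show "y t = y0 + forcing B u t + integral {0..t} (\<lambda>s. f (y s))"
    using y_0 by (simp add: algebra_simps)
qed

lemma int_sol_imp_solves_on:
  assumes T: "0 < T" and sol: "\<And>b. 0 \<le> b \<Longrightarrow> ereal b < T \<Longrightarrow> int_sol f D y0 (forcing B u) b y"
  shows "solves_on f D B y0 u T y"
  unfolding solves_on_def
proof (intro conjI allI impI)
  show "0 < T" by (rule T)
  show "y 0 = y0" using int_solD(3)[OF sol[of 0], of 0] T by (simp add: forcing_def zero_ereal_def)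
  show "y t \<in> D" if "0 \<le> t \<and> ereal t < T" for t using int_solD(2)[OF sol[of t], of t] that by simp
  show "abs_continuous_on {0..b} y" if b: "0 \<le> b \<and> ereal b < T" for b
  proof -
    note s = sol[OF conjunct1[OF b] conjunct2[OF b]]
    have fy: "continuous_on {0..b} (\<lambda>s. f (y s))"
      using int_solD(1,2)[OF s] by (intro continuous_on_compose2[OF continuous_on_field]) auto
    then have "compact ((\<lambda>s. f (y s)) ` {0..b})" by (rule compact_continuous_image) simp
    then obtain M where M: "M > 0" "\<And>s. s \<in> {0..b} \<Longrightarrow> norm (f (y s)) \<le> M"
      using compact_imp_bounded bounded_pos[of "(\<lambda>s. f (y s)) ` {0..b}"] by auto
    have "(K + M)-lipschitz_on {0..b} y"
    proof (rule lipschitz_on_leI)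
      fix r t assume rt: "r \<in> {0..b}" "t \<in> {0..b}" "r \<le> t"
      have "integral {0..r} (\<lambda>s. f (y s)) + integral {r..t} (\<lambda>s. f (y s)) = integral {0..t} (\<lambda>s. f (y s))"
        by (rule Henstock_Kurzweil_Integration.integral_combine)
           (use rt int_sol_integrable[OF s] in auto)
      then have "y t - y r = (forcing B u t - forcing B u r) + integral {r..t} (\<lambda>s. f (y s))"
        using int_solD(3)[OF s rt(1)] int_solD(3)[OF s rt(2)] by (simp add: algebra_simps)
      then have "norm (y t - y r) \<le> norm (forcing B u t - forcing B u r) + norm (integral {r..t} (\<lambda>s. f (y s)))"
        using norm_triangle_ineq by metis
      also have "norm (forcing B u t - forcing B u r) \<le> K * (t - r)"
        using lipschitz_onD[OF forcing_lipschitz, of t r] rt by (simp add: dist_norm)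
      also have "norm (integral {r..t} (\<lambda>s. f (y s))) \<le> M * (t - r)"
        by (rule integral_bound) (use rt M fy in \<open>auto intro: continuous_on_subset\<close>)
      finally show "dist (y r) (y t) \<le> (K + M) * dist r t"
        using rt(3) by (simp add: dist_norm norm_minus_commute algebra_simps)
    qed (use K M(1) in auto)
    then show ?thesis by (rule lipschitz_imp_abs_continuous)
  qed
  let ?bad = "\<lambda>n::nat. {t\<in>{0<..<real n}. \<not> (forcing B u has_vector_derivative B t *v u t) (at t)}"
  have "negligible (?bad n)" for n
    unfolding forcing_def[abs_def]
    by (rule negligible_no_derivative_indefinite_integral) (intro ess_bounded_integral[OF bdd K]; simp)
  then have "negligible (\<Union>n. ?bad n)" by (intro negligible_countable_Union) auto
  then have "(\<Union>n. ?bad n) \<in> null_sets lebesgue" by (simp add: negligible_iff_null_sets)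
  moreover have "{t \<in> space lebesgue. \<not> (0 < t \<and> ereal t < T \<longrightarrow> (y has_vector_derivative (f (y t) + B t *v u t)) (at t))} \<subseteq> (\<Union>n. ?bad n)"
  proof (rule subsetI, rule ccontr)
    fix t assume t: "t \<in> {t \<in> space lebesgue. \<not> (0 < t \<and> ereal t < T \<longrightarrow> (y has_vector_derivative (f (y t) + B t *v u t)) (at t))}"
      and nt: "t \<notin> (\<Union>n. ?bad n)"
    then have "0 < t" "ereal t < T" by auto
    obtain n where "t < real n" using reals_Archimedean2 by blast
    then have w: "(forcing B u has_vector_derivative B t *v u t) (at t)" using nt \<open>0 < t\<close> by auto
    obtain b where b: "t < b" "ereal b < T" using ereal_dense2[OF \<open>ereal t < T\<close>] by auto
    have s: "int_sol f D y0 (forcing B u) b y" using b \<open>0 < t\<close> by (intro sol) auto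
    have "continuous_on {0..b} (\<lambda>s. f (y s))"
      using int_solD(1,2)[OF s] by (intro continuous_on_compose2[OF continuous_on_field]) auto
    then have "((\<lambda>t. integral {0..t} (\<lambda>s. f (y s))) has_vector_derivative f (y t)) (at t within {0..b})"
      by (rule integral_has_vector_derivative) (use \<open>0 < t\<close> b in auto)
    then have i: "((\<lambda>t. integral {0..t} (\<lambda>s. f (y s))) has_vector_derivative f (y t)) (at t)"
      using \<open>0 < t\<close> b by (simp add: at_within_Icc_at)
    have "((\<lambda>t. y0 + forcing B u t + integral {0..t} (\<lambda>s. f (y s))) has_vector_derivative (0 + B t *v u t + f (y t))) (at t)"
      by (intro has_vector_derivative_add has_vector_derivative_const w i)
    then have "(y has_vector_derivative (0 + B t *v u t + f (y t))) (at t)"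
    proof (rule has_vector_derivative_transform_within_open[of _ _ _ "{0<..<b}"])
      show "y0 + forcing B u t + integral {0..t} (\<lambda>s. f (y s)) = y t" if "t \<in> {0<..<b}" for t
        using int_solD(3)[OF s, of t] that by simp
    qed (use \<open>0 < t\<close> b in auto)
    then show False using t by (simp add: add.commute)
  qed
  ultimately show "AE t in lebesgue. 0 < t \<and> ereal t < T \<longrightarrow> (y has_vector_derivative (f (y t) + B t *v u t)) (at t)"
    by (intro AE_I') 
qed

text \<open>
  A solution on a closed interval \<open>[0, b]\<close> runs in a compact set and can be extended, hence the strict
  inequality.
\<close>
lemma less_T_max_iff:
  assumes "0 \<le> b"
  shows "ereal b < T_max f D B y0 u \<longleftrightarrow> (\<exists>y. int_sol f D y0 (forcing B u) b y)"
proof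
  assume "ereal b < T_max f D B y0 u"
  then obtain T y where "ereal b < T" "solves_on f D B y0 u T y"
    unfolding T_max_def less_Sup_iff by auto
  then show "\<exists>y. int_sol f D y0 (forcing B u) b y" using solves_on_imp_int_sol assms by blast
next
  assume "\<exists>y. int_sol f D y0 (forcing B u) b y"
  then obtain y where y: "int_sol f D y0 (forcing B u) b y" by blast
  have C: "compact (y ` {0..b})" "y ` {0..b} \<noteq> {}" "y ` {0..b} \<subseteq> D"
    using int_solD(1,2)[OF y] assms by (auto intro: compact_continuous_image)
  obtain h where "h > 0" "\<exists>y'. int_sol f D y0 (forcing B u) (b + h) y'"
    using int_sol_extend[OF C assms forcing_lipschitz] y assms by (metis order_refl)
  then obtain y' where y': "int_sol f D y0 (forcing B u) (b + h) y'" by blast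
  have "solves_on f D B y0 u (ereal (b + h)) y'"
    by (rule int_sol_imp_solves_on) (use \<open>h > 0\<close> assms in \<open>auto intro: int_sol_mono[OF y']\<close>)
  then have "ereal (b + h) \<le> T_max f D B y0 u"
    unfolding T_max_def by (intro Sup_upper) auto
  moreover have "ereal b < ereal (b + h)" using \<open>h > 0\<close> by simp
  ultimately show "ereal b < T_max f D B y0 u" by order
qed

lemma T_max_pos: "0 < T_max f D B y0 u"
proof -
  have "int_sol f D y0 (forcing B u) 0 (\<lambda>_. y0)" using y0 by (simp add: int_sol_def forcing_def)
  then show ?thesis using less_T_max_iff[of 0] by (auto simp: zero_ereal_def)
qed

text \<open>
  The supremum of the existence times is attained: by uniqueness the solutions on the intervals
  \<open>[0, b]\<close> fit together to one on \<open>[0, T_max)\<close>.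
\<close>
lemma traj_int_sol:
  assumes "0 \<le> b" "ereal b < T_max f D B y0 u"
  shows "int_sol f D y0 (forcing B u) b (traj f D B y0 u)"
proof -
  define Y where "Y b = (SOME y. int_sol f D y0 (forcing B u) b y)" for b
  have Y: "int_sol f D y0 (forcing B u) b (Y b)" if "0 \<le> b" "ereal b < T_max f D B y0 u" for b
    unfolding Y_def by (rule someI_ex[OF iffD1[OF less_T_max_iff[OF that(1)] that(2)]])
  have "solves_on f D B y0 u (T_max f D B y0 u) (\<lambda>t. Y t t)"
  proof (rule int_sol_imp_solves_on[OF T_max_pos])
    fix b assume b: "0 \<le> b" "ereal b < T_max f D B y0 u"
    have eq: "Y t t = Y b t" if "t \<in> {0..b}" for t
    proof (rule int_sol_unique[where y = "Y t" and y' = "Y b" and b = t])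
      have "ereal t < T_max f D B y0 u"
        using le_less_trans[of "ereal t" "ereal b" "T_max f D B y0 u"] that b(2) by simp
      then show "int_sol f D y0 (forcing B u) t (Y t)" using that by (intro Y) auto
      show "int_sol f D y0 (forcing B u) t (Y b)" using that by (intro int_sol_mono[OF Y[OF b]]) auto
    qed (use that in auto)
    show "int_sol f D y0 (forcing B u) b (\<lambda>t. Y t t)"
      unfolding int_sol_def
    proof (intro conjI ballI)
      show "continuous_on {0..b} (\<lambda>t. Y t t)"
        by (rule continuous_on_eq[OF int_solD(1)[OF Y[OF b]]]) (simp add: eq)
      fix t assume t: "t \<in> {0..b}"
      show "Y t t \<in> D" using int_solD(2)[OF Y[OF b] t] unfolding eq[OF t] .
      have "integral {0..t} (\<lambda>s. f (Y s s)) = integral {0..t} (\<lambda>s. f (Y b s))"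
        by (rule Henstock_Kurzweil_Integration.integral_cong) (use t eq in auto)
      then show "Y t t = y0 + forcing B u t + integral {0..t} (\<lambda>s. f (Y s s))"
        using int_solD(3)[OF Y[OF b] t] unfolding eq[OF t] by simp
    qed
  qed
  then have "solves_on f D B y0 u (T_max f D B y0 u) (traj f D B y0 u)"
    unfolding traj_def by (rule someI[where P = "solves_on f D B y0 u (T_max f D B y0 u)"])
  then show ?thesis by (rule solves_on_imp_int_sol[OF _ assms])
qed

text \<open>
  Within a compact set solutions can be extended by a fixed length \<open>h\<close>, in particular from a time
  \<open>b > T - h\<close>.
\<close>
lemma traj_not_in_compact:
  assumes T: "T_max f D B y0 u = ereal T" and C: "compact C" "C \<subseteq> D"
  shows "\<not> traj f D B y0 u ` {0..<T} \<subseteq> C"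
proof
  assume sub: "traj f D B y0 u ` {0..<T} \<subseteq> C"
  have "0 < T" using T_max_pos T by simp
  then have "C \<noteq> {}" using sub by fastforce
  from int_sol_extend[OF C(1) this C(2) less_imp_le[OF \<open>0 < T\<close>] forcing_lipschitz, of y0]
  obtain h where h: "h > 0"
    "\<And>b y. \<lbrakk>0 \<le> b; b \<le> T; int_sol f D y0 (forcing B u) b y; y ` {0..b} \<subseteq> C\<rbrakk>
      \<Longrightarrow> \<exists>y'. int_sol f D y0 (forcing B u) (b + h) y'" by metis
  define b where "b = max 0 (T - h / 2)"
  have b: "0 \<le> b" "b < T" "T < b + h" using \<open>0 < T\<close> \<open>h > 0\<close> by (auto simp: b_def)
  have "\<exists>y'. int_sol f D y0 (forcing B u) (b + h) y'"
  proof (rule h(2))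
    show "int_sol f D y0 (forcing B u) b (traj f D B y0 u)" using b T by (intro traj_int_sol) auto
    show "traj f D B y0 u ` {0..b} \<subseteq> C" using sub b by force
  qed (use b in auto)
  then have "ereal (b + h) < ereal T" using less_T_max_iff[of "b + h"] b \<open>h > 0\<close> T by auto
  then show False using b by simp
qed

text \<open>
  At a time before \<open>T_max\<close> the trajectory is in the open domain of \<open>f\<close>, where \<open>f\<close> is continuous and
  hence locally bounded. So \<open>T_max\<close> is the only candidate for a quenching time.
\<close>
lemma T_max_eq_T_q:
  assumes q: "quenches f D K y0"
  shows "T_max f D B y0 u = ereal (T_q f D B y0 u)" "0 < T_q f D B y0 u"
proof -
  let ?y = "traj f D B y0 u"
  from q[unfolded quenches_def] obtain Tb where "\<forall>w y T. K-lipschitz_on {0..} w \<longrightarrow> w 0 = 0 \<longrightarrow> 0 < T \<longrightarrow>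
     (\<forall>b\<in>{0..<T}. int_sol f D y0 w b y) \<longrightarrow>
     T \<le> Tb \<and> (filterlim (\<lambda>t. norm (f (y t))) at_top (at_left T) \<or>
       (\<exists>C. compact C \<and> C \<subseteq> D \<and> y ` {0..<T} \<subseteq> C))" by (rule exE)
  note Tb = this[rule_format]
  have w0: "forcing B u 0 = 0" by (simp add: forcing_def)
  have le: "T \<le> Tb" if T: "0 < T" "ereal T \<le> T_max f D B y0 u" for T
  proof -
    have "T \<le> Tb \<and> (filterlim (\<lambda>t. norm (f (?y t))) at_top (at_left T) \<or>
       (\<exists>C. compact C \<and> C \<subseteq> D \<and> ?y ` {0..<T} \<subseteq> C))"
      by (rule Tb[OF forcing_lipschitz w0 T(1)])
         (use less_le_trans[OF _ T(2)] in \<open>simp add: traj_int_sol\<close>)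
    then show ?thesis by blast
  qed
  have "T_max f D B y0 u \<noteq> \<infinity>"
  proof
    assume "T_max f D B y0 u = \<infinity>"
    then have "max 1 (Tb + 1) \<le> Tb" by (intro le) auto
    then show False by simp
  qed
  then obtain T where T: "T_max f D B y0 u = ereal T" using T_max_pos by (cases "T_max f D B y0 u") auto
  have "0 < T" using T_max_pos T by simp
  have sol: "int_sol f D y0 (forcing B u) b ?y" if "b \<in> {0..<T}" for b using that T by (intro traj_int_sol) auto
  have lim: "filterlim (\<lambda>t. norm (f (?y t))) at_top (at_left T)"
    using Tb[OF forcing_lipschitz w0 \<open>0 < T\<close> sol] traj_not_in_compact[OF T] by blast
  have "T_q f D B y0 u = T"
    unfolding T_q_def
  proof (rule the_equality)
    show "is_quenching_time f D B y0 u T"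
      unfolding is_quenching_time_def using \<open>0 < T\<close> T lim int_solD(2)[OF sol] by auto
    fix T' assume T': "is_quenching_time f D B y0 u T'"
    show "T' = T"
    proof (rule ccontr)
      assume "T' \<noteq> T"
      then have T'T: "0 < T'" "T' < T" using T' T by (auto simp: is_quenching_time_def)
      define b where "b = (T' + T) / 2"
      have b: "T' < b" "b \<in> {0..<T}" using T'T by (auto simp: b_def)
      have "continuous_on {0..b} (\<lambda>t. f (?y t))"
        using int_solD(1,2)[OF sol[OF b(2)]] by (intro continuous_on_compose2[OF continuous_on_field]) auto
      then have "isCont (\<lambda>t. f (?y t)) T'"
        using T'T b by (intro continuous_on_interior[of "{0..b}"]) (auto simp: interior_atLeastAtMost_real)
      then have "((\<lambda>t. norm (f (?y t))) \<longlongrightarrow> norm (f (?y T'))) (at_left T')"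
        unfolding isCont_def by (intro tendsto_norm) (rule tendsto_mono[OF at_le], auto)
      moreover have "filterlim (\<lambda>t. norm (f (?y t))) at_infinity (at_left T')"
        using T' unfolding is_quenching_time_def by (intro filterlim_at_top_imp_at_infinity) auto
      ultimately show False using not_tendsto_and_filterlim_at_infinity[of "at_left T'"] by auto
    qed
  qed
  then show "T_max f D B y0 u = ereal (T_q f D B y0 u)" "0 < T_q f D B y0 u" using T \<open>0 < T\<close> by auto
qed

end

section \<open>Lipschitz continuity of the three vector fields and growth of solutions\<close>

text \<open>
  A pointwise form of local Lipschitz continuity that is stable under the quotients from which the
  three vector fields are built.
\<close>
definition lipschitz_near :: "('a::metric_space \<Rightarrow> 'b::metric_space) \<Rightarrow> 'a \<Rightarrow> bool" where
  "lipschitz_near g p \<longleftrightarrow> (\<exists>r>0. \<exists>L. L-lipschitz_on (ball p r) g)"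

lemma lipschitz_near_divide:
  fixes g h :: "'a::metric_space \<Rightarrow> real"
  assumes g: "L-lipschitz_on UNIV g" and h: "M-lipschitz_on UNIV h" and "h p \<noteq> 0"
  shows "lipschitz_near (\<lambda>y. g y / h y) p"
proof -
  have "0 \<le> L" "0 \<le> M" using g h lipschitz_on_nonneg by auto
  define m where "m = \<bar>h p\<bar> / 2"
  define r where "r = m / (M + 1)"
  define G where "G = \<bar>g p\<bar> + L * r"
  have "m > 0" using \<open>h p \<noteq> 0\<close> by (simp add: m_def)
  then have "r > 0" using \<open>0 \<le> M\<close> by (simp add: r_def)
  have "0 \<le> G" using \<open>0 \<le> L\<close> \<open>r > 0\<close> by (simp add: G_def)
  have hm: "m \<le> \<bar>h y\<bar>" if "y \<in> ball p r" for y
  proof -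
    have "\<bar>h y - h p\<bar> \<le> M * dist y p" using lipschitz_onD[OF h, of y p] by (simp add: dist_real_def)
    also have "\<dots> \<le> M * r" using that \<open>0 \<le> M\<close> by (intro mult_left_mono) (auto simp: dist_commute)
    also have "\<dots> \<le> m" using \<open>0 \<le> M\<close> \<open>m > 0\<close> by (simp add: r_def field_simps)
    finally have "\<bar>h y - h p\<bar> \<le> m" .
    then show ?thesis unfolding m_def by linarith
  qed
  have gG: "\<bar>g y\<bar> \<le> G" if "y \<in> ball p r" for y
  proof -
    have "\<bar>g y - g p\<bar> \<le> L * dist y p" using lipschitz_onD[OF g, of y p] by (simp add: dist_real_def)
    also have "\<dots> \<le> L * r" using that \<open>0 \<le> L\<close> by (intro mult_left_mono) (auto simp: dist_commute)
    finally have "\<bar>g y - g p\<bar> \<le> L * r" .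
    then show ?thesis unfolding G_def by linarith
  qed
  have "(L / m + G * M / m\<^sup>2)-lipschitz_on (ball p r) (\<lambda>y. g y / h y)"
  proof (rule lipschitz_onI)
    fix x y assume xy: "x \<in> ball p r" "y \<in> ball p r"
    have nz: "h x \<noteq> 0" "h y \<noteq> 0" using hm[OF xy(1)] hm[OF xy(2)] \<open>m > 0\<close> by auto
    have "g x / h x - g y / h y = (g x - g y) / h x + g y * (h y - h x) / (h x * h y)"
      using nz by (simp add: field_simps)
    then have "\<bar>g x / h x - g y / h y\<bar> \<le> \<bar>g x - g y\<bar> / \<bar>h x\<bar> + \<bar>g y\<bar> * \<bar>h y - h x\<bar> / (\<bar>h x\<bar> * \<bar>h y\<bar>)"
      using abs_triangle_ineq[of "(g x - g y) / h x" "g y * (h y - h x) / (h x * h y)"] by (simp add: abs_mult)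
    also have "\<dots> \<le> L * dist x y / m + G * (M * dist x y) / (m * m)"
    proof (intro add_mono frac_le mult_mono)
      show "\<bar>g x - g y\<bar> \<le> L * dist x y" using lipschitz_onD[OF g, of x y] by (simp add: dist_real_def)
      show "\<bar>h y - h x\<bar> \<le> M * dist x y" using lipschitz_onD[OF h, of y x] by (simp add: dist_real_def dist_commute)
    qed (use hm xy gG \<open>m > 0\<close> \<open>0 \<le> G\<close> \<open>0 \<le> L\<close> \<open>0 \<le> M\<close> in auto)
    also have "\<dots> = (L / m + G * M / m\<^sup>2) * dist x y"
      by (simp add: power2_eq_square field_simps)
    finally show "dist (g x / h x) (g y / h y) \<le> (L / m + G * M / m\<^sup>2) * dist x y" by (simp add: dist_real_def)
  qed (use \<open>m > 0\<close> \<open>0 \<le> G\<close> \<open>0 \<le> L\<close> \<open>0 \<le> M\<close> in auto)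
  then show ?thesis unfolding lipschitz_near_def using \<open>r > 0\<close> by blast
qed

lemma lipschitz_near_vector2:
  fixes g h :: "real^2 \<Rightarrow> real"
  assumes "lipschitz_near g p" "lipschitz_near h p"
  shows "lipschitz_near (\<lambda>y. vector [g y, h y] :: real^2) p"
proof -
  obtain r L where g: "r > 0" "L-lipschitz_on (ball p r) g" using assms(1) unfolding lipschitz_near_def by auto
  obtain s M where h: "s > 0" "M-lipschitz_on (ball p s) h" using assms(2) unfolding lipschitz_near_def by auto
  have "(L + M)-lipschitz_on (ball p (min r s)) (\<lambda>y. vector [g y, h y] :: real^2)"
  proof (rule lipschitz_onI)
    fix x y assume xy: "x \<in> ball p (min r s)" "y \<in> ball p (min r s)"
    have "dist (vector [g x, h x] :: real^2) (vector [g y, h y]) \<le> \<bar>g x - g y\<bar> + \<bar>h x - h y\<bar>"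
      unfolding dist_norm using norm_le_l1_cart[of "vector [g x, h x] - vector [g y, h y] :: real^2"] by (simp add: sum_2)
    also have "\<dots> \<le> L * dist x y + M * dist x y"
      using lipschitz_onD[OF g(2), of x y] lipschitz_onD[OF h(2), of x y] xy
      by (intro add_mono) (auto simp: dist_real_def)
    finally show "dist (vector [g x, h x] :: real^2) (vector [g y, h y]) \<le> (L + M) * dist x y"
      by (simp add: algebra_simps)
  qed (use lipschitz_on_nonneg[OF g(2)] lipschitz_on_nonneg[OF h(2)] in simp)
  then show ?thesis unfolding lipschitz_near_def using g(1) h(1) by (intro exI[of _ "min r s"]) auto
qed

lemma lipschitz_fieldI:
  fixes f :: "'a::euclidean_space \<Rightarrow> 'a"
  assumes "open D" and loc: "\<And>p. p \<in> D \<Longrightarrow> lipschitz_near f p"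
  shows "lipschitz_field f D"
proof
  show "open D" by fact
  fix C assume C: "compact C" "C \<subseteq> D"
  have "local_lipschitz {0::real} C (\<lambda>_. f)"
  proof (rule local_lipschitzI)
    fix t :: real and x assume "x \<in> C"
    then obtain r L where r: "r > 0" "L-lipschitz_on (ball x r) f"
      using loc C(2) unfolding lipschitz_near_def by blast
    have "L-lipschitz_on (cball x (r / 2) \<inter> C) f"
      by (rule lipschitz_on_subset[OF r(2)]) (use r(1) in auto)
    then show "\<exists>u>0. \<exists>L. \<forall>t\<in>cball t u \<inter> {0}. L-lipschitz_on (cball x u \<inter> C) f"
      using r(1) by (intro exI[of _ "r / 2"]) auto
  qed
  then obtain L where "\<And>t. t \<in> {0::real} \<Longrightarrow> L-lipschitz_on C f"
    by (rule local_lipschitz_compact_implies_lipschitz) (use C(1) in auto)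
  then show "\<exists>L. L-lipschitz_on C f" by blast
qed

lemma lipschitz_on_vec_nth: "1-lipschitz_on UNIV (\<lambda>y::real^'n. y $ i)"
  by (rule lipschitz_onI) (auto simp: dist_vec_nth_le)

lemma lipschitz_on_norm: "1-lipschitz_on UNIV (norm :: 'a::real_normed_vector \<Rightarrow> real)"
  by (rule lipschitz_onI) (auto simp: dist_real_def dist_norm norm_triangle_ineq3)

lemma lipschitz_on_one_minus:
  fixes g :: "'a::metric_space \<Rightarrow> real"
  assumes "L-lipschitz_on X g" shows "L-lipschitz_on X (\<lambda>y. 1 - g y)"
  using assms unfolding lipschitz_on_def by (auto simp: dist_real_def abs_minus_commute)

lemma lipschitz_field_f1: "lipschitz_field f1 dom_f1"
proof (rule lipschitz_fieldI)
  show "open dom_f1" unfolding dom_f1_def by (intro open_Collect_neq continuous_intros)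
  fix p assume "p \<in> dom_f1"
  then have "lipschitz_near (\<lambda>y. y$2 / (1 - y$1)) p"
    by (intro lipschitz_near_divide[OF lipschitz_on_vec_nth lipschitz_on_one_minus[OF lipschitz_on_vec_nth]])
       (simp add: dom_f1_def)
  moreover have "lipschitz_near (\<lambda>y::real^2. (y$1 + y$2) / 1) p"
    by (rule lipschitz_near_divide[OF lipschitz_on_add[OF lipschitz_on_vec_nth lipschitz_on_vec_nth] lipschitz_on_constant]) simp
  ultimately show "lipschitz_near f1 p"
    unfolding f1_def[abs_def] using lipschitz_near_vector2 by auto
qed

lemma lipschitz_field_f2: "lipschitz_field f2 dom_f2"
proof (rule lipschitz_fieldI)
  show "open dom_f2" unfolding dom_f2_def by (intro open_Collect_neq continuous_intros)
  fix p assume "p \<in> dom_f2"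
  then have "lipschitz_near (\<lambda>y. y$i / (1 - norm y)) p" for i
    by (intro lipschitz_near_divide[OF lipschitz_on_vec_nth lipschitz_on_one_minus[OF lipschitz_on_norm]])
       (simp add: dom_f2_def)
  then show "lipschitz_near f2 p"
    unfolding f2_def[abs_def] by (intro lipschitz_near_vector2)
qed

lemma lipschitz_field_f3: "lipschitz_field f3 dom_f3"
proof (rule lipschitz_fieldI)
  show "open dom_f3" unfolding dom_f3_def by (intro open_Collect_conj open_Collect_neq continuous_intros)
  fix p assume "p \<in> dom_f3"
  then have "lipschitz_near (\<lambda>y. 1 / (1 - y$i)) p" if "i = 1 \<or> i = 2" for i
    using that by (intro lipschitz_near_divide[OF lipschitz_on_constant lipschitz_on_one_minus[OF lipschitz_on_vec_nth]])
      (auto simp: dom_f3_def)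
  then show "lipschitz_near f3 p"
    unfolding f3_def[abs_def] by (intro lipschitz_near_vector2) auto
qed

text \<open>
  All monotonicity of solutions comes from this inequality: in the direction \<open>e\<close> the forcing
  contributes at most \<open>K * norm e\<close> per unit of time, so a lower bound \<open>c > K * norm e\<close> on the
  component of the vector field yields growth. The bound on the field is assumed in the interior of
  the time interval, so that the lemma applies at the first time at which a region might be left.
\<close>
lemma int_sol_inner_growth:
  assumes "lipschitz_field f D" and sol: "int_sol f D y0 w b y" and w: "K-lipschitz_on {0..} w"
    and st: "0 \<le> s" "s \<le> t" "t \<le> b"
    and c: "\<And>\<tau>. \<lbrakk>s < \<tau>; \<tau> < t\<rbrakk> \<Longrightarrow> c \<le> e \<bullet> f (y \<tau>)"
  shows "(c - K * norm e) * (t - s) \<le> e \<bullet> y t - e \<bullet> y s"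
proof (cases "s = t")
  case False
  interpret lipschitz_field f D by fact
  have cont: "continuous_on {s..t} (\<lambda>\<tau>. f (y \<tau>))"
    using int_solD(1,2)[OF sol] st
    by (intro continuous_on_compose2[OF continuous_on_field]) (auto intro: continuous_on_subset)
  have c': "c \<le> e \<bullet> f (y \<tau>)" if "\<tau> \<in> {s..t}" for \<tau>
    by (rule continuous_ge_on_closure[of "{s<..<t}" "\<lambda>\<tau>. e \<bullet> f (y \<tau>)"])
       (use that False st c cont in \<open>auto intro!: continuous_intros\<close>)
  have "integral {0..s} (\<lambda>s. f (y s)) + integral {s..t} (\<lambda>s. f (y s)) = integral {0..t} (\<lambda>s. f (y s))"
    by (rule Henstock_Kurzweil_Integration.integral_combine) (use st int_sol_integrable[OF sol] in auto)
  then have "y t - y s = (w t - w s) + integral {s..t} (\<lambda>s. f (y s))"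
    using int_solD(3)[OF sol, of s] int_solD(3)[OF sol, of t] st by (simp add: algebra_simps)
  then have "e \<bullet> y t - e \<bullet> y s = e \<bullet> (w t - w s) + e \<bullet> integral {s..t} (\<lambda>s. f (y s))"
    by (simp flip: inner_diff_right add: inner_add_right)
  moreover have "c * (t - s) \<le> e \<bullet> integral {s..t} (\<lambda>s. f (y s))"
  proof -
    have "((\<lambda>s. f (y s)) has_integral integral {s..t} (\<lambda>s. f (y s))) {s..t}"
      by (intro integrable_integral integrable_continuous_real cont)
    then have "((\<lambda>s. e \<bullet> f (y s)) has_integral e \<bullet> integral {s..t} (\<lambda>s. f (y s))) {s..t}"
      using has_integral_linear[OF _ bounded_linear_inner_right[of e]] by (simp add: o_def)
    moreover have "((\<lambda>_. c) has_integral c * (t - s)) {s..t}"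
      using has_integral_const_real[of c s t] st by (simp add: mult.commute)
    ultimately show ?thesis using c' has_integral_le by blast
  qed
  moreover have "- (K * norm e * (t - s)) \<le> e \<bullet> (w t - w s)"
  proof -
    have "\<bar>e \<bullet> (w t - w s)\<bar> \<le> norm e * norm (w t - w s)" by (rule Cauchy_Schwarz_ineq2)
    also have "\<dots> \<le> norm e * (K * (t - s))"
      using lipschitz_onD[OF w, of t s] st by (intro mult_left_mono) (auto simp: dist_norm)
    finally show ?thesis by (simp add: mult_ac abs_le_iff)
  qed
  ultimately show ?thesis by (simp add: algebra_simps)
qed simp

text \<open>
  Continuation principle: the first time outside \<open>G\<close> would contradict the step hypothesis.
\<close>
lemma stays_in_open_set:
  fixes y :: "real \<Rightarrow> 'a::topological_space"
  assumes cont: "\<And>b. b \<in> {0..<T} \<Longrightarrow> continuous_on {0..b} y" and G: "open G" "y 0 \<in> G"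
    and step: "\<And>t. \<lbrakk>0 < t; t < T; \<And>s. s \<in> {0..<t} \<Longrightarrow> y s \<in> G\<rbrakk> \<Longrightarrow> y t \<in> G"
    and t: "t \<in> {0..<T}"
  shows "y t \<in> G"
proof (rule ccontr)
  assume nt: "y t \<notin> G"
  define A where "A = {s \<in> {0..t}. y s \<in> - G}"
  have "A = {0..t} \<inter> y -` (- G)" by (auto simp: A_def)
  then have "closed A" using continuous_closed_preimage[OF cont[OF t] closed_atLeastAtMost closed_Compl[OF G(1)]] by simp
  moreover have "bounded A" by (rule bounded_subset[of "{0..t}"]) (auto simp: A_def)
  ultimately have cA: "compact A" by (simp add: compact_eq_bounded_closed)
  have ne: "A \<noteq> {}" using nt t by (auto simp: A_def)
  obtain \<tau> where \<tau>: "\<tau> \<in> A" "\<And>s. s \<in> A \<Longrightarrow> \<tau> \<le> s" using compact_attains_inf[OF cA ne] by blast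
  then have "0 < \<tau>" using G(2) by (cases "\<tau> = 0") (auto simp: A_def)
  have "y \<tau> \<in> G"
  proof (rule step[OF \<open>0 < \<tau>\<close>])
    show "\<tau> < T" using \<tau>(1) t by (auto simp: A_def)
    fix s assume s: "s \<in> {0..<\<tau>}"
    then have "s \<notin> A" using \<tau>(2) by force
    then show "y s \<in> G" using s \<tau>(1) by (auto simp: A_def)
  qed
  then show False using \<tau>(1) by (simp add: A_def)
qed

text \<open>
  Applied to the distance \<open>d\<close> from the singular set, the two alternatives correspond to blow-up of the
  vector field and to compactness.
\<close>
lemma decreasing_tendsto_0_or_bounded_below:
  fixes d :: "real \<Rightarrow> real"
  assumes "0 < T" and pos: "\<And>t. t \<in> {0..<T} \<Longrightarrow> 0 < d t"
    and mono: "\<And>s t. \<lbrakk>0 \<le> s; s \<le> t; t < T\<rbrakk> \<Longrightarrow> d t \<le> d s"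
  shows "filterlim (\<lambda>t. inverse (d t)) at_top (at_left T) \<or> (\<exists>l>0. \<forall>t\<in>{0..<T}. l \<le> d t)"
proof (cases "\<exists>l>0. \<forall>t\<in>{0..<T}. l \<le> d t")
  case False
  have ev: "eventually (\<lambda>t. t \<in> {0..<T}) (at_left T)"
    using eventually_at_left_real[OF \<open>0 < T\<close>] by eventually_elim auto
  have "(d \<longlongrightarrow> 0) (at_left T)"
  proof (rule order_tendstoI)
    fix a :: real assume "a < 0"
    show "eventually (\<lambda>t. a < d t) (at_left T)"
      using ev
    proof eventually_elim
      case (elim t)
      then show ?case using pos[of t] \<open>a < 0\<close> by simp
    qed
  next
    fix a :: real assume "0 < a"
    then obtain s where s: "s \<in> {0..<T}" "d s < a" using False by force
    then have "eventually (\<lambda>t. t \<in> {s<..<T}) (at_left T)" by (intro eventually_at_left_real) auto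
    then show "eventually (\<lambda>t. d t < a) (at_left T)"
    proof eventually_elim
      case (elim t)
      then have "d t \<le> d s" using s by (intro mono) auto
      then show ?case using s(2) by simp
    qed
  qed
  moreover have "eventually (\<lambda>t. 0 < d t) (at_left T)" using eventually_mono[OF ev pos] .
  ultimately show ?thesis by (intro disjI1 filterlim_inverse_at_top)
qed simp

section \<open>Quenching estimates for the three vector fields\<close>

text \<open>
  The sign \<open>\<sigma>\<close> distinguishes the two sides of the line \<open>y\<^sub>1 = 1\<close>: \<open>d = \<sigma> (1 - y\<^sub>1)\<close> is the distance
  to it on either side. For \<open>0 < d < 1/(2K)\<close> and \<open>y\<^sub>2 > m \<ge> 1\<close>, the field decreases \<open>d\<close> at a rate
  \<open>y\<^sub>2 / d \<ge> 2K\<close>, and the hypothesis \<open>low\<close> makes \<open>y\<^sub>2\<close> nondecreasing. So the region is invariant and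
  \<open>d\<close> decreases at a rate of at least \<open>K\<close>.
\<close>
lemma quenches_f1_branch:
  fixes z :: "real^2"
  assumes \<sigma>: "\<sigma> = 1 \<or> \<sigma> = - 1" and K: "0 < K" and m: "1 \<le> m"
    and low: "\<And>x. \<lbrakk>0 < \<sigma> * (1 - x); \<sigma> * (1 - x) < 1 / (2 * K)\<rbrakk> \<Longrightarrow> K \<le> x + m"
    and z: "0 < \<sigma> * (1 - z$1)" "\<sigma> * (1 - z$1) < 1 / (2 * K)" "m < z$2"
  shows "quenches f1 dom_f1 K z"
  unfolding quenches_def
proof (intro exI allI impI)
  fix w y T
  assume w: "K-lipschitz_on {0..} w" "w 0 = (0::real^2)" and "0 < T" and sol': "\<forall>b\<in>{0..<T}. int_sol f1 dom_f1 z w b y"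
  then have sol: "\<And>b. b \<in> {0..<T} \<Longrightarrow> int_sol f1 dom_f1 z w b y" by blast
  define \<delta> where "\<delta> = 1 / (2 * K)"
  define d where "d t = \<sigma> * (1 - y t $ 1)" for t
  define G where "G = {y::real^2. 0 < \<sigma> * (1 - y$1) \<and> \<sigma> * (1 - y$1) < \<delta> \<and> m < y$2}"
  have \<sigma>\<sigma>: "\<sigma> * \<sigma> = 1" "\<bar>\<sigma>\<bar> = 1" using \<sigma> by auto
  have "0 < \<delta>" using K by (simp add: \<delta>_def)
  have "y 0 = z" using int_solD(3)[OF sol[of 0], of 0] w(2) \<open>0 < T\<close> by simp
  have cont: "continuous_on {0..b} y" if "b \<in> {0..<T}" for b using int_solD(1)[OF sol[OF that]] .
  define e1 :: "real^2" where "e1 = axis 1 \<sigma>"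
  define e2 :: "real^2" where "e2 = axis 2 1"
  have e1: "e1 \<bullet> v = \<sigma> * v$1" and e2: "e2 \<bullet> v = v$2" for v
    by (simp_all add: e1_def e2_def inner_axis')
  have ne: "norm e1 = 1" "norm e2 = 1" using \<sigma>\<sigma>(2) by (simp_all add: e1_def e2_def norm_axis_1 norm_eq_sqrt_inner inner_axis_axis)
  have f1_1: "\<sigma> * f1 v $ 1 = v$2 / (\<sigma> * (1 - v$1))" for v
    using \<sigma> by (auto simp: f1_def minus_divide_right)
  have rate1: "2 * K * v$2 \<le> e1 \<bullet> f1 v" if "v \<in> G" for v
  proof -
    have v: "0 < \<sigma> * (1 - v$1)" "\<sigma> * (1 - v$1) < 1 / (2 * K)" "0 < v$2"
      using that m by (auto simp: G_def \<delta>_def)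
    have "2 * K * (\<sigma> * (1 - v$1)) \<le> 1" using v(2) K by (simp add: field_simps)
    then have "2 * K * (\<sigma> * (1 - v$1)) * v$2 \<le> 1 * v$2" using v(3) by (intro mult_right_mono) auto
    then have "2 * K * v$2 * (\<sigma> * (1 - v$1)) \<le> v$2" by (simp only: mult_ac mult_1_right)
    then show ?thesis unfolding e1 f1_1 pos_le_divide_eq[OF v(1)] .
  qed
  have rate1': "2 * K \<le> e1 \<bullet> f1 v" if "v \<in> G" for v
  proof -
    have "1 < v$2" using that m by (auto simp: G_def)
    then have "2 * K * 1 \<le> 2 * K * v$2" using K by (intro mult_left_mono) auto
    then show ?thesis using rate1[OF that] by simp
  qed
  have rate2: "K \<le> e2 \<bullet> f1 v" if "v \<in> G" for v
    using that low[of "v$1"] by (auto simp: G_def e2 f1_def \<delta>_def)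
  have mono1: "d t \<le> d s - K * (t - s)"
    if st: "0 \<le> s" "s \<le> t" "t < T" and inG: "\<And>\<tau>. s < \<tau> \<Longrightarrow> \<tau> < t \<Longrightarrow> y \<tau> \<in> G" for s t
    using int_sol_inner_growth[OF lipschitz_field_f1 sol[of t] w(1), of s t "2 * K" e1] st inG rate1' ne
    by (auto simp: e1 d_def algebra_simps)
  have mono2: "y s $ 2 \<le> y t $ 2"
    if st: "0 \<le> s" "s \<le> t" "t < T" and inG: "\<And>\<tau>. s < \<tau> \<Longrightarrow> \<tau> < t \<Longrightarrow> y \<tau> \<in> G" for s t
    using int_sol_inner_growth[OF lipschitz_field_f1 sol[of t] w(1), of s t K e2] st inG rate2 ne
    by (auto simp: e2)
  have yG: "y t \<in> G" if "t \<in> {0..<T}" for t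
    using _ _ _ _ that
  proof (rule stays_in_open_set)
    show "open G" unfolding G_def by (intro open_Collect_conj open_Collect_less continuous_intros)
    show "y 0 \<in> G" using z by (simp add: G_def \<open>y 0 = z\<close> \<delta>_def)
    fix t assume t: "0 < t" "t < T" and inG: "\<And>s. s \<in> {0..<t} \<Longrightarrow> y s \<in> G"
    have "d t \<le> d 0 - K * (t - 0)" "y 0 $ 2 \<le> y t $ 2"
      by (intro mono1 mono2; use t inG in auto)+
    moreover have "0 \<le> K * t" using K t by simp
    moreover have "d 0 < \<delta>" "m < y 0 $ 2" using \<open>y 0 \<in> G\<close> by (auto simp: G_def d_def)
    moreover have "0 \<le> d t"
      unfolding d_def
    proof (rule continuous_ge_on_closure[of "{0..<t}" "\<lambda>t. \<sigma> * (1 - y t $ 1)"])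
      show "continuous_on (closure {0..<t}) (\<lambda>t. \<sigma> * (1 - y t $ 1))"
        using t by (auto intro!: continuous_intros cont)
      show "0 \<le> \<sigma> * (1 - y x $ 1)" if "x \<in> {0..<t}" for x using inG[OF that] by (simp add: G_def)
    qed (use t in auto)
    moreover have "d t \<noteq> 0" using int_solD(2)[OF sol[of t], of t] t \<sigma> by (auto simp: dom_f1_def d_def)
    ultimately show "y t \<in> G" by (simp add: G_def flip: d_def)
  qed (rule cont)
  have dpos: "0 < d t" "d t < \<delta>" "m < y t $ 2" if "t \<in> {0..<T}" for t using yG[OF that] by (auto simp: G_def d_def)
  have dle: "d t \<le> d s - K * (t - s)" "y s $ 2 \<le> y t $ 2" if "0 \<le> s" "s \<le> t" "t < T" for s t
    using that by (auto intro!: mono1 mono2 yG)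
  have "T \<le> \<delta> / K"
  proof (rule ccontr)
    assume "\<not> T \<le> \<delta> / K"
    then have t: "\<delta> / K \<in> {0..<T}" using \<open>0 < \<delta>\<close> K by auto
    then have "d (\<delta> / K) \<le> d 0 - K * (\<delta> / K - 0)" by (intro dle) auto
    then show False using dpos(1)[OF t] dpos(2)[of 0] \<open>0 < T\<close> K by simp
  qed
  moreover have "filterlim (\<lambda>t. norm (f1 (y t))) at_top (at_left T) \<or> (\<exists>C. compact C \<and> C \<subseteq> dom_f1 \<and> y ` {0..<T} \<subseteq> C)"
  proof -
    have mono: "d t \<le> d s" if "0 \<le> s" "s \<le> t" "t < T" for s t
      using dle(1)[OF that] K that mult_nonneg_nonneg[of K "t - s"] by linarith
    have "filterlim (\<lambda>t. inverse (d t)) at_top (at_left T) \<or> (\<exists>l>0. \<forall>t\<in>{0..<T}. l \<le> d t)"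
      by (rule decreasing_tendsto_0_or_bounded_below[OF \<open>0 < T\<close> dpos(1) mono])
    then show ?thesis
    proof (elim disjE exE conjE)
      assume lim: "filterlim (\<lambda>t. inverse (d t)) at_top (at_left T)"
      have "eventually (\<lambda>t. inverse (d t) \<le> norm (f1 (y t))) (at_left T)"
        using eventually_at_left_real[OF \<open>0 < T\<close>]
      proof eventually_elim
        case (elim t)
        then have t: "t \<in> {0..<T}" by simp
        have "inverse (d t) \<le> y t $ 2 / d t"
          using dpos[OF t] m by (simp add: inverse_eq_divide divide_right_mono)
        also have "\<dots> = \<sigma> * f1 (y t) $ 1" unfolding f1_1 d_def ..
        also have "\<dots> \<le> \<bar>f1 (y t) $ 1\<bar>" using \<sigma> by auto
        also have "\<dots> \<le> norm (f1 (y t))" by (rule component_le_norm_cart)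
        finally show ?case .
      qed
      then show ?thesis by (intro disjI1 filterlim_at_top_mono[OF lim])
    next
      fix l assume l: "0 < l" "\<forall>t\<in>{0..<T}. l \<le> d t"
      \<comment> \<open>It remains to bound \<open>y\<^sub>2\<close> from above. In the direction \<open>e\<close> the term \<open>y\<^sub>2 / d \<ge> 2K y\<^sub>2\<close> of the
         first component absorbs the exponential growth \<open>y\<^sub>1 + y\<^sub>2\<close> of the second one.\<close>
      define e where "e = e1 - (2 * K) *\<^sub>R e2"
      define M where "M = (1 + \<delta> - e \<bullet> y 0 + (2 * K * (1 + \<delta>) + K * norm e) * T) / (2 * K)"
      have y1: "\<bar>v$1\<bar> \<le> 1 + \<delta>" if "0 < \<sigma> * (1 - v$1)" "\<sigma> * (1 - v$1) \<le> \<delta>" for v :: "real^2"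
        using that \<sigma> by auto
      have M: "y t $ 2 \<le> M" if t: "t \<in> {0..<T}" for t
      proof -
        have rate: "- (2 * K * (1 + \<delta>)) \<le> e \<bullet> f1 v" if v: "v \<in> G" for v
        proof -
          have "v$1 \<le> 1 + \<delta>" using y1[of v] v by (auto simp: G_def)
          then have "2 * K * v$1 \<le> 2 * K * (1 + \<delta>)" using K by (intro mult_left_mono) auto
          moreover have "e \<bullet> f1 v = e1 \<bullet> f1 v - 2 * K * (v$1 + v$2)"
            by (simp add: e_def inner_diff_left e2 f1_def)
          ultimately show ?thesis using rate1[OF v] by (simp add: algebra_simps)
        qed
        have "(- (2 * K * (1 + \<delta>)) - K * norm e) * (t - 0) \<le> e \<bullet> y t - e \<bullet> y 0"
          by (rule int_sol_inner_growth[OF lipschitz_field_f1 sol[OF t] w(1)])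
             (use t in \<open>auto intro!: rate yG\<close>)
        moreover have "(2 * K * (1 + \<delta>) + K * norm e) * t \<le> (2 * K * (1 + \<delta>) + K * norm e) * T"
          using t K \<open>0 < \<delta>\<close> by (intro mult_left_mono) auto
        moreover have "e \<bullet> y t = \<sigma> * y t $ 1 - 2 * K * y t $ 2"
          by (simp add: e_def inner_diff_left e1 e2)
        moreover have "\<sigma> * y t $ 1 \<le> 1 + \<delta>" using y1[of "y t"] yG[OF t] \<sigma> by (auto simp: G_def)
        ultimately have "2 * K * y t $ 2 \<le> 1 + \<delta> - e \<bullet> y 0 + (2 * K * (1 + \<delta>) + K * norm e) * T"
          by (simp add: algebra_simps)
        then show ?thesis unfolding M_def using K by (simp add: field_simps)
      qed
      define C where "C = {v::real^2. l \<le> \<sigma> * (1 - v$1) \<and> \<sigma> * (1 - v$1) \<le> \<delta> \<and> m \<le> v$2 \<and> v$2 \<le> M}"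
      have "closed C" unfolding C_def by (intro closed_Collect_conj closed_Collect_le continuous_intros)
      moreover have "bounded C"
      proof (rule boundedI)
        fix v assume v: "v \<in> C"
        have "norm v \<le> \<bar>v$1\<bar> + \<bar>v$2\<bar>" using norm_le_l1_cart[of v] by (simp add: sum_2)
        also have "\<dots> \<le> (1 + \<delta>) + M" using v l(1) m y1[of v] by (intro add_mono) (auto simp: C_def)
        finally show "norm v \<le> (1 + \<delta>) + M" .
      qed
      moreover have "C \<subseteq> dom_f1" using l(1) by (auto simp: C_def dom_f1_def)
      moreover have "y ` {0..<T} \<subseteq> C"
        using dpos M l(2) by (force simp: C_def d_def)
      ultimately show ?thesis by (auto simp: compact_eq_bounded_closed)
    qed
  qed
  ultimately show "T \<le> \<delta> / K \<and> (filterlim (\<lambda>t. norm (f1 (y t))) at_top (at_left T) \<or>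
       (\<exists>C. compact C \<and> C \<subseteq> dom_f1 \<and> y ` {0..<T} \<subseteq> C))" by blast
qed

text \<open>
  Each of the two distances \<open>d\<^sub>i = \<sigma> (1 - y\<^sub>i)\<close> decreases at a rate that is the inverse of the other
  one. Both are less than \<open>1/(2K)\<close>, so both decrease at a rate of at least \<open>2K - K\<close>. Quenching may
  happen through either of them, whichever vanishes first.
\<close>
lemma quenches_f3_branch:
  fixes z :: "real^2"
  assumes \<sigma>: "\<sigma> = 1 \<or> \<sigma> = - 1" and K: "0 < K"
    and z: "\<And>i. 0 < \<sigma> * (1 - z$i)" "\<And>i. \<sigma> * (1 - z$i) < 1 / (2 * K)"
  shows "quenches f3 dom_f3 K z"
  unfolding quenches_def
proof (intro exI allI impI)
  fix w y T
  assume w: "K-lipschitz_on {0..} w" "w 0 = (0::real^2)" and "0 < T" and sol': "\<forall>b\<in>{0..<T}. int_sol f3 dom_f3 z w b y"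
  then have sol: "\<And>b. b \<in> {0..<T} \<Longrightarrow> int_sol f3 dom_f3 z w b y" by blast
  define \<delta> where "\<delta> = 1 / (2 * K)"
  define d where "d i t = \<sigma> * (1 - y t $ i)" for i t
  define G where "G = {y::real^2. \<forall>i. 0 < \<sigma> * (1 - y$i) \<and> \<sigma> * (1 - y$i) < \<delta>}"
  define other :: "2 \<Rightarrow> 2" where "other i = (if i = 1 then 2 else 1)" for i
  have \<sigma>\<sigma>: "\<bar>\<sigma>\<bar> = 1" using \<sigma> by auto
  have "0 < \<delta>" using K by (simp add: \<delta>_def)
  have "y 0 = z" using int_solD(3)[OF sol[of 0], of 0] w(2) \<open>0 < T\<close> by simp
  have cont: "continuous_on {0..b} y" if "b \<in> {0..<T}" for b using int_solD(1)[OF sol[OF that]] .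
  define e :: "2 \<Rightarrow> real^2" where "e i = axis i \<sigma>" for i
  have e: "e i \<bullet> v = \<sigma> * v$i" for i v by (simp add: e_def inner_axis')
  have ne: "norm (e i) = 1" for i using \<sigma>\<sigma> by (simp add: e_def norm_eq_sqrt_inner inner_axis_axis)
  have f3_i: "\<sigma> * f3 v $ i = inverse (\<sigma> * (1 - v $ other i))" for v i
    using exhaust_2[of i] \<sigma> by (auto simp: f3_def other_def inverse_eq_divide minus_divide_right)
  have other2: "other (other i) = i" for i using exhaust_2[of i] by (auto simp: other_def)
  have rate: "2 * K \<le> e i \<bullet> f3 v" if "v \<in> G" for v i
  proof -
    have "0 < \<sigma> * (1 - v $ other i)" "\<sigma> * (1 - v $ other i) < 1 / (2 * K)"
      using that by (auto simp: G_def \<delta>_def)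
    then have "inverse (1 / (2 * K)) \<le> inverse (\<sigma> * (1 - v $ other i))" by (intro le_imp_inverse_le) auto
    then show ?thesis unfolding e f3_i by simp
  qed
  have mono1: "d i t \<le> d i s - K * (t - s)"
    if st: "0 \<le> s" "s \<le> t" "t < T" and inG: "\<And>\<tau>. s < \<tau> \<Longrightarrow> \<tau> < t \<Longrightarrow> y \<tau> \<in> G" for i s t
    using int_sol_inner_growth[OF lipschitz_field_f3 sol[of t] w(1), of s t "2 * K" "e i"] st inG rate ne
    by (auto simp: e d_def algebra_simps)
  have open_G: "open G"
  proof -
    have "G = {y. 0 < \<sigma> * (1 - y$1) \<and> \<sigma> * (1 - y$1) < \<delta> \<and> 0 < \<sigma> * (1 - y$2) \<and> \<sigma> * (1 - y$2) < \<delta>}"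
      by (auto simp: G_def forall_2)
    then show ?thesis by (simp only:) (intro open_Collect_conj open_Collect_less continuous_intros)
  qed
  have yG: "y t \<in> G" if "t \<in> {0..<T}" for t
    using _ _ _ _ that
  proof (rule stays_in_open_set)
    show "open G" by (rule open_G)
    show "y 0 \<in> G" using z by (simp add: G_def \<open>y 0 = z\<close> \<delta>_def)
    fix t assume t: "0 < t" "t < T" and inG: "\<And>s. s \<in> {0..<t} \<Longrightarrow> y s \<in> G"
    have "0 < d i t \<and> d i t < \<delta>" for i
    proof -
      have "d i t \<le> d i 0 - K * (t - 0)" by (rule mono1) (use t inG in auto)
      moreover have "0 \<le> K * t" using K t by simp
      moreover have "d i 0 < \<delta>" using \<open>y 0 \<in> G\<close> by (auto simp: G_def d_def)
      moreover have "0 \<le> d i t"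
        unfolding d_def
      proof (rule continuous_ge_on_closure[of "{0..<t}" "\<lambda>t. \<sigma> * (1 - y t $ i)"])
        show "continuous_on (closure {0..<t}) (\<lambda>t. \<sigma> * (1 - y t $ i))"
          using t by (auto intro!: continuous_intros cont)
        show "0 \<le> \<sigma> * (1 - y x $ i)" if "x \<in> {0..<t}" for x using inG[OF that] by (auto simp: G_def less_imp_le)
      qed (use t in auto)
      moreover have "d i t \<noteq> 0"
        using int_solD(2)[OF sol[of t], of t] t \<sigma> exhaust_2[of i] by (auto simp: dom_f3_def d_def)
      ultimately show ?thesis by simp
    qed
    then show "y t \<in> G" by (simp add: G_def d_def)
  qed (rule cont)
  have dpos: "0 < d i t" "d i t < \<delta>" if "t \<in> {0..<T}" for i t using yG[OF that] by (auto simp: G_def d_def)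
  have dle: "d i t \<le> d i s - K * (t - s)" if "0 \<le> s" "s \<le> t" "t < T" for i s t
    using that by (auto intro!: mono1 yG)
  have "T \<le> \<delta> / K"
  proof (rule ccontr)
    assume "\<not> T \<le> \<delta> / K"
    then have t: "\<delta> / K \<in> {0..<T}" using \<open>0 < \<delta>\<close> K by auto
    then have "d 1 (\<delta> / K) \<le> d 1 0 - K * (\<delta> / K - 0)" by (intro dle) auto
    then show False using dpos(1)[OF t, of 1] dpos(2)[of 0 1] \<open>0 < T\<close> K by simp
  qed
  moreover have "filterlim (\<lambda>t. norm (f3 (y t))) at_top (at_left T) \<or> (\<exists>C. compact C \<and> C \<subseteq> dom_f3 \<and> y ` {0..<T} \<subseteq> C)"
  proof -
    have mono: "d i t \<le> d i s" if "0 \<le> s" "s \<le> t" "t < T" for i s t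
      using dle[OF that, of i] K that mult_nonneg_nonneg[of K "t - s"] by linarith
    have dich: "filterlim (\<lambda>t. inverse (d i t)) at_top (at_left T) \<or> (\<exists>l>0. \<forall>t\<in>{0..<T}. l \<le> d i t)" for i
      by (rule decreasing_tendsto_0_or_bounded_below[OF \<open>0 < T\<close> dpos(1) mono])
    show ?thesis
    proof (cases "\<exists>i. filterlim (\<lambda>t. inverse (d i t)) at_top (at_left T)")
      case True
      then obtain i where lim: "filterlim (\<lambda>t. inverse (d i t)) at_top (at_left T)" by blast
      have "eventually (\<lambda>t. inverse (d i t) \<le> norm (f3 (y t))) (at_left T)"
      proof (rule always_eventually, rule allI)
        fix t
        have "inverse (d i t) = \<sigma> * f3 (y t) $ other i" unfolding f3_i other2 d_def ..
        also have "\<dots> \<le> \<bar>f3 (y t) $ other i\<bar>" using \<sigma> by auto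
        also have "\<dots> \<le> norm (f3 (y t))" by (rule component_le_norm_cart)
        finally show "inverse (d i t) \<le> norm (f3 (y t))" .
      qed
      then show ?thesis by (intro disjI1 filterlim_at_top_mono[OF lim])
    next
      case False
      then obtain l where l: "\<And>i. 0 < l i" "\<And>i t. t \<in> {0..<T} \<Longrightarrow> l i \<le> d i t"
        using dich by metis
      define C where "C = {v::real^2. (l 1 \<le> \<sigma> * (1 - v$1) \<and> \<sigma> * (1 - v$1) \<le> \<delta>) \<and> (l 2 \<le> \<sigma> * (1 - v$2) \<and> \<sigma> * (1 - v$2) \<le> \<delta>)}"
      have "closed C" unfolding C_def by (intro closed_Collect_conj closed_Collect_le continuous_intros)
      moreover have "bounded C"
      proof (rule boundedI)
        fix v assume v: "v \<in> C"
        have v1: "\<bar>v$1\<bar> \<le> 1 + \<delta>" "\<bar>v$2\<bar> \<le> 1 + \<delta>" using v l(1)[of 1] l(1)[of 2] \<sigma> by (auto simp: C_def)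
        have "norm v \<le> \<bar>v$1\<bar> + \<bar>v$2\<bar>" using norm_le_l1_cart[of v] by (simp add: sum_2)
        then show "norm v \<le> (1 + \<delta>) + (1 + \<delta>)" using v1 by linarith
      qed
      moreover have "C \<subseteq> dom_f3" using l(1)[of 1] l(1)[of 2] by (auto simp: C_def dom_f3_def)
      moreover have "y ` {0..<T} \<subseteq> C"
        using less_imp_le[OF dpos(2)] l(2) by (simp add: C_def image_subset_iff flip: d_def)
      ultimately show ?thesis by (auto simp: compact_eq_bounded_closed)
    qed
  qed
  ultimately show "T \<le> \<delta> / K \<and> (filterlim (\<lambda>t. norm (f3 (y t))) at_top (at_left T) \<or>
       (\<exists>C. compact C \<and> C \<subseteq> dom_f3 \<and> y ` {0..<T} \<subseteq> C))" by blast
qed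

lemma f2_eq: "f2 v = inverse (1 - norm v) *\<^sub>R v"
  by (simp add: f2_def vec_eq_iff forall_2 divide_inverse mult.commute)

text \<open>
  Here \<open>d = \<sigma> (1 - \<parallel>y\<parallel>)\<close> is the distance to the unit circle, inside for \<open>\<sigma> = 1\<close> and outside for
  \<open>\<sigma> = - 1\<close>. The field is radial with modulus \<open>\<parallel>y\<parallel> / d\<close>, and \<open>\<parallel>y\<parallel> > 2K d\<close> persists while \<open>d\<close>
  decreases. As the norm is not linear, the growth estimate is applied in the direction of \<open>y\<close> at
  one end point of a short interval, and the short intervals are put together by Bolzano's
  bisection principle.
\<close>
lemma quenches_f2_branch:
  fixes z :: "real^2"
  assumes \<sigma>: "\<sigma> = 1 \<or> \<sigma> = - 1" and K: "0 < K"
    and z: "0 < \<sigma> * (1 - norm z)" "2 * K * (\<sigma> * (1 - norm z)) < norm z"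
  shows "quenches f2 dom_f2 K z"
  unfolding quenches_def
proof (intro exI allI impI)
  fix w y T
  assume w: "K-lipschitz_on {0..} w" "w 0 = (0::real^2)" and "0 < T" and sol': "\<forall>b\<in>{0..<T}. int_sol f2 dom_f2 z w b y"
  then have sol: "\<And>b. b \<in> {0..<T} \<Longrightarrow> int_sol f2 dom_f2 z w b y" by blast
  define d where "d t = \<sigma> * (1 - norm (y t))" for t
  define G where "G = {y::real^2. 0 < \<sigma> * (1 - norm y) \<and> 2 * K * (\<sigma> * (1 - norm y)) < norm y}"
  have \<sigma>\<sigma>: "\<bar>\<sigma>\<bar> = 1" "\<sigma> * \<sigma> = 1" using \<sigma> by auto
  have "y 0 = z" using int_solD(3)[OF sol[of 0], of 0] w(2) \<open>0 < T\<close> by simp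
  have cont: "continuous_on {0..b} y" if "b \<in> {0..<T}" for b using int_solD(1)[OF sol[OF that]] .
  have G_pos: "0 < norm v" "norm v \<noteq> 1" "0 < \<sigma> * (1 - norm v)" if "v \<in> G" for v
  proof -
    have "0 < 2 * K * (\<sigma> * (1 - norm v))" using that K by (auto simp: G_def)
    then show "0 < norm v" "norm v \<noteq> 1" "0 < \<sigma> * (1 - norm v)" using that by (auto simp: G_def)
  qed
  have local_rate: "\<exists>h>0. \<forall>r t. r \<in> {a..b} \<and> t \<in> {a..b} \<and> r \<le> x \<and> x \<le> t \<and> t - r < h \<longrightarrow>
      K * (t - r) \<le> \<sigma> * norm (y t) - \<sigma> * norm (y r)"
    if ab: "0 \<le> a" "b < T" and inG: "\<And>\<tau>. \<tau> \<in> {a..b} \<Longrightarrow> y \<tau> \<in> G" and x: "x \<in> {a..b}" for a b x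
  proof -
    have cy: "continuous_on {a..b} y" using cont[of b] ab x by (auto intro: continuous_on_subset)
    define F where "F = (\<lambda>(p, s). \<sigma> * ((y p \<bullet> y s) / (norm (y p) * (1 - norm (y s)))))"
    have "continuous_on ({a..b} \<times> {a..b}) F"
      unfolding F_def case_prod_unfold
      by (intro continuous_intros continuous_on_compose2[OF cy])
         (use G_pos inG in auto)
    moreover have "F (x, x) > 2 * K"
    proof -
      note g = G_pos[OF inG[OF x]]
      have "F (x, x) = norm (y x) / (\<sigma> * (1 - norm (y x)))"
        using g \<sigma> by (auto simp: F_def power2_norm_eq_inner[symmetric] power2_eq_square minus_divide_right)
      also have "\<dots> > 2 * K" using inG[OF x] g(3) by (simp add: G_def pos_less_divide_eq)
      finally show ?thesis .
    qed
    moreover have "(x, x) \<in> {a..b} \<times> {a..b}" using x by simp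
    ultimately obtain h where h: "h > 0"
      "\<And>q. \<lbrakk>q \<in> {a..b} \<times> {a..b}; dist q (x, x) < h\<rbrakk> \<Longrightarrow> dist (F q) (F (x, x)) < F (x, x) - 2 * K"
      unfolding continuous_on_iff by (metis diff_gt_0_iff_gt)
    have F: "2 * K \<le> F (p, s)" if "p \<in> {a..b}" "s \<in> {a..b}" "\<bar>p - x\<bar> < h / 2" "\<bar>s - x\<bar> < h / 2" for p s
    proof -
      have "dist (p, s) (x, x) \<le> \<bar>p - x\<bar> + \<bar>s - x\<bar>"
        using sqrt_sum_squares_le_sum_abs[of "p - x" "s - x"] by (simp add: dist_Pair_Pair dist_real_def)
      also have "\<dots> < h" using that by simp
      finally show ?thesis using h(2)[of "(p, s)"] that(1,2) by (auto simp: dist_real_def)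
    qed
    have "K * (t - r) \<le> \<sigma> * norm (y t) - \<sigma> * norm (y r)"
      if rt: "r \<in> {a..b}" "t \<in> {a..b}" "r \<le> x" "x \<le> t" "t - r < h / 2" for r t
    proof -
      \<comment> \<open>The end point is chosen such that Cauchy-Schwarz at the other end point goes in the right
         direction: the norm grows for \<open>\<sigma> = 1\<close> and shrinks for \<open>\<sigma> = - 1\<close>.\<close>
      define p where "p = (if \<sigma> = 1 then r else t)"
      have p: "p \<in> {a..b}" "\<bar>p - x\<bar> < h / 2" using rt by (auto simp: p_def)
      note gp = G_pos[OF inG[OF p(1)]]
      define e where "e = (\<sigma> / norm (y p)) *\<^sub>R y p"
      have ne: "norm e = 1" using gp \<sigma>\<sigma> by (simp add: e_def)
      have "(2 * K - K * norm e) * (t - r) \<le> e \<bullet> y t - e \<bullet> y r"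
      proof (rule int_sol_inner_growth[OF lipschitz_field_f2 sol[of b] w(1)])
        fix \<tau> assume \<tau>: "r < \<tau>" "\<tau> < t"
        have "\<bar>\<tau> - x\<bar> < h / 2" using \<tau> rt(3-5) by linarith
        then have "2 * K \<le> F (p, \<tau>)" using F p \<tau> rt by auto
        also have "\<dots> = e \<bullet> f2 (y \<tau>)"
          by (simp add: F_def e_def f2_eq divide_inverse)
        finally show "2 * K \<le> e \<bullet> f2 (y \<tau>)" .
      qed (use rt ab in auto)
      also have "e \<bullet> y t - e \<bullet> y r \<le> \<sigma> * norm (y t) - \<sigma> * norm (y r)"
      proof -
        have ep: "e \<bullet> y p = \<sigma> * norm (y p)"
          using gp by (simp add: e_def power2_norm_eq_inner[symmetric] power2_eq_square)
        have le: "e \<bullet> v \<le> norm v" "- (e \<bullet> v) \<le> norm v" for v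
          using Cauchy_Schwarz_ineq2[of e v] ne by auto
        show ?thesis using \<sigma>
        proof
          assume "\<sigma> = 1"
          then show ?thesis using ep le(1)[of "y t"] by (simp add: p_def)
        next
          assume "\<sigma> = - 1"
          then show ?thesis using ep le(2)[of "y r"] by (simp add: p_def)
        qed
      qed
      finally show ?thesis using ne by simp
    qed
    then show ?thesis using h(1) by (intro exI[of _ "h / 2"]) auto
  qed
  have mono1: "d b \<le> d a - K * (b - a)"
    if ab: "0 \<le> a" "a \<le> b" "b < T" and inG: "\<And>\<tau>. \<tau> \<in> {a..b} \<Longrightarrow> y \<tau> \<in> G" for a b
  proof -
    have "a \<le> a \<and> b \<le> b \<longrightarrow> K * (b - a) \<le> \<sigma> * norm (y b) - \<sigma> * norm (y a)"
    proof (rule Bolzano[OF ab(2), where P = "\<lambda>r t. a \<le> r \<and> t \<le> b \<longrightarrow> K * (t - r) \<le> \<sigma> * norm (y t) - \<sigma> * norm (y r)"])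
      fix r s t
      assume "a \<le> r \<and> s \<le> b \<longrightarrow> K * (s - r) \<le> \<sigma> * norm (y s) - \<sigma> * norm (y r)"
        "a \<le> s \<and> t \<le> b \<longrightarrow> K * (t - s) \<le> \<sigma> * norm (y t) - \<sigma> * norm (y s)" "r \<le> s" "s \<le> t"
      then show "a \<le> r \<and> t \<le> b \<longrightarrow> K * (t - r) \<le> \<sigma> * norm (y t) - \<sigma> * norm (y r)"
        by (auto simp: algebra_simps)
    next
      fix x assume "a \<le> x" "x \<le> b"
      then obtain h where "h > 0" "\<forall>r t. r \<in> {a..b} \<and> t \<in> {a..b} \<and> r \<le> x \<and> x \<le> t \<and> t - r < h \<longrightarrow>
          K * (t - r) \<le> \<sigma> * norm (y t) - \<sigma> * norm (y r)"
        using local_rate[OF ab(1,3) inG, of x] by auto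
      then show "\<exists>h>0. \<forall>r t. r \<le> x \<and> x \<le> t \<and> t - r < h \<longrightarrow>
          (a \<le> r \<and> t \<le> b \<longrightarrow> K * (t - r) \<le> \<sigma> * norm (y t) - \<sigma> * norm (y r))"
        by (intro exI[of _ h]) auto
    qed
    then show ?thesis by (simp add: d_def algebra_simps)
  qed
  have open_G: "open G" unfolding G_def by (intro open_Collect_conj open_Collect_less continuous_intros)
  \<comment> \<open>With \<open>\<parallel>v\<parallel> = 1 - \<sigma> d\<close> the second condition on \<open>G\<close> is linear in \<open>d\<close>. If \<open>\<sigma> + 2K \<ge> 0\<close> it persists
     as \<open>d\<close> decreases, otherwise it is trivial.\<close>
  have G_iff: "v \<in> G \<longleftrightarrow> 0 < \<sigma> * (1 - norm v) \<and> (\<sigma> + 2 * K) * (\<sigma> * (1 - norm v)) < 1" for v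
    using \<sigma> by (auto simp: G_def algebra_simps)
  have yG: "y t \<in> G" if "t \<in> {0..<T}" for t
    using _ _ _ _ that
  proof (rule stays_in_open_set)
    show "open G" by (rule open_G)
    show y0G: "y 0 \<in> G" using z by (simp add: G_def \<open>y 0 = z\<close>)
    fix t assume t: "0 < t" "t < T" and inG: "\<And>s. s \<in> {0..<t} \<Longrightarrow> y s \<in> G"
    have cd: "continuous_on (closure {0..<t}) d"
      unfolding d_def using t by (auto intro!: continuous_intros cont)
    have tc: "t \<in> closure {0..<t}" using t by simp
    have "d t \<le> d 0"
    proof (rule continuous_le_on_closure[OF cd tc])
      fix x assume x: "x \<in> {0..<t}"
      then have "d x \<le> d 0 - K * (x - 0)" using t by (intro mono1 inG) auto
      also have "\<dots> \<le> d 0" using x K by simp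
      finally show "d x \<le> d 0" .
    qed
    moreover have "0 \<le> d t"
      by (rule continuous_ge_on_closure[OF cd tc]) (use G_pos(3)[OF inG] in \<open>simp add: d_def less_imp_le\<close>)
    moreover have "d t \<noteq> 0" using int_solD(2)[OF sol[of t], of t] t \<sigma> by (auto simp: dom_f2_def d_def)
    moreover have "(\<sigma> + 2 * K) * d 0 < 1" using y0G unfolding G_iff d_def by simp
    moreover have "(\<sigma> + 2 * K) * d t < 1"
    proof (cases "0 \<le> \<sigma> + 2 * K")
      case True
      then show ?thesis using mult_left_mono[OF \<open>d t \<le> d 0\<close> True] \<open>(\<sigma> + 2 * K) * d 0 < 1\<close> by simp
    next
      case False
      then show ?thesis using mult_nonpos_nonneg[of "\<sigma> + 2 * K" "d t"] \<open>0 \<le> d t\<close> by simp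
    qed
    ultimately have "0 < d t \<and> (\<sigma> + 2 * K) * d t < 1" by simp
    then show "y t \<in> G" unfolding G_iff d_def .
  qed (rule cont)
  have dpos: "0 < d t" if "t \<in> {0..<T}" for t using yG[OF that] by (auto simp: G_def d_def)
  have dle: "d t \<le> d s - K * (t - s)" if "0 \<le> s" "s \<le> t" "t < T" for s t
    using that by (auto intro!: mono1 yG)
  define \<delta> where "\<delta> = \<sigma> * (1 - norm z)"
  have d0: "d 0 = \<delta>" by (simp add: d_def \<delta>_def \<open>y 0 = z\<close>)
  have "0 < \<delta>" using z by (simp add: \<delta>_def)
  have "T \<le> \<delta> / K"
  proof (rule ccontr)
    assume "\<not> T \<le> \<delta> / K"
    then have t: "\<delta> / K \<in> {0..<T}" using \<open>0 < \<delta>\<close> K by auto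
    then have "d (\<delta> / K) \<le> d 0 - K * (\<delta> / K - 0)" by (intro dle) auto
    then show False using dpos(1)[OF t] d0 K by simp
  qed
  moreover have "filterlim (\<lambda>t. norm (f2 (y t))) at_top (at_left T) \<or> (\<exists>C. compact C \<and> C \<subseteq> dom_f2 \<and> y ` {0..<T} \<subseteq> C)"
  proof -
    have mono: "d t \<le> d s" if "0 \<le> s" "s \<le> t" "t < T" for s t
      using dle[OF that] K that mult_nonneg_nonneg[of K "t - s"] by linarith
    have d\<delta>: "d t \<le> \<delta>" if "t \<in> {0..<T}" for t using mono[of 0 t] that d0 by simp
    have "filterlim (\<lambda>t. inverse (d t)) at_top (at_left T) \<or> (\<exists>l>0. \<forall>t\<in>{0..<T}. l \<le> d t)"
      by (rule decreasing_tendsto_0_or_bounded_below[OF \<open>0 < T\<close> dpos(1) mono])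
    then show ?thesis
    proof (elim disjE exE conjE)
      assume lim: "filterlim (\<lambda>t. inverse (d t)) at_top (at_left T)"
      define r where "r = min 1 (norm z)"
      have "r > 0" using G_pos(1)[of z] z by (auto simp: r_def G_def)
      have lim': "filterlim (\<lambda>t. r * inverse (d t)) at_top (at_left T)"
        by (rule filterlim_tendsto_pos_mult_at_top[OF tendsto_const \<open>r > 0\<close> lim])
      have "eventually (\<lambda>t. r * inverse (d t) \<le> norm (f2 (y t))) (at_left T)"
        using eventually_at_left_real[OF \<open>0 < T\<close>]
      proof eventually_elim
        case (elim t)
        then have t: "t \<in> {0..<T}" by simp
        have "r \<le> norm (y t)"
          using \<sigma> d\<delta>[OF t] dpos[OF t] by (auto simp: r_def d_def \<delta>_def)
        then have "r * inverse (d t) \<le> norm (y t) * inverse (d t)"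
          using dpos[OF t] by (intro mult_right_mono) auto
        also have "\<dots> = norm (f2 (y t))"
          using dpos[OF t] \<sigma> by (auto simp: f2_eq d_def abs_if)
        finally show ?case .
      qed
      then show ?thesis by (intro disjI1 filterlim_at_top_mono[OF lim'])
    next
      fix l assume l: "0 < l" "\<forall>t\<in>{0..<T}. l \<le> d t"
      define C where "C = {v::real^2. l \<le> \<sigma> * (1 - norm v) \<and> \<sigma> * (1 - norm v) \<le> \<delta>}"
      have "closed C" unfolding C_def by (intro closed_Collect_conj closed_Collect_le continuous_intros)
      moreover have "bounded C"
        by (rule boundedI[of _ "1 + \<delta>"]) (use l(1) \<sigma> in \<open>auto simp: C_def\<close>)
      moreover have "C \<subseteq> dom_f2" using l(1) by (auto simp: C_def dom_f2_def)
      moreover have "y ` {0..<T} \<subseteq> C"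
        using d\<delta> l(2) by (simp add: C_def image_subset_iff flip: d_def)
      ultimately show ?thesis by (auto simp: compact_eq_bounded_closed)
    qed
  qed
  ultimately show "T \<le> \<delta> / K \<and> (filterlim (\<lambda>t. norm (f2 (y t))) at_top (at_left T) \<or>
       (\<exists>C. compact C \<and> C \<subseteq> dom_f2 \<and> y ` {0..<T} \<subseteq> C))" by blast
qed

text \<open>
  To the left of the line \<open>y\<^sub>1 = 1\<close> the region is the one for \<open>m = K + 1/K - 1\<close>, where \<open>m \<ge> 1\<close> is the
  inequality \<open>(K - 1)\<^sup>2 \<ge> 0\<close> divided by \<open>K\<close>. To the right of it, \<open>m = K + 1\<close>.
\<close>
lemma quenches_f1:
  assumes K: "0 < K" and z: "z \<in> S_f1 K"
  shows "z \<in> dom_f1" "quenches f1 dom_f1 K z"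
proof -
  show "z \<in> dom_f1" using z by (auto simp: S_f1_def dom_f1_def)
  from z consider
      (below) "z$1 < 1" "1 - 1 / (2 * K) < z$1" "K + 1 / K - 1 < z$2"
    | (above) "1 < z$1" "z$1 < 1 + 1 / (2 * K)" "K + 1 < z$2"
    by (auto simp: S_f1_def)
  then show "quenches f1 dom_f1 K z"
  proof cases
    case below
    define h where "h = 1 / (2 * K)"
    have h: "1 / K = h + h" "0 < h" using K by (simp_all add: h_def field_simps)
    have "0 \<le> (K - 1)\<^sup>2 / K" using K by simp
    also have "\<dots> = K + 1 / K - 2" using K by (simp add: power2_eq_square field_simps)
    finally have "1 \<le> K + 1 / K - 1" by simp
    moreover have "K \<le> x + (K + 1 / K - 1)" if "1 * (1 - x) < 1 / (2 * K)" for x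
      using that h(2) unfolding h(1) h_def[symmetric] by simp
    ultimately show ?thesis
      using below by (intro quenches_f1_branch[where \<sigma> = 1 and m = "K + 1 / K - 1"] K) auto
  next
    case above
    then show ?thesis
      using K by (intro quenches_f1_branch[where \<sigma> = "- 1" and m = "K + 1"] K) auto
  qed
qed

lemma quenches_f2:
  assumes K: "0 < K" and z: "z \<in> S_f2 K"
  shows "z \<in> dom_f2" "quenches f2 dom_f2 K z"
proof -
  show "z \<in> dom_f2" using z by (auto simp: S_f2_def dom_f2_def)
  from z consider
      (below) "norm z < 1" "1 - 1 / (2 * K + 1) < norm z"
    | (above) "1 < norm z" "norm z < 1 + 1 / (2 * K)"
    by (auto simp: S_f2_def)
  then show "quenches f2 dom_f2 K z"
  proof cases
    case below
    have "(1 - norm z) * (2 * K + 1) < 1"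
      using below(2) K by (simp add: field_simps)
    then show ?thesis
      using below by (intro quenches_f2_branch[where \<sigma> = 1] K) (auto simp: algebra_simps)
  next
    case above
    have "(norm z - 1) * (2 * K) < 1" using above(2) K by (simp add: field_simps)
    then show ?thesis
      using above by (intro quenches_f2_branch[where \<sigma> = "- 1"] K) (auto simp: algebra_simps)
  qed
qed

lemma quenches_f3:
  assumes K: "0 < K" and z: "z \<in> S_f3 K"
  shows "z \<in> dom_f3" "quenches f3 dom_f3 K z"
proof -
  show "z \<in> dom_f3" using z by (auto simp: S_f3_def dom_f3_def)
  have le: "exp (- 3 / 2) / (2 * K) \<le> 1 / (2 * K)" using K by (intro divide_right_mono) auto
  from z consider
      (below) "\<forall>i. z$i < 1" "\<forall>i. 1 - exp (- 3 / 2) / (2 * K) < z$i"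
    | (above) "\<forall>i. 1 < z$i" "\<forall>i. z$i < 1 + exp (- 3 / 2) / (2 * K)"
    unfolding S_f3_def forall_2 by auto
  then show "quenches f3 dom_f3 K z"
  proof cases
    case below
    have "1 * (1 - z$i) < 1 / (2 * K)" for i
    proof -
      have "1 - z$i < exp (- 3 / 2) / (2 * K)" using below(2)[rule_format, of i] by (simp only: algebra_simps)
      also note le
      finally show ?thesis by simp
    qed
    then show ?thesis
      using below(1) by (intro quenches_f3_branch[where \<sigma> = 1] K) auto
  next
    case above
    have "- 1 * (1 - z$i) < 1 / (2 * K)" for i
    proof -
      have "z$i - 1 < exp (- 3 / 2) / (2 * K)" using above(2)[rule_format, of i] by (simp only: algebra_simps)
      also note le
      finally show ?thesis by simp
    qed
    then show ?thesis
      using above(1) by (intro quenches_f3_branch[where \<sigma> = "- 1"] K) auto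
  qed
qed

section \<open>Closedness of the set of forcings\<close>

lemma U_ad_ae: "u \<in> U_ad \<rho> \<Longrightarrow> AE t in lebesgue. 0 \<le> t \<longrightarrow> norm (u t) \<le> \<rho>"
  by (simp add: U_ad_def AE_lebesgue_on_nonneg_iff)

lemma U_ad_midpoint:
  assumes "u \<in> U_ad \<rho>" "v \<in> U_ad \<rho>"
  shows "(\<lambda>t. (1/2) *\<^sub>R (u t + v t)) \<in> U_ad \<rho>"
proof -
  have "AE t in lebesgue. 0 \<le> t \<longrightarrow> norm ((1/2) *\<^sub>R (u t + v t)) \<le> \<rho>"
    using U_ad_ae[OF assms(1)] U_ad_ae[OF assms(2)]
  proof eventually_elim
    case (elim t)
    show ?case
    proof
      assume "0 \<le> t"
      then have "norm (u t + v t) \<le> \<rho> + \<rho>" using elim norm_triangle_le[of "u t" "v t"] by force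
      then show "norm ((1/2) *\<^sub>R (u t + v t)) \<le> \<rho>" by simp
    qed
  qed
  moreover have "(\<lambda>t. (1/2) *\<^sub>R (u t + v t)) \<in> borel_measurable (lebesgue_on {0..})"
    using assms by (auto simp: U_ad_def)
  ultimately show ?thesis by (simp add: U_ad_def AE_lebesgue_on_nonneg_iff)
qed

lemma U_ad_on_Icc:
  assumes "u \<in> U_ad \<rho>"
  shows "u \<in> borel_measurable (lebesgue_on {0..H})" "AE t in lebesgue_on {0..H}. norm (u t) \<le> \<rho>"
proof -
  show "u \<in> borel_measurable (lebesgue_on {0..H})"
    using assms by (auto simp: U_ad_def intro: measurable_restrict_mono)
  have "AE t in lebesgue. t \<in> {0..H} \<longrightarrow> norm (u t) \<le> \<rho>"
    using U_ad_ae[OF assms] by (rule eventually_mono) simp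
  then show "AE t in lebesgue_on {0..H}. norm (u t) \<le> \<rho>" by (subst AE_restrict_space_iff) auto
qed

lemma finite_measure_lebesgue_on_Icc: "finite_measure (lebesgue_on {a..b::real})"
  by (rule finite_measureI) (simp add: emeasure_restrict_space emeasure_lborel_Icc_eq)

lemma U_ad_limit:
  assumes u: "\<And>n. u n \<in> U_ad \<rho>" and \<rho>: "0 \<le> \<rho>"
    and cauchy: "AE x in lebesgue_on {0..H}. Cauchy (\<lambda>n. u n x)"
  obtains v where "v \<in> U_ad \<rho>" "AE x in lebesgue_on {0..H}. (\<lambda>n. u n x) \<longlonglongrightarrow> v x"
proof -
  define v where "v x = (if x \<in> {0..H} then lim (\<lambda>n. u n x) else 0)" for x
  have c: "AE x in lebesgue. x \<in> {0..H} \<longrightarrow> Cauchy (\<lambda>n. u n x)"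
    using cauchy by (subst (asm) AE_restrict_space_iff) auto
  have conv: "AE x in lebesgue. x \<in> {0..H} \<longrightarrow> (\<lambda>n. u n x) \<longlonglongrightarrow> v x"
    using c
  proof eventually_elim
    case (elim x)
    then show ?case by (auto simp: v_def Cauchy_convergent_iff convergent_LIMSEQ_iff)
  qed
  have "(\<lambda>x. lim (\<lambda>n. u n x)) \<in> borel_measurable (lebesgue_on {0..H})"
    by (rule borel_measurable_lim_metric) (rule U_ad_on_Icc(1)[OF u])
  then have "v \<in> borel_measurable (lebesgue_on {0..})"
    unfolding v_def by (subst borel_measurable_if_lebesgue_on) auto
  moreover have "AE x in lebesgue. 0 \<le> x \<longrightarrow> norm (v x) \<le> \<rho>"
  proof -
    have "AE x in lebesgue. \<forall>n. 0 \<le> x \<longrightarrow> norm (u n x) \<le> \<rho>"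
      unfolding AE_all_countable using U_ad_ae[OF u] by blast
    with conv show ?thesis
    proof eventually_elim
      case (elim x)
      show ?case
      proof
        assume x: "0 \<le> x"
        show "norm (v x) \<le> \<rho>"
        proof (cases "x \<in> {0..H}")
          case True
          then have "(\<lambda>n. norm (u n x)) \<longlonglongrightarrow> norm (v x)" using elim by (intro tendsto_norm) auto
          then show ?thesis by (rule LIMSEQ_le_const2) (use elim x in auto)
        next
          case False
          then show ?thesis using \<rho> by (simp only: v_def if_False norm_zero)
        qed
      qed
    qed
  qed
  ultimately have "v \<in> U_ad \<rho>" by (simp add: U_ad_def AE_lebesgue_on_nonneg_iff)
  moreover have "AE x in lebesgue_on {0..H}. (\<lambda>n. u n x) \<longlonglongrightarrow> v x"
    using conv by (subst AE_restrict_space_iff) auto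
  ultimately show ?thesis by (rule that)
qed

text \<open>
  The Hilbert space argument behind weak compactness. The infimum \<open>d n\<close> of the squared \<open>L\<^sup>2\<close> norm over
  \<open>C n\<close> increases with \<open>n\<close> and is bounded, hence converges. If \<open>v n\<close> is nearly minimal in \<open>C n\<close>, then
  the midpoint of \<open>v n\<close> and \<open>v k\<close> for \<open>k \<ge> n\<close> is still in \<open>C n\<close>, and the parallelogram law bounds the
  \<open>L\<^sup>2\<close> distance of \<open>v n\<close> and \<open>v k\<close> by the increase of \<open>d\<close>. A subsequence of the resulting \<open>L\<^sup>1\<close> Cauchy
  sequence is Cauchy almost everywhere.
\<close>
lemma near_minimal_midpoint_Cauchy:
  fixes C :: "nat \<Rightarrow> ('a \<Rightarrow> 'b::euclidean_space) set"
  assumes "finite_measure M" and meas: "\<And>n u. u \<in> C n \<Longrightarrow> u \<in> borel_measurable M"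
    and bd: "\<And>n u. u \<in> C n \<Longrightarrow> AE x in M. norm (u x) \<le> \<rho>"
    and mid: "\<And>n u u'. \<lbrakk>u \<in> C n; u' \<in> C n\<rbrakk> \<Longrightarrow> (\<lambda>x. (1/2) *\<^sub>R (u x + u' x)) \<in> C n"
    and decr: "\<And>m n. m \<le> n \<Longrightarrow> C n \<subseteq> C m" and ne: "\<And>n. C n \<noteq> {}"
  obtains v where "\<And>n. v n \<in> C n" "AE x in M. Cauchy (\<lambda>n. v n x)"
proof -
  interpret finite_measure M by fact
  define q where "q u = (LINT x|M. (norm (u x))\<^sup>2)" for u :: "'a \<Rightarrow> 'b"
  have int1: "integrable M u" if "u \<in> C n" for n u
    using bd[OF that] meas[OF that] by (rule integrable_const_bound)
  have int2: "integrable M (\<lambda>x. (norm (u x))\<^sup>2)" if "u \<in> C n" for n u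
  proof (rule integrable_const_bound[where B = "\<rho>\<^sup>2"])
    show "AE x in M. norm ((norm (u x))\<^sup>2) \<le> \<rho>\<^sup>2"
      using bd[OF that] by (rule eventually_mono) (simp add: power_mono)
  qed (use meas[OF that] in measurable)
  have q_nonneg: "0 \<le> q u" for u unfolding q_def by simp
  have q_bound: "q u \<le> \<rho>\<^sup>2 * measure M (space M)" if "u \<in> C n" for n u
  proof -
    have "q u \<le> (LINT x|M. \<rho>\<^sup>2)"
      unfolding q_def
    proof (rule integral_mono_AE[OF int2[OF that]])
      show "AE x in M. (norm (u x))\<^sup>2 \<le> \<rho>\<^sup>2"
        using bd[OF that] by (rule eventually_mono) (simp add: power_mono)
    qed simp
    then show ?thesis by (simp add: mult.commute)
  qed
  have parallelogram: "(norm (a - b))\<^sup>2 = 2 * (norm a)\<^sup>2 + 2 * (norm b)\<^sup>2 - 4 * (norm ((1/2) *\<^sub>R (a + b)))\<^sup>2" for a b :: 'b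
    by (simp add: power2_norm_eq_inner inner_add_left inner_add_right inner_diff_left inner_diff_right inner_commute algebra_simps)
  have q_diff: "q (\<lambda>x. u x - u' x) = 2 * q u + 2 * q u' - 4 * q (\<lambda>x. (1/2) *\<^sub>R (u x + u' x))"
      "integrable M (\<lambda>x. (norm (u x - u' x))\<^sup>2)"
    if "u \<in> C n" "u' \<in> C n" for n u u'
    using int2[OF that(1)] int2[OF that(2)] int2[OF mid[OF that]] unfolding q_def parallelogram by simp_all
  define d where "d n = (INF u\<in>C n. q u)" for n
  have bdd: "bdd_below (q ` C n)" for n by (rule bdd_belowI2[of _ 0]) (rule q_nonneg)
  have d_le: "d n \<le> q u" if "u \<in> C n" for n u unfolding d_def by (rule cINF_lower[OF bdd that])
  have "incseq d"
    unfolding d_def by (intro incseq_SucI cINF_superset_mono ne bdd decr) auto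
  moreover have "d n \<le> \<rho>\<^sup>2 * measure M (space M)" for n
    using ne[of n] d_le q_bound by (meson all_not_in_conv order_trans)
  ultimately have "Cauchy d" by (metis incseq_convergent LIMSEQ_imp_Cauchy)
  have "\<exists>u\<in>C n. q u < d n + 1 / real (Suc n)" for n
  proof -
    have "(INF u\<in>C n. q u) < d n + 1 / real (Suc n)" by (simp add: d_def)
    then show ?thesis by (simp only: cINF_less_iff[OF ne bdd])
  qed
  then obtain v where v: "\<And>n. v n \<in> C n" "\<And>n. q (v n) < d n + 1 / real (Suc n)" by metis
  have q_le: "q (\<lambda>x. v n x - v k x) \<le> 2 * (d k - d n) + 4 * (1 / real (Suc n))" if "n \<le> k" for n k
  proof -
    have vk: "v k \<in> C n" using v(1) decr[OF that] by blast
    have "4 * d n \<le> 4 * q (\<lambda>x. (1/2) *\<^sub>R (v n x + v k x))" using d_le[OF mid[OF v(1) vk]] by simp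
    moreover have "1 / real (Suc k) \<le> 1 / real (Suc n)" using that by (intro divide_left_mono) auto
    ultimately show ?thesis using v(2)[of n] v(2)[of k] unfolding q_diff(1)[OF v(1) vk] by simp
  qed
  have L1: "(LINT x|M. norm (v n x - v k x)) \<le> (\<eta> * measure M (space M) + q (\<lambda>x. v n x - v k x) / \<eta>) / 2"
    if "\<eta> > 0" "n \<le> k" for \<eta> n k
  proof -
    have vk: "v k \<in> C n" using v(1) decr[OF that(2)] by blast
    \<comment> \<open>On a space of finite measure, the inequality of arithmetic and geometric means with a free
       parameter \<open>\<eta>\<close> compares \<open>L\<^sup>1\<close> with \<open>L\<^sup>2\<close>.\<close>
    have le: "norm z \<le> (\<eta> + (norm z)\<^sup>2 / \<eta>) / 2" for z :: 'b
    proof -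
      have "2 * norm z * \<eta> \<le> \<eta> * \<eta> + (norm z)\<^sup>2"
      proof -
        have "(norm z - \<eta>)\<^sup>2 = \<eta> * \<eta> + (norm z)\<^sup>2 - 2 * norm z * \<eta>"
          by (simp add: power2_eq_square algebra_simps)
        moreover have "0 \<le> (norm z - \<eta>)\<^sup>2" by (rule zero_le_power2)
        ultimately show ?thesis by linarith
      qed
      then show ?thesis using \<open>\<eta> > 0\<close> by (simp add: field_simps)
    qed
    have "(LINT x|M. norm (v n x - v k x)) \<le> (LINT x|M. (\<eta> + (norm (v n x - v k x))\<^sup>2 / \<eta>) / 2)"
      by (rule integral_mono) (use int1[OF v(1), of n] int1[OF vk] q_diff(2)[OF v(1) vk] le in auto)
    also have "\<dots> = (\<eta> * measure M (space M) + q (\<lambda>x. v n x - v k x) / \<eta>) / 2"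
      using q_diff(2)[OF v(1) vk] by (simp add: q_def mult.commute)
    finally show ?thesis .
  qed
  have small: "\<exists>N. \<forall>n\<ge>N. \<forall>k\<ge>n. (LINT x|M. norm (v n x - v k x)) < e" if "e > 0" for e
  proof -
    define m where "m = measure M (space M)"
    define \<eta> where "\<eta> = e / (m + 1)"
    have "m \<ge> 0" by (simp add: m_def)
    then have \<eta>: "\<eta> > 0" "\<eta> * m < e" using \<open>e > 0\<close> by (auto simp: \<eta>_def field_simps)
    then have e8: "e * \<eta> / 8 > 0" using \<open>e > 0\<close> by simp
    obtain N1 where N1: "\<And>n k. n \<ge> N1 \<Longrightarrow> k \<ge> N1 \<Longrightarrow> \<bar>d k - d n\<bar> < e * \<eta> / 8"
      using CauchyD[OF \<open>Cauchy d\<close> e8] by auto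
    obtain N2 where N2: "inverse (real (Suc N2)) < e * \<eta> / 8" using reals_Archimedean[OF e8] by blast
    have "(LINT x|M. norm (v n x - v k x)) < e" if n: "n \<ge> max N1 N2" "k \<ge> n" for n k
    proof -
      define s where "s = 1 / real (Suc n)"
      define c where "c = e * \<eta> / 8"
      have "s \<le> inverse (real (Suc N2))" using n by (simp add: s_def inverse_eq_divide frac_le)
      then have "s < c" using N2 by (simp add: c_def)
      moreover have "d k - d n < c" using abs_ge_self[of "d k - d n"] N1[of n k] n by (simp add: c_def)
      ultimately have "2 * (d k - d n) + 4 * s < 2 * c + 4 * c" by (intro add_strict_mono) simp_all
      also have "\<dots> < 8 * c" using e8 by (simp add: c_def mult.commute)
      finally have "2 * (d k - d n) + 4 * s < 8 * c" .
      moreover have "8 * c = e * \<eta>" by (simp add: c_def)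
      ultimately have "2 * (d k - d n) + 4 * s < e * \<eta>" by simp
      then have "q (\<lambda>x. v n x - v k x) / \<eta> < e"
        using q_le[OF n(2)] \<eta>(1) by (simp add: divide_less_eq s_def)
      then show ?thesis using L1[OF \<eta>(1) n(2)] \<eta>(2) by (simp add: m_def)
    qed
    then show ?thesis by blast
  qed
  obtain r where r: "strict_mono r" "AE x in M. Cauchy (\<lambda>i. v (r i) x)"
  proof (rule cauchy_L1_AE_cauchy_subseq[of M v])
    show "integrable M (v n)" for n by (rule int1[OF v(1)])
    fix e :: real assume "e > 0"
    then obtain N where N: "\<And>n k. n \<ge> N \<Longrightarrow> k \<ge> n \<Longrightarrow> (LINT x|M. norm (v n x - v k x)) < e"
      using small by blast
    show "\<exists>N. \<forall>i\<ge>N. \<forall>j\<ge>N. (LINT x|M. norm (v i x - v j x)) < e"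
    proof (intro exI[of _ N] allI impI)
      fix i j assume ij: "N \<le> i" "N \<le> j"
      show "(LINT x|M. norm (v i x - v j x)) < e"
        using N[of i j] N[of j i] ij by (cases "i \<le> j") (simp_all add: norm_minus_commute)
    qed
  qed (rule that)
  show ?thesis
  proof (rule that[of "\<lambda>n. v (r n)"])
    show "v (r n) \<in> C n" for n using v(1)[of "r n"] decr[OF seq_suble[OF r(1)]] by blast
  qed (rule r(2))
qed

text \<open>
  The controls \<open>u n\<close> themselves need not converge in any strong sense. However, the set \<open>C n\<close> of all
  admissible controls with forcing within \<open>1/(n+1)\<close> of \<open>w\<close> is closed under midpoints, so it contains
  controls that do converge almost everywhere, and dominated convergence identifies the forcing of
  their limit.
\<close>
lemma forcing_set_closed:
  fixes u :: "nat \<Rightarrow> real \<Rightarrow> real^2"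
  assumes B: "B \<in> borel_measurable (lebesgue_on {0..})" "AE s in lebesgue. 0 \<le> s \<longrightarrow> onorm ((*v) (B s)) \<le> m" "m > 0"
    and "0 \<le> \<rho>" and u: "\<And>n. u n \<in> U_ad \<rho>"
    and lim: "\<And>e. 0 < e \<Longrightarrow> \<exists>N. \<forall>n t. n \<ge> N \<and> t \<in> {0..H} \<longrightarrow> norm (forcing B (u n) t - w t) < e"
  obtains v where "v \<in> U_ad \<rho>" "\<And>t. t \<in> {0..H} \<Longrightarrow> forcing B v t = w t"
proof -
  have bdd: "ess_bounded (m * \<rho>) (\<lambda>s. B s *v v s)" if "v \<in> U_ad \<rho>" for v
    by (rule ess_bounded_forcing[OF B that])
  have K: "0 \<le> m * \<rho>" using \<open>m > 0\<close> \<open>0 \<le> \<rho>\<close> by simp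
  have half_diff: "(1/2) *\<^sub>R (a + b) - c = (1/2) *\<^sub>R ((a - c) + (b - c))" for a b c :: "real^2"
    by (simp add: vec_eq_iff field_simps)
  define C where "C n = {v \<in> U_ad \<rho>. \<forall>t\<in>{0..H}. norm (forcing B v t - w t) \<le> 1 / real (Suc n)}" for n
  obtain v where v: "\<And>n. v n \<in> C n" "AE x in lebesgue_on {0..H}. Cauchy (\<lambda>n. v n x)"
  proof (rule near_minimal_midpoint_Cauchy[of "lebesgue_on {0..H}" C \<rho>])
    show "finite_measure (lebesgue_on {0..H})" by (rule finite_measure_lebesgue_on_Icc)
    show "u \<in> borel_measurable (lebesgue_on {0..H})" if "u \<in> C n" for n u
      using that by (intro U_ad_on_Icc) (auto simp: C_def)
    show "AE x in lebesgue_on {0..H}. norm (u x) \<le> \<rho>" if "u \<in> C n" for n u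
      using that by (intro U_ad_on_Icc) (auto simp: C_def)
    show "(\<lambda>x. (1/2) *\<^sub>R (u x + u' x)) \<in> C n" if uu: "u \<in> C n" "u' \<in> C n" for n u u'
    proof -
      have U: "u \<in> U_ad \<rho>" "u' \<in> U_ad \<rho>" using uu by (auto simp: C_def)
      have "norm (forcing B (\<lambda>x. (1/2) *\<^sub>R (u x + u' x)) t - w t) \<le> 1 / real (Suc n)" if t: "t \<in> {0..H}" for t
      proof -
        have i: "(\<lambda>s. B s *v u s) integrable_on {0..t}" "(\<lambda>s. B s *v u' s) integrable_on {0..t}"
          using t by (auto intro!: ess_bounded_integral(1)[OF bdd[OF U(1)] K] ess_bounded_integral(1)[OF bdd[OF U(2)] K])
        have "forcing B (\<lambda>x. (1/2) *\<^sub>R (u x + u' x)) t = (1/2) *\<^sub>R (forcing B u t + forcing B u' t)"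
          unfolding forcing_def
          by (simp add: linear_scale[OF matrix_vector_mul_linear] matrix_vector_right_distrib
              Henstock_Kurzweil_Integration.integral_add[OF i] del: scaleR_half_double)
        then have "norm (forcing B (\<lambda>x. (1/2) *\<^sub>R (u x + u' x)) t - w t)
            = norm ((1/2) *\<^sub>R ((forcing B u t - w t) + (forcing B u' t - w t)))"
          by (simp add: half_diff)
        also have "\<dots> \<le> (norm (forcing B u t - w t) + norm (forcing B u' t - w t)) / 2"
          using norm_triangle_ineq[of "forcing B u t - w t" "forcing B u' t - w t"] by simp
        also have "\<dots> \<le> 1 / real (Suc n)"
        proof -
          have "norm (forcing B u t - w t) \<le> 1 / real (Suc n)" "norm (forcing B u' t - w t) \<le> 1 / real (Suc n)"
            using uu t by (auto simp: C_def simp del: of_nat_Suc)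
          then show ?thesis
            using field_sum_of_halves[of "1 / real (Suc n)"] by (simp only: add_divide_distrib)
        qed
        finally show ?thesis .
      qed
      then show ?thesis using U_ad_midpoint[OF U] by (simp add: C_def)
    qed
    show "C n \<subseteq> C m" if "m \<le> n" for m n
    proof -
      have "1 / real (Suc n) \<le> 1 / real (Suc m)" using that by (intro divide_left_mono) auto
      then show ?thesis by (auto simp: C_def intro: order_trans simp del: of_nat_Suc)
    qed
    show "C n \<noteq> {}" for n
    proof -
      obtain N where N: "\<forall>n' t. n' \<ge> N \<and> t \<in> {0..H} \<longrightarrow> norm (forcing B (u n') t - w t) < 1 / real (Suc n)"
        using lim[of "1 / real (Suc n)"] by auto
      have "norm (forcing B (u N) t - w t) \<le> 1 / real (Suc n)" if "t \<in> {0..H}" for t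
        by (rule less_imp_le[OF N[rule_format]]) (use that in simp)
      then have "u N \<in> C n" using u[of N] by (simp add: C_def)
      then show ?thesis by blast
    qed
  qed (rule that)
  have vU: "v n \<in> U_ad \<rho>" for n using v(1) by (auto simp: C_def)
  obtain V where V: "V \<in> U_ad \<rho>" "AE x in lebesgue_on {0..H}. (\<lambda>n. v n x) \<longlonglongrightarrow> V x"
    by (rule U_ad_limit[OF vU \<open>0 \<le> \<rho>\<close> v(2)], rule that)
  have "forcing B V t = w t" if t: "t \<in> {0..H}" for t
  proof -
    let ?M = "lebesgue_on {0..t}"
    interpret finite_measure ?M by (rule finite_measure_lebesgue_on_Icc)
    have meas: "(\<lambda>s. B s *v u s) \<in> borel_measurable ?M" if "u \<in> U_ad \<rho>" for u
      using bdd[OF that] unfolding ess_bounded_def by (auto intro: measurable_restrict_mono)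
    have bound: "AE s in ?M. norm (B s *v u s) \<le> m * \<rho>" if "u \<in> U_ad \<rho>" for u
    proof -
      have "AE s in lebesgue. s \<in> {0..t} \<longrightarrow> norm (B s *v u s) \<le> m * \<rho>"
        using bdd[OF that] unfolding ess_bounded_def by (auto elim: eventually_mono)
      then show ?thesis by (subst AE_restrict_space_iff) auto
    qed
    have eq: "forcing B u t = (LINT s|?M. B s *v u s)" if "u \<in> U_ad \<rho>" for u
      unfolding forcing_def
      by (rule lebesgue_integral_eq_integral[symmetric])
         (use integrable_const_bound[OF bound[OF that] meas[OF that]] in auto)
    have ae: "AE s in ?M. (\<lambda>n. B s *v v n s) \<longlonglongrightarrow> B s *v V s"
    proof -
      have "AE s in lebesgue. s \<in> {0..H} \<longrightarrow> (\<lambda>n. v n s) \<longlonglongrightarrow> V s"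
        using V(2) by (subst (asm) AE_restrict_space_iff) auto
      then have "AE s in lebesgue. s \<in> {0..t} \<longrightarrow> (\<lambda>n. B s *v v n s) \<longlonglongrightarrow> B s *v V s"
      proof (rule eventually_mono)
        fix s assume s: "s \<in> {0..H} \<longrightarrow> (\<lambda>n. v n s) \<longlonglongrightarrow> V s"
        show "s \<in> {0..t} \<longrightarrow> (\<lambda>n. B s *v v n s) \<longlonglongrightarrow> B s *v V s"
          using s t bounded_linear.tendsto[OF matrix_vector_mul_bounded_linear] by fastforce
      qed
      then show ?thesis by (subst AE_restrict_space_iff) auto
    qed
    have "(\<lambda>n. LINT s|?M. B s *v v n s) \<longlonglongrightarrow> (LINT s|?M. B s *v V s)"
      by (rule integral_dominated_convergence[where w = "\<lambda>_. m * \<rho>"])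
         (use meas[OF vU] meas[OF V(1)] ae bound[OF vU] in auto)
    then have "(\<lambda>n. forcing B (v n) t) \<longlonglongrightarrow> forcing B V t" by (simp add: eq vU V(1))
    moreover have "(\<lambda>n. forcing B (v n) t) \<longlonglongrightarrow> w t"
    proof (rule LIM_zero_cancel, rule Lim_null_comparison)
      show "\<forall>\<^sub>F n in sequentially. norm (forcing B (v n) t - w t) \<le> 1 / real (Suc n)"
        using v(1) t by (intro always_eventually) (auto simp: C_def)
      show "(\<lambda>n. 1 / real (Suc n)) \<longlonglongrightarrow> 0" using LIMSEQ_inverse_real_of_nat by (simp add: inverse_eq_divide)
    qed
    ultimately show ?thesis by (rule LIMSEQ_unique)
  qed
  then show ?thesis using that V(1) by blast
qed

section \<open>Existence of optimal controls\<close>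

text \<open>
  The direct method of the calculus of variations, with uniform convergence of forcings as the
  topology.
\<close>
lemma exists_minimal_quenching_time:
  assumes B: "B \<in> borel_measurable (lebesgue_on {0..})" "AE s in lebesgue. 0 \<le> s \<longrightarrow> onorm ((*v) (B s)) \<le> m" "m > 0"
    and "0 < \<rho>" and field: "lipschitz_field f D" and y0: "y0 \<in> D" and q: "quenches f D (m * \<rho>) y0"
  shows "\<exists>v\<in>U_ad \<rho>. T_q f D B y0 v = (INF u\<in>U_ad \<rho>. T_q f D B y0 u)"
proof -
  interpret lipschitz_field f D by (rule field)
  let ?K = "m * \<rho>" and ?T = "T_q f D B y0"
  have K: "0 \<le> ?K" using \<open>m > 0\<close> \<open>0 < \<rho>\<close> by simp
  have bdd: "ess_bounded ?K (\<lambda>s. B s *v u s)" if "u \<in> U_ad \<rho>" for u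
    by (rule ess_bounded_forcing[OF B that])
  have T_max: "T_max f D B y0 u = ereal (?T u)" and T_pos: "0 < ?T u" if "u \<in> U_ad \<rho>" for u
    using T_max_eq_T_q[OF field bdd[OF that] K y0 q] by auto
  have lip: "?K-lipschitz_on {0..} (forcing B u)" if "u \<in> U_ad \<rho>" for u
    by (rule forcing_lipschitz[OF field bdd[OF that] K y0])
  have ne: "U_ad \<rho> \<noteq> {}"
  proof -
    have "(\<lambda>_. 0) \<in> U_ad \<rho>" using \<open>0 < \<rho>\<close> by (simp add: U_ad_def)
    then show ?thesis by blast
  qed
  have below: "bdd_below (?T ` U_ad \<rho>)" by (rule bdd_belowI2[of _ 0]) (rule less_imp_le[OF T_pos])
  define t where "t = (INF u\<in>U_ad \<rho>. ?T u)"
  have t_le: "t \<le> ?T u" if "u \<in> U_ad \<rho>" for u unfolding t_def by (rule cINF_lower[OF below that])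
  have "0 \<le> t" unfolding t_def by (rule cINF_greatest[OF ne]) (rule less_imp_le[OF T_pos])
  have "\<exists>u\<in>U_ad \<rho>. ?T u < t + 1 / real (Suc n)" for n
  proof -
    have "(INF u\<in>U_ad \<rho>. ?T u) < t + 1 / real (Suc n)" by (simp add: t_def)
    then show ?thesis by (simp only: cINF_less_iff[OF ne below])
  qed
  then obtain u where u: "\<And>n. u n \<in> U_ad \<rho>" "\<And>n. ?T (u n) < t + 1 / real (Suc n)" by metis
  define H where "H = t + 1"
  obtain g k where g: "continuous_on {0..H} g" "strict_mono (k :: nat \<Rightarrow> nat)"
    "\<And>e. 0 < e \<Longrightarrow> \<exists>N. \<forall>n x. n \<ge> N \<and> x \<in> {0..H} \<longrightarrow> norm (forcing B (u (k n)) x - g x) < e"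
  proof (rule Arzela_Ascoli[of "{0..H}" "\<lambda>n. forcing B (u n)" "?K * H"])
    show "norm (forcing B (u n) x) \<le> ?K * H" if x: "x \<in> {0..H}" for n x
    proof -
      have "norm (forcing B (u n) x) \<le> ?K * x"
        using lipschitz_onD[OF lip[OF u(1)], of x 0] x by (simp add: dist_norm forcing_def)
      also have "\<dots> \<le> ?K * H" using x K by (intro mult_left_mono) auto
      finally show ?thesis .
    qed
    show "\<exists>d>0. \<forall>n y. y \<in> {0..H} \<and> norm (x - y) < d \<longrightarrow> norm (forcing B (u n) x - forcing B (u n) y) < e"
      if x: "x \<in> {0..H}" and e: "0 < e" for x e
    proof (intro exI[of _ "e / (?K + 1)"] conjI allI impI)
      show "0 < e / (?K + 1)" using e K by simp
      fix n y assume y: "y \<in> {0..H} \<and> norm (x - y) < e / (?K + 1)"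
      have "norm (forcing B (u n) x - forcing B (u n) y) \<le> ?K * norm (x - y)"
        using lipschitz_onD[OF lip[OF u(1)], of x y] x y by (simp add: dist_norm)
      also have "\<dots> \<le> ?K * (e / (?K + 1))" using y K by (intro mult_left_mono) auto
      also have "\<dots> < e" using e K by (simp add: field_simps)
      finally show "norm (forcing B (u n) x - forcing B (u n) y) < e" .
    qed
  qed (auto intro: that)
  obtain v where v: "v \<in> U_ad \<rho>" "\<And>t. t \<in> {0..H} \<Longrightarrow> forcing B v t = g t"
  proof (rule forcing_set_closed[OF B less_imp_le[OF \<open>0 < \<rho>\<close>], where u = "\<lambda>n. u (k n)" and w = g and H = H])
    show "u (k n) \<in> U_ad \<rho>" for n by (rule u(1))
    show "\<exists>N. \<forall>n t. n \<ge> N \<and> t \<in> {0..H} \<longrightarrow> norm (forcing B (u (k n)) t - g t) < e" if "0 < e" for e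
      by (rule g(3)[OF that])
  qed (rule that)
  have "?T v \<le> t"
  proof (rule ccontr)
    assume "\<not> ?T v \<le> t"
    define b where "b = min H ((t + ?T v) / 2)"
    have b: "t < b" "b \<le> H" "b < ?T v" "0 \<le> b"
      using \<open>\<not> ?T v \<le> t\<close> \<open>0 \<le> t\<close> by (auto simp: b_def H_def min_def)
    define y where "y = traj f D B y0 v"
    have y: "int_sol f D y0 (forcing B v) b y"
      unfolding y_def by (rule traj_int_sol[OF field bdd[OF v(1)] K y0 b(4)]) (simp add: T_max[OF v(1)] b)
    have C: "compact (y ` {0..b})" "y ` {0..b} \<noteq> {}" "y ` {0..b} \<subseteq> D"
      using int_solD(1,2)[OF y] b(4) by (auto intro: compact_continuous_image)
    from int_sol_perturb[OF C b(4), of y0] obtain \<delta> where \<delta>: "\<delta> > 0"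
      "\<And>c w w' z. \<lbrakk>0 \<le> c; c \<le> b; int_sol f D y0 w c z; z ` {0..c} \<subseteq> y ` {0..b}; continuous_on {0..c} w';
         \<And>t. t \<in> {0..c} \<Longrightarrow> norm (w' t - w t) \<le> \<delta>\<rbrakk> \<Longrightarrow> \<exists>y'. int_sol f D y0 w' c y'" by metis
    obtain N1 where N1: "\<forall>n x. n \<ge> N1 \<and> x \<in> {0..H} \<longrightarrow> norm (forcing B (u (k n)) x - g x) < \<delta>"
      using g(3)[OF \<delta>(1)] by blast
    obtain N2 where N2: "inverse (real (Suc N2)) < b - t" using reals_Archimedean[of "b - t"] b(1) by auto
    define n where "n = max N1 N2"
    have "\<exists>y'. int_sol f D y0 (forcing B (u (k n))) b y'"
    proof (rule \<delta>(2)[OF b(4) order_refl y order_refl])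
      show "continuous_on {0..b} (forcing B (u (k n)))"
        by (rule continuous_on_subset[OF lipschitz_on_continuous_on[OF lip[OF u(1)]]]) auto
      show "norm (forcing B (u (k n)) t - forcing B v t) \<le> \<delta>" if "t \<in> {0..b}" for t
        using N1[rule_format, of n t] v(2)[of t] that b(2) by (simp add: n_def)
    qed
    then have "ereal b < T_max f D B y0 (u (k n))"
      using less_T_max_iff[OF field bdd[OF u(1)] K y0 b(4)] by blast
    then have "b < ?T (u (k n))" by (simp add: T_max[OF u(1)])
    moreover have "1 / real (Suc (k n)) \<le> inverse (real (Suc N2))"
    proof -
      have "N2 \<le> k n" using seq_suble[OF g(2), of n] by (simp add: n_def)
      then show ?thesis by (simp add: inverse_eq_divide frac_le)
    qed
    ultimately show False using u(2)[of "k n"] N2 by linarith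
  qed
  then have "?T v = t" using t_le[OF v(1)] by simp
  then show ?thesis using v(1) unfolding t_def by blast
qed

theorem theorem1p1:
  fixes B :: "real \<Rightarrow> real^2^2" and \<rho>0 :: real
    and f :: "real^2 \<Rightarrow> real^2" and D S :: "(real^2) set" and y0 :: "real^2"
  assumes "L_infty B"
    and "\<not> (AE s in lebesgue_on {0<..}. B s = 0)"
    and "\<rho>0 > 0"
    and "(f, D, S) \<in> {(f1, dom_f1, S_f1 (K_zero B \<rho>0)),
                      (f2, dom_f2, S_f2 (K_zero B \<rho>0)),
                      (f3, dom_f3, S_f3 (K_zero B \<rho>0))}"
    and "y0 \<in> S"
  shows "\<exists>u'\<in>U_ad \<rho>0. T_q f D B y0 u' = (INF u\<in>U_ad \<rho>0. T_q f D B y0 u)"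
proof -
  obtain m where m: "m > 0" "K_zero B \<rho>0 = m * \<rho>0" "B \<in> borel_measurable (lebesgue_on {0..})"
    "AE s in lebesgue. 0 \<le> s \<longrightarrow> onorm ((*v) (B s)) \<le> m"
    by (rule L_infty_bound[OF assms(1-3)], rule that)
  have K: "0 < m * \<rho>0" using m(1) assms(3) by simp
  have "lipschitz_field f D \<and> y0 \<in> D \<and> quenches f D (m * \<rho>0) y0"
    using assms(4,5) lipschitz_field_f1 lipschitz_field_f2 lipschitz_field_f3
      quenches_f1[OF K] quenches_f2[OF K] quenches_f3[OF K]
    unfolding m(2) by auto
  then show ?thesis using exists_minimal_quenching_time[OF m(3,4,1) assms(3)] by blast
qed

end
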